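(* Let $Nneg(\mathbb A_n)$ be the number, up to isomorphism, of connected non-negative posets $I$ with $|I|=n$ and $\mathrm{Dyn}_I=\mathbb A_{n-\mathrm{crk}_I}$. Then $$Nneg(\mathbb A_n)=\begin{cases}1,& n\in\{1,2\},\\ 2^{n-2}+\frac{1}{2n}\sum_{d\mid n}2^{n/d}\varphi(d)+2^{\frac{n-3}{2}}-\lceil\frac{n+1}{2}\rceil,& n\ge3\text{ odd},\\ 2^{n-2}+\frac{1}{2n}\sum_{d\mid n}2^{n/d}\varphi(d)+2^{\frac n2-2}-\lceil\frac{n+1}{2}\rceil,& n\ge4\text{ even},\end{cases}$$ where $\varphi$ is Euler's totient function. In particular, for $n=1,\dots,21$ these numbers are $1,1,3,5,11,21,42,81,161,312,616,1209,2389,4711,9344,18497,36743,72955,145116,288633,574729$.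
   Context: For a finite poset $I$ on $\{1,\dots,n\}$: $C_I=[c_{ij}]$, $c_{ij}=1$ iff $i\preceq_I j$; $G_I=\tfrac12(C_I+C_I^{tr})$; $q_I(v)=vG_Iv^{tr}$; $I$ is non-negative of corank $\mathrm{crk}_I=r$ if $G_I$ is positive semi-definite of rank $n-r$; $I$ is connected if the underlying graph of its Hasse digraph (arrow $i\to j$ iff $i\prec_I j$ with nothing strictly between) is connected. Dynkin graphs: $\mathbb A_m$ path on $m$ vertices, $\mathbb D_m$ path on $m-1$ vertices plus a vertex attached to the second, $\mathbb E_6,\mathbb E_7,\mathbb E_8$ trees with one branch vertex and arms of $1,2,2$ / $1,2,3$ / $1,2,4$ vertices; $G_\Gamma=E_m-\tfrac12\mathrm{Adj}(\Gamma)$. Dynkin type of a connected non-negative $I$ of corank $r$: $\mathrm{Ker}\,q_I=\{v\in\mathbb Z^n:q_I(v)=0\}$ has a $\mathbb Z$-basis $h^{(1)},\dots,h^{(r)}$ with $h^{(i)}_{k_j}=\delta_{ij}$ for some $k_1<\dots<k_r$; $I'=I\setminus\{k_1,\dots,k_r\}$ is connected positive with $G_{I'}=B^{tr}G_DB$, $B\in GL(n-r,\mathbb Z)$, for a unique Dynkin graph $D$ on $n-r$ vertices; $\mathrm{Dyn}_I:=D$. *)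

theory Defs
  imports "Jordan_Normal_Form.DL_Rank" "HOL-Number_Theory.Totient"
begin

text \<open>A finite poset on the ground set {0..<n} (the paper's {1,...,n}, shifted by one)
  is a relation R :: (nat \<times> nat) set with partial_order_on {0..<n} R
  (reflexive on {0..<n}, R \<subseteq> {0..<n} \<times> {0..<n}, antisymmetric, transitive).\<close>

definition is_poset :: "nat \<Rightarrow> (nat \<times> nat) set \<Rightarrow> bool" where
  "is_poset n R \<longleftrightarrow> partial_order_on {0..<n} R"

definition incmat :: "nat \<Rightarrow> (nat \<times> nat) set \<Rightarrow> real mat" where
  "incmat n R = mat n n (\<lambda>(i,j). if (i,j) \<in> R then 1 else 0)"

definition gram :: "nat \<Rightarrow> (nat \<times> nat) set \<Rightarrow> real mat" where
  "gram n R = (1/2::real) \<cdot>\<^sub>m (incmat n R + transpose_mat (incmat n R))"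

definition qform :: "real mat \<Rightarrow> real vec \<Rightarrow> real" where
  "qform G v = v \<bullet> (G *\<^sub>v v)"

definition psd :: "nat \<Rightarrow> real mat \<Rightarrow> bool" where
  "psd n G \<longleftrightarrow> (\<forall>v \<in> carrier_vec n. 0 \<le> qform G v)"

definition pos_def :: "nat \<Rightarrow> real mat \<Rightarrow> bool" where
  "pos_def n G \<longleftrightarrow> (\<forall>v \<in> carrier_vec n. v \<noteq> 0\<^sub>v n \<longrightarrow> 0 < qform G v)"

definition nonneg_poset :: "nat \<Rightarrow> (nat \<times> nat) set \<Rightarrow> bool" where
  "nonneg_poset n R \<longleftrightarrow> psd n (gram n R)"

definition corank :: "nat \<Rightarrow> (nat \<times> nat) set \<Rightarrow> nat" where
  "corank n R = n - vec_space.rank n (gram n R)"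

definition hasse :: "nat set \<Rightarrow> (nat \<times> nat) set \<Rightarrow> nat \<Rightarrow> nat \<Rightarrow> bool" where
  "hasse A R i j \<longleftrightarrow> i \<in> A \<and> j \<in> A \<and> (i,j) \<in> R \<and> i \<noteq> j \<and>
     \<not> (\<exists>k\<in>A. (i,k) \<in> R \<and> (k,j) \<in> R \<and> k \<noteq> i \<and> k \<noteq> j)"

definition connected_on :: "nat set \<Rightarrow> (nat \<times> nat) set \<Rightarrow> bool" where
  "connected_on A R \<longleftrightarrow>
     (\<forall>i\<in>A. \<forall>j\<in>A. (\<lambda>x y. hasse A R x y \<or> hasse A R y x)\<^sup>*\<^sup>* i j)"

definition connected_poset :: "nat \<Rightarrow> (nat \<times> nat) set \<Rightarrow> bool" where
  "connected_poset n R \<longleftrightarrow> connected_on {0..<n} R"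

definition int_kernel :: "nat \<Rightarrow> (nat \<times> nat) set \<Rightarrow> int vec set" where
  "int_kernel n R = {v \<in> carrier_vec n. qform (gram n R) (map_vec real_of_int v) = 0}"

definition is_Z_basis :: "nat \<Rightarrow> int vec set \<Rightarrow> nat \<Rightarrow> (nat \<Rightarrow> int vec) \<Rightarrow> bool" where
  "is_Z_basis n K r h \<longleftrightarrow>
     (\<forall>i<r. h i \<in> K \<and> h i \<in> carrier_vec n) \<and>
     (\<forall>v\<in>K. \<exists>c :: nat \<Rightarrow> int. v = finsum_vec TYPE(int) n (\<lambda>i. c i \<cdot>\<^sub>v h i) {..<r}) \<and>
     (\<forall>c :: nat \<Rightarrow> int. finsum_vec TYPE(int) n (\<lambda>i. c i \<cdot>\<^sub>v h i) {..<r} = 0\<^sub>v n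
        \<longrightarrow> (\<forall>i<r. c i = 0))"

definition rest_list :: "nat \<Rightarrow> nat set \<Rightarrow> nat list" where
  "rest_list n S = filter (\<lambda>i. i \<notin> S) [0..<n]"

definition sub_poset :: "nat \<Rightarrow> nat set \<Rightarrow> (nat \<times> nat) set \<Rightarrow> (nat \<times> nat) set" where
  "sub_poset n S R = {(a,b). a < length (rest_list n S) \<and> b < length (rest_list n S) \<and>
       (rest_list n S ! a, rest_list n S ! b) \<in> R}"

datatype dynkin = Dyn_A nat | Dyn_D nat | Dyn_E6 | Dyn_E7 | Dyn_E8

fun dyn_size :: "dynkin \<Rightarrow> nat" where
  "dyn_size (Dyn_A m) = m"
| "dyn_size (Dyn_D m) = m"
| "dyn_size Dyn_E6 = 6"
| "dyn_size Dyn_E7 = 7"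
| "dyn_size Dyn_E8 = 8"

fun dyn_valid :: "dynkin \<Rightarrow> bool" where
  "dyn_valid (Dyn_A m) = (1 \<le> m)"
| "dyn_valid (Dyn_D m) = (4 \<le> m)"
| "dyn_valid _ = True"

text \<open>Edges. A_m: path 0-1-...-(m-1). D_m: path 0-...-(m-2) plus vertex m-1 attached to
  vertex 1 (the second vertex). E_k: branch vertex 0 with arms 1 | 2-3 | 4-5-...\<close>

fun dyn_edge :: "dynkin \<Rightarrow> nat \<Rightarrow> nat \<Rightarrow> bool" where
  "dyn_edge (Dyn_A m) i j = (i < m \<and> j < m \<and> (j = i + 1 \<or> i = j + 1))"
| "dyn_edge (Dyn_D m) i j = (i < m \<and> j < m \<and>
      ((i + 1 < m \<and> j + 1 < m \<and> (j = i + 1 \<or> i = j + 1)) \<or>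
       (i = m - 1 \<and> j = 1) \<or> (i = 1 \<and> j = m - 1)))"
| "dyn_edge Dyn_E6 i j = ({i,j} \<in> {{0,1},{0,2},{2,3},{0,4},{4,5}})"
| "dyn_edge Dyn_E7 i j = ({i,j} \<in> {{0,1},{0,2},{2,3},{0,4},{4,5},{5,6}})"
| "dyn_edge Dyn_E8 i j = ({i,j} \<in> {{0,1},{0,2},{2,3},{0,4},{4,5},{5,6},{6,7}})"

definition dyn_gram :: "dynkin \<Rightarrow> real mat" where
  "dyn_gram D = mat (dyn_size D) (dyn_size D)
     (\<lambda>(i,j). (if i = j then 1 else 0) - (if dyn_edge D i j then 1/2 else 0))"

definition Z_congruent :: "nat \<Rightarrow> real mat \<Rightarrow> real mat \<Rightarrow> bool" where
  "Z_congruent m G' G \<longleftrightarrow> (\<exists>B :: int mat. B \<in> carrier_mat m m \<and> (det B = 1 \<or> det B = -1) \<and>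
      G' = transpose_mat (map_mat real_of_int B) * G * map_mat real_of_int B)"

definition dyn_witness :: "nat \<Rightarrow> (nat \<times> nat) set \<Rightarrow> (nat \<Rightarrow> nat) \<Rightarrow> (nat \<Rightarrow> int vec)
    \<Rightarrow> dynkin \<Rightarrow> bool" where
  "dyn_witness n R k h D \<longleftrightarrow>
     (let r = corank n R; S = k ` {..<r}; m = n - r in
       (\<forall>j<r. k j < n) \<and> strict_mono_on {..<r} k \<and>
       is_Z_basis n (int_kernel n R) r h \<and>
       (\<forall>i<r. \<forall>j<r. h i $ k j = (if i = j then 1 else 0)) \<and>
       connected_poset m (sub_poset n S R) \<and>
       pos_def m (gram m (sub_poset n S R)) \<and>
       dyn_size D = m \<and>
       Z_congruent m (gram m (sub_poset n S R)) (dyn_gram D))"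

definition Dyn :: "nat \<Rightarrow> (nat \<times> nat) set \<Rightarrow> dynkin" where
  "Dyn n R = (SOME D. dyn_valid D \<and> (\<exists>k h. dyn_witness n R k h D))"

definition poset_iso :: "nat \<Rightarrow> (nat \<times> nat) set \<Rightarrow> (nat \<times> nat) set \<Rightarrow> bool" where
  "poset_iso n R S \<longleftrightarrow> (\<exists>f. bij_betw f {0..<n} {0..<n} \<and>
      (\<forall>i<n. \<forall>j<n. (i,j) \<in> R \<longleftrightarrow> (f i, f j) \<in> S))"

definition NnegA_posets :: "nat \<Rightarrow> (nat \<times> nat) set set" where
  "NnegA_posets n = {R. is_poset n R \<and> connected_poset n R \<and> nonneg_poset n R \<and>
      Dyn n R = Dyn_A (n - corank n R)}"

definition Nneg_A :: "nat \<Rightarrow> nat" where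
  "Nneg_A n = card (NnegA_posets n // {(R,S). poset_iso n R S})"

end

theory Submission
  imports Defs
begin

text \<open>Twice the Gram matrix has diagonal 2 and off-diagonal entries 0 and 1. If it is non-negative of
  Dynkin type \<open>A\<^sub>m\<close>, it is the Gram matrix of roots \<open>\<epsilon>\<^sub>a - \<epsilon>\<^sub>b\<close>, so every
  element of the poset carries two labels and two elements are comparable exactly if they share a label in the
  same place. Hence the Hasse diagram has all degrees at most 2: a connected poset of type \<open>A\<close> is given
  by an orientation of a path or of a cycle, and conversely every orientation has this type unless it is that
  of a cycle made of at most two monotone runs. Burnside's lemma counts the orientations up to reversal of a
  path and up to the dihedral group of a cycle; among the latter orbits \<open>\<lfloor>n / 2\<rfloor> + 1\<close> have at
  most two runs.

  The converse direction needs a Dynkin type to exist. Inflations \<open>e\<^sub>j \<mapsto> e\<^sub>j - e\<^sub>i\<close>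
  turn a connected unit form into one with non-positive off-diagonal entries, where either a highest root
  argument finds a Dynkin graph or there is a radical vector having a coefficient 1; exchanging vertices
  along such vectors produces a kernel basis of the required shape with a connected complement.\<close>


text \<open>Two obstacles shape the proof. \<open>Dyn\<close> is a Hilbert choice: nothing is known
  about it until some witness exists, and then it may return any witnessed type. Type A is therefore
  recognised by an invariant, \<open>root_rep\<close>, which survives integral congruence and the
  passage from the poset to the complement of the chosen vertices and back. The second obstacle is
  termination of inflations: the tracked vector is determined by bounded data only if the radical is
  contained in the line that it spans. Inflations are therefore run only on positive forms and on
  circuits, forms whose radical is spanned by one vector without zero coordinates;
  \<open>infl_state\<close> covers both after a change of signs. Higher corank is reduced to
  circuits by adding vertices one at a time. For cycles, words are periodic functions on the
  integers: elements are compared on the unrolled line, where the order is that of a path, and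
  winding around the cycle becomes the choice of a lift.\<close>

definition bil :: "'a set \<Rightarrow> ('a \<Rightarrow> 'a \<Rightarrow> 'b::comm_ring_1) \<Rightarrow> ('a \<Rightarrow> 'b) \<Rightarrow> ('a \<Rightarrow> 'b) \<Rightarrow> 'b" where
  "bil S A x y = (\<Sum>i\<in>S. \<Sum>j\<in>S. A i j * x i * y j)"

text \<open>Vectors are functions on the whole type of which only the values on \<open>S\<close>
  count, so restricting a form to a subset changes no carrier. The ring stays general because the
  same identities serve integral and real vectors.\<close>

definition app :: "'a set \<Rightarrow> ('a \<Rightarrow> 'a \<Rightarrow> 'b::comm_ring_1) \<Rightarrow> ('a \<Rightarrow> 'b) \<Rightarrow> 'a \<Rightarrow> 'b" where
  "app S A x i = (\<Sum>j\<in>S. A i j * x j)"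

text \<open>The diagonal is 2 because the forms are twice the Gram matrices, which makes all entries
  integral.\<close>

definition unit_form :: "'a set \<Rightarrow> ('a \<Rightarrow> 'a \<Rightarrow> 'b::comm_ring_1) \<Rightarrow> bool" where
  "unit_form S A \<longleftrightarrow> finite S \<and> (\<forall>i\<in>S. A i i = 2) \<and> (\<forall>i\<in>S. \<forall>j\<in>S. A i j = A j i)"

definition nonneg_form :: "'a set \<Rightarrow> ('a \<Rightarrow> 'a \<Rightarrow> 'b::linordered_idom) \<Rightarrow> bool" where
  "nonneg_form S A \<longleftrightarrow> unit_form S A \<and> (\<forall>x. 0 \<le> bil S A x x)"

lemma unit_formD:
  assumes "unit_form S A"
  shows "finite S" "i \<in> S \<Longrightarrow> A i i = 2" "i \<in> S \<Longrightarrow> j \<in> S \<Longrightarrow> A i j = A j i"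
  using assms unfolding unit_form_def by auto

lemma nonneg_formD:
  assumes "nonneg_form S A"
  shows "unit_form S A" "finite S" "0 \<le> bil S A x x"
  using assms unfolding nonneg_form_def unit_form_def by auto

lemma bil_app: "bil S A x y = (\<Sum>i\<in>S. x i * app S A y i)"
  unfolding bil_def app_def by (simp add: sum_distrib_left mult_ac)

lemma bil_cong:
  assumes "\<And>i. i \<in> S \<Longrightarrow> x i = x' i" "\<And>i. i \<in> S \<Longrightarrow> y i = y' i"
    "\<And>i j. i \<in> S \<Longrightarrow> j \<in> S \<Longrightarrow> A i j = A' i j"
  shows "bil S A x y = bil S A' x' y'"
  unfolding bil_def using assms by (intro sum.cong) auto

lemma app_cong:
  assumes "\<And>i. i \<in> S \<Longrightarrow> x i = x' i" "\<And>j. j \<in> S \<Longrightarrow> A i j = A' i j"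
  shows "app S A x i = app S A' x' i"
  unfolding app_def using assms by (intro sum.cong) auto

lemma bil_sym:
  assumes "unit_form S A"
  shows "bil S A x y = bil S A y x"
proof -
  have "bil S A x y = (\<Sum>i\<in>S. \<Sum>j\<in>S. A j i * x j * y i)"
    unfolding bil_def by (rule sum.swap)
  also have "\<dots> = bil S A y x"
    unfolding bil_def using unit_formD(3)[OF assms] by (intro sum.cong) (auto simp: mult_ac)
  finally show ?thesis .
qed

lemma app_add: "app S A (\<lambda>i. x i + y i) k = app S A x k + app S A y k"
  by (simp add: app_def algebra_simps sum.distrib)

lemma app_scale: "app S A (\<lambda>i. c * x i) k = c * app S A x k"
  by (simp add: app_def sum_distrib_left mult_ac)

lemma app_diff: "app S A (\<lambda>i. x i - y i) k = app S A x k - app S A y k"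
  by (simp add: app_def algebra_simps sum_subtractf)

lemma bil_add_right: "bil S A x (\<lambda>i. y i + z i) = bil S A x y + bil S A x z"
  by (simp add: bil_app app_add algebra_simps sum.distrib)

lemma bil_add_left: "bil S A (\<lambda>i. y i + z i) x = bil S A y x + bil S A z x"
  by (simp add: bil_app algebra_simps sum.distrib)

lemma bil_scale_right: "bil S A x (\<lambda>i. c * y i) = c * bil S A x y"
  by (simp add: bil_app app_scale sum_distrib_left mult_ac)

lemma bil_scale_left: "bil S A (\<lambda>i. c * y i) x = c * bil S A y x"
  by (simp add: bil_app sum_distrib_left mult_ac)

definition unit_at :: "'a \<Rightarrow> 'a \<Rightarrow> 'b::comm_ring_1" where
  "unit_at i j = (if j = i then 1 else 0)"

lemma app_unit_at: "finite S \<Longrightarrow> i \<in> S \<Longrightarrow> app S A (unit_at i) k = A k i"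
  by (simp add: app_def unit_at_def if_distrib[of "(*) _"] sum.delta cong: if_cong)

lemma bil_unit_at_left: "finite S \<Longrightarrow> i \<in> S \<Longrightarrow> bil S A (unit_at i) x = app S A x i"
  by (simp add: bil_app unit_at_def if_distrib[of "\<lambda>c. c * _"] sum.delta cong: if_cong)

lemma bil_combination:
  assumes "unit_form S A"
  shows "bil S A (\<lambda>i. a * x i + b * y i) (\<lambda>i. a * x i + b * y i)
     = a^2 * bil S A x x + 2 * a * b * bil S A x y + b^2 * bil S A y y"
  using bil_sym[OF assms, of y x]
  by (simp add: bil_add_left bil_add_right bil_scale_left bil_scale_right power2_eq_square algebra_simps)

lemma bil_perturb:
  assumes "unit_form S A" "i \<in> S"
  shows "bil S A (\<lambda>k. a * x k + b * unit_at i k) (\<lambda>k. a * x k + b * unit_at i k)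
     = a^2 * bil S A x x + 2 * a * b * app S A x i + 2 * b^2"
proof -
  have fin: "finite S" using assms(1) by (rule unit_formD)
  have "bil S A x (unit_at i) = app S A x i"
    using bil_sym[OF assms(1), of x] bil_unit_at_left[OF fin assms(2), of A] by simp
  moreover have "bil S A (unit_at i) (unit_at i) = 2"
    using bil_unit_at_left[OF fin assms(2), of A] app_unit_at[OF fin assms(2), of A] unit_formD(2)[OF assms] by simp
  ultimately show ?thesis by (simp add: bil_combination[OF assms(1)])
qed

text \<open>With \<open>a = app S A x i\<close>, the vector \<open>-2 a x + e_i\<close> has value
  \<open>2 - 4 a^2\<close>, which is negative for every nonzero integer \<open>a\<close>. So null
  vectors of a non-negative form lie in its radical.\<close>

lemma null_vector_app:
  fixes A :: "'a \<Rightarrow> 'a \<Rightarrow> int"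
  assumes "nonneg_form S A" "bil S A x x = 0" "i \<in> S"
  shows "app S A x i = 0"
proof -
  let ?a = "app S A x i"
  let ?y = "\<lambda>k. (-2 * ?a) * x k + 1 * unit_at i k"
  have "0 \<le> bil S A ?y ?y"
    by (rule nonneg_formD(3)[OF assms(1)])
  also have "\<dots> = 2 - 4 * (?a * ?a)"
    using assms by (subst bil_perturb) (auto simp: nonneg_formD power2_eq_square)
  finally have "?a * ?a \<le> 0" by presburger
  then show ?thesis by (simp add: mult_le_0_iff; linarith)
qed

lemma app_zero_imp_null: "(\<And>i. i \<in> S \<Longrightarrow> app S A x i = 0) \<Longrightarrow> bil S A y x = 0"
  by (simp add: bil_app)

text \<open>Evaluate the form at \<open>x + e_i\<close> and \<open>x - e_i\<close>. Together with
  \<open>entry_bound\<close> this leaves only finitely many inflation states up to equality on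
  \<open>S\<close>.\<close>

lemma app_bound:
  fixes A :: "'a \<Rightarrow> 'a \<Rightarrow> int"
  assumes "nonneg_form S A" "i \<in> S"
  shows "\<bar>app S A x i\<bar> \<le> bil S A x x + 2"
proof -
  have u: "unit_form S A" using assms(1) by (rule nonneg_formD)
  have "0 \<le> bil S A x x + 2 * app S A x i + 2"
    using nonneg_formD(3)[OF assms(1), of "\<lambda>k. 1 * x k + 1 * unit_at i k"] bil_perturb[OF u assms(2), of 1 x 1]
    by simp
  moreover have "0 \<le> bil S A x x - 2 * app S A x i + 2"
    using nonneg_formD(3)[OF assms(1), of "\<lambda>k. 1 * x k + (-1) * unit_at i k"] bil_perturb[OF u assms(2), of 1 x "-1"]
    by simp
  ultimately show ?thesis using nonneg_formD(3)[OF assms(1), of x] by linarith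
qed

lemma entry_bound:
  fixes A :: "'a \<Rightarrow> 'a \<Rightarrow> int"
  assumes "nonneg_form S A" "i \<in> S" "j \<in> S"
  shows "\<bar>A i j\<bar> \<le> 2"
proof -
  have u: "unit_form S A" and fin: "finite S" using assms(1) by (auto dest: nonneg_formD)
  have q: "bil S A (unit_at j) (unit_at j) = 2" "app S A (unit_at j) i = A i j"
    using bil_unit_at_left[OF fin assms(3), of A] app_unit_at[OF fin assms(3), of A] unit_formD(2)[OF u assms(3)] by auto
  have "0 \<le> 4 + 2 * A i j"
    using nonneg_formD(3)[OF assms(1), of "\<lambda>k. 1 * unit_at j k + 1 * unit_at i k"]
      bil_perturb[OF u assms(2), of 1 "unit_at j" 1] q by simp
  moreover have "0 \<le> 4 - 2 * A i j"
    using nonneg_formD(3)[OF assms(1), of "\<lambda>k. 1 * unit_at j k + (-1) * unit_at i k"]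
      bil_perturb[OF u assms(2), of 1 "unit_at j" "-1"] q by simp
  ultimately show ?thesis by linarith
qed

lemma bil_support:
  assumes "T \<subseteq> S" "finite S" "\<And>i. i \<in> S - T \<Longrightarrow> x i = 0" "\<And>i. i \<in> S - T \<Longrightarrow> y i = 0"
  shows "bil S A x y = bil T A x y"
proof -
  have "bil S A x y = (\<Sum>i\<in>T. \<Sum>j\<in>S. A i j * x i * y j)"
    unfolding bil_def using assms by (intro sum.mono_neutral_right) auto
  also have "\<dots> = bil T A x y"
    unfolding bil_def using assms by (intro sum.cong refl sum.mono_neutral_right) auto
  finally show ?thesis .
qed

lemma app_support:
  assumes "T \<subseteq> S" "finite S" "\<And>i. i \<in> S - T \<Longrightarrow> x i = 0"
  shows "app S A x k = app T A x k"
  unfolding app_def using assms by (intro sum.mono_neutral_right) auto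

lemma nonneg_form_subset:
  assumes "nonneg_form S A" "T \<subseteq> S"
  shows "nonneg_form T A"
proof -
  have "0 \<le> bil T A x x" for x
  proof -
    let ?x = "\<lambda>i. if i \<in> T then x i else 0"
    have "bil S A ?x ?x = bil T A ?x ?x"
      using assms nonneg_formD(2) by (intro bil_support) auto
    also have "\<dots> = bil T A x x" by (rule bil_cong) auto
    finally show ?thesis using nonneg_formD(3)[OF assms(1), of ?x] by simp
  qed
  then show ?thesis
    using assms unfolding nonneg_form_def unit_form_def by (meson finite_subset subsetD)
qed

lemma bil_image:
  assumes "inj_on f T"
  shows "bil (f ` T) A x y = bil T (\<lambda>i j. A (f i) (f j)) (x \<circ> f) (y \<circ> f)"
  using assms by (simp add: bil_def sum.reindex)

text \<open>Connectedness is phrased by cuts instead of paths: a cut without crossing entries can be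
  followed through an inflation, whereas paths would have to be rebuilt.\<close>

definition conn_form :: "'a set \<Rightarrow> ('a \<Rightarrow> 'a \<Rightarrow> int) \<Rightarrow> bool" where
  "conn_form S A \<longleftrightarrow> (\<forall>P. P \<subseteq> S \<and> P \<noteq> {} \<and> P \<noteq> S \<longrightarrow> (\<exists>i\<in>P. \<exists>j\<in>S - P. A i j \<noteq> 0))"

subsection \<open>Inflations\<close>

text \<open>These are the entries of the form in the basis with \<open>e_j\<close> replaced by
  \<open>e_j - e_i\<close>. At \<open>(j, j)\<close> both corrections apply, and there the product
  of \<open>e_i\<close> with itself has to be added.\<close>

definition infl :: "'a \<Rightarrow> 'a \<Rightarrow> ('a \<Rightarrow> 'a \<Rightarrow> int) \<Rightarrow> 'a \<Rightarrow> 'a \<Rightarrow> int" where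
  "infl i j A k l = A k l - (if l = j then A k i else 0) - (if k = j then A i l else 0)
     + (if k = j \<and> l = j then A i i else 0)"

lemma app_upd:
  assumes "finite S" "i \<in> S"
  shows "app S A (x(i := x i - c)) k = app S A x k - A k i * c"
proof -
  have "x(i := x i - c) = (\<lambda>l. x l - c * unit_at i l)" by (auto simp: unit_at_def)
  then show ?thesis by (simp add: app_diff app_scale app_unit_at assms)
qed

lemma app_infl:
  assumes "finite S" "i \<in> S" "j \<in> S" "i \<noteq> j"
  shows "app S (infl i j A) y k
    = app S A (y(i := y i - y j)) k - (if k = j then app S A (y(i := y i - y j)) i else 0)"
proof -
  have "app S (infl i j A) y k = app S A y k - A k i * y j
      - (if k = j then app S A y i - A i i * y j else 0)"
    using assms by (auto simp: app_def infl_def algebra_simps sum.distrib sum_subtractf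
        if_distrib[of "(*) _"] sum.delta cong: if_cong)
  then show ?thesis using assms by (simp add: app_upd)
qed

text \<open>The vector with coordinates \<open>x\<close> in the new basis has the old coordinates
  \<open>x\<close>, except for \<open>x i - x j\<close> at \<open>i\<close>.\<close>

lemma bil_infl:
  assumes "finite S" "i \<in> S" "j \<in> S" "i \<noteq> j"
  shows "bil S (infl i j A) x y = bil S A (x(i := x i - x j)) (y(i := y i - y j))"
proof -
  let ?y = "y(i := y i - y j)"
  have "bil S (infl i j A) x y = (\<Sum>k\<in>S. x k * app S A ?y k) - (\<Sum>k\<in>S. if k = j then x k * app S A ?y i else 0)"
    unfolding bil_app app_infl[OF assms] by (simp add: algebra_simps sum_subtractf if_distrib[of "(*) _"] cong: if_cong)
  also have "\<dots> = (\<Sum>k\<in>S. x k * app S A ?y k) - (\<Sum>k\<in>S. if k = i then x j * app S A ?y i else 0)"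
    using assms by (simp add: sum.delta')
  also have "\<dots> = (\<Sum>k\<in>S. (x(i := x i - x j)) k * app S A ?y k)"
    unfolding sum_subtractf[symmetric] by (intro sum.cong) (auto simp: algebra_simps)
  finally show ?thesis by (simp add: bil_app)
qed

text \<open>\<open>z\<close> is a fixed positive vector followed through the changes of basis,
  \<open>N\<close> its value. The last clause confines the radical to multiples of \<open>z\<close>.
  It admits two situations: a positive form, where the radical is zero and \<open>z\<close> may
  start as the all-one vector, and a circuit, where \<open>N = 0\<close> and \<open>z\<close>
  generates the radical.\<close>

definition infl_state :: "'a set \<Rightarrow> int \<Rightarrow> ('a \<Rightarrow> 'a \<Rightarrow> int) \<Rightarrow> ('a \<Rightarrow> int) \<Rightarrow> bool" where
  "infl_state S N A z \<longleftrightarrow> nonneg_form S A \<and> conn_form S A \<and> (\<forall>i\<in>S. 0 < z i) \<and> bil S A z z = N \<and>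
     (\<forall>x. (\<forall>i\<in>S. app S A x i = 0) \<longrightarrow> (\<exists>c. \<forall>i\<in>S. x i = c * z i))"

text \<open>The vector itself does not move: its coordinates become \<open>z i + z j\<close> at
  \<open>i\<close>, so they stay positive and the value and the radical are merely
  rewritten.\<close>

lemma infl_state_step:
  assumes st: "infl_state S N A z" and ij: "i \<in> S" "j \<in> S" "i \<noteq> j" "A i j = 1"
  shows "infl_state S N (infl i j A) (z(i := z i + z j))"
proof -
  have nn: "nonneg_form S A" and cn: "conn_form S A" and pos: "\<And>i. i \<in> S \<Longrightarrow> 0 < z i"
    and N: "bil S A z z = N"
    and rad: "\<And>x. (\<And>i. i \<in> S \<Longrightarrow> app S A x i = 0) \<Longrightarrow> \<exists>c. \<forall>i\<in>S. x i = c * z i"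
    using st unfolding infl_state_def by auto
  have u: "unit_form S A" and fin: "finite S" using nn by (auto dest: nonneg_formD)
  have sym: "k \<in> S \<Longrightarrow> l \<in> S \<Longrightarrow> A k l = A l k" for k l using unit_formD(3)[OF u] .
  have d: "k \<in> S \<Longrightarrow> A k k = 2" for k using unit_formD(2)[OF u] .
  have u': "unit_form S (infl i j A)"
    unfolding unit_form_def using fin ij d sym by (auto simp: infl_def)
  have nn': "nonneg_form S (infl i j A)"
    unfolding nonneg_form_def using u' fin ij nonneg_formD(3)[OF nn] by (simp add: bil_infl)
  have z': "(z(i := z i + z j))(i := (z(i := z i + z j)) i - (z(i := z i + z j)) j) = z"
    using ij by auto
  have N': "bil S (infl i j A) (z(i := z i + z j)) (z(i := z i + z j)) = N"
    unfolding bil_infl[OF fin ij(1-3)] z' by (rule N)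
  have rad': "\<exists>c. \<forall>k\<in>S. x k = c * (z(i := z i + z j)) k"
    if x: "\<forall>k\<in>S. app S (infl i j A) x k = 0" for x
  proof -
    let ?x = "x(i := x i - x j)"
    have i0: "app S A ?x i = 0" using x ij by (auto simp: app_infl[OF fin ij(1-3)])
    have "app S A ?x k = 0" if "k \<in> S" for k
      using x that i0 by (auto simp: app_infl[OF fin ij(1-3)] split: if_splits)
    then obtain c where c: "\<forall>k\<in>S. ?x k = c * z k" using rad[of ?x] by auto
    have "x j = c * z j" "x i - x j = c * z i" using c ij by (auto split: if_splits)
    then have "\<forall>k\<in>S. x k = c * (z(i := z i + z j)) k"
      using c by (auto simp: algebra_simps split: if_splits)
    then show ?thesis by blast
  qed
  have cn': "conn_form S (infl i j A)"
    unfolding conn_form_def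
  proof (intro allI impI, rule ccontr)
    fix P assume P: "P \<subseteq> S \<and> P \<noteq> {} \<and> P \<noteq> S"
    assume "\<not> (\<exists>k\<in>P. \<exists>l\<in>S - P. infl i j A k l \<noteq> 0)"
    then have 0: "infl i j A k l = 0" if "k \<in> P" "l \<in> S" "l \<notin> P" for k l using that by auto
    \<comment> \<open>The pair \<open>i\<close>, \<open>j\<close> is still joined, so a cut without
      crossing entries keeps both on one side; such a cut would already have been one for the old
      form.\<close>
    have ij0: "infl i j A i j = -1" "infl i j A j i = -1"
      using ij d sym[of i j] by (auto simp: infl_def)
    have same: "i \<in> P \<longleftrightarrow> j \<in> P" using 0[of i j] 0[of j i] ij0 ij by auto
    have "A k l = 0" if kl: "k \<in> P" "l \<in> S" "l \<notin> P" for k l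
    proof -
      have "A k i = 0" if "l = j" 
      proof -
        have "i \<notin> P" "k \<noteq> j" using same kl that by auto
        then show ?thesis using 0[of k i] kl ij by (auto simp: infl_def)
      qed
      moreover have "A i l = 0" if "k = j"
      proof -
        have "i \<in> P" "l \<noteq> j" using same kl that by auto
        then show ?thesis using 0[of i l] kl ij by (auto simp: infl_def)
      qed
      ultimately show ?thesis using 0[OF kl] kl by (cases "l = j"; cases "k = j") (auto simp: infl_def)
    qed
    then show False using cn P unfolding conn_form_def by (metis DiffD1 DiffD2)
  qed
  show ?thesis unfolding infl_state_def
    using nn' cn' N' rad' pos ij by (auto simp: add_pos_pos)
qed

lemma finite_image_factor:
  assumes "finite (g ` X)" "\<And>p q. p \<in> X \<Longrightarrow> q \<in> X \<Longrightarrow> g p = g q \<Longrightarrow> h p = h q"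
  shows "finite (h ` X)"
proof -
  have "h ` X \<subseteq> (\<lambda>u. h (SOME p. p \<in> X \<and> g p = u)) ` (g ` X)"
  proof
    fix v assume "v \<in> h ` X"
    then obtain p where p: "p \<in> X" "v = h p" by auto
    let ?q = "SOME q. q \<in> X \<and> g q = g p"
    have "?q \<in> X \<and> g ?q = g p" by (rule someI[of _ p]) (use p in auto)
    then have "h ?q = v" using assms(2)[of ?q p] p by auto
    then show "v \<in> (\<lambda>u. h (SOME p. p \<in> X \<and> g p = u)) ` (g ` X)" using p(1) by (auto intro!: rev_image_eqI[of "g p"])
  qed
  then show ?thesis using assms(1) finite_subset by blast
qed

text \<open>The difference of the two vectors lies in the common radical, hence is an integral
  multiple of either one. So \<open>z i\<close> and \<open>z' i\<close> divide each other, and both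
  are positive.\<close>

lemma infl_state_unique:
  assumes "infl_state S N A z" "infl_state S N A' z'"
    and eqA: "\<And>i j. i \<in> S \<Longrightarrow> j \<in> S \<Longrightarrow> A i j = A' i j"
    and eqz: "\<And>i. i \<in> S \<Longrightarrow> app S A z i = app S A' z' i"
    and i: "i \<in> S"
  shows "z i = z' i"
proof -
  have e: "app S A' x i = app S A x i" if "i \<in> S" for x i using that eqA by (intro app_cong) auto
  have "\<exists>c. \<forall>i\<in>S. z' i - z i = c * z i"
    using assms(1) eqz e unfolding infl_state_def by (auto simp: app_diff)
  then obtain c where c: "\<forall>i\<in>S. z' i - z i = c * z i" ..
  have "\<exists>c. \<forall>i\<in>S. z i - z' i = c * z' i"
    using assms(2) eqz e unfolding infl_state_def by (auto simp: app_diff)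
  then obtain d where d: "\<forall>i\<in>S. z i - z' i = d * z' i" ..
  have p: "0 < z i" "0 < z' i" using assms(1,2) i unfolding infl_state_def by auto
  have "z' i = (1 + c) * z i" "z i = (1 + d) * z' i"
    using c[rule_format, OF i] d[rule_format, OF i] by (simp_all add: algebra_simps)
  then have "z i dvd z' i" "z' i dvd z i" by (metis dvd_triv_right)+
  then show ?thesis using p by (simp add: zdvd_antisym_nonneg)
qed

lemma infl_state_bounded:
  "\<exists>M. \<forall>A z. infl_state S N A z \<longrightarrow> sum z S \<le> M"
proof (cases "finite S")
  case True
  let ?X = "{p. infl_state S N (fst p) (snd p)}"
  let ?g = "\<lambda>p. (restrict (\<lambda>(i, j). fst p i j) (S \<times> S), restrict (app S (fst p) (snd p)) S)"
  have sub: "?g ` ?X \<subseteq> (PiE (S \<times> S) (\<lambda>_. {-2..2})) \<times> (PiE S (\<lambda>_. {-(N + 2)..N + 2}))"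
  proof
    fix u assume "u \<in> ?g ` ?X"
    then obtain A z where st: "infl_state S N A z" and u: "u = ?g (A, z)" by auto
    have nn: "nonneg_form S A" and N: "bil S A z z = N" using st unfolding infl_state_def by auto
    have "\<bar>A i j\<bar> \<le> 2" if "i \<in> S" "j \<in> S" for i j using entry_bound[OF nn that] .
    moreover have "\<bar>app S A z i\<bar> \<le> N + 2" if "i \<in> S" for i using app_bound[OF nn that, of z] N by simp
    ultimately show "u \<in> (PiE (S \<times> S) (\<lambda>_. {-2..2})) \<times> (PiE S (\<lambda>_. {-(N + 2)..N + 2}))"
      unfolding u by (auto simp: abs_le_iff PiE_iff extensional_def; fastforce)
  qed
  have "finite (?g ` ?X)"
    by (rule finite_subset[OF sub]) (use True in \<open>auto intro!: finite_PiE finite_cartesian_product\<close>)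
  then have "finite ((\<lambda>p. sum (snd p) S) ` ?X)"
  proof (rule finite_image_factor)
    fix p q assume p: "p \<in> ?X" and q: "q \<in> ?X" and e: "?g p = ?g q"
    have eA: "fst p i j = fst q i j" if "i \<in> S" "j \<in> S" for i j
      using fun_cong[OF conjunct1[OF e[unfolded prod.inject]], of "(i, j)"] that by simp
    have ez: "app S (fst p) (snd p) i = app S (fst q) (snd q) i" if "i \<in> S" for i
      using fun_cong[OF conjunct2[OF e[unfolded prod.inject]], of i] that by simp
    show "sum (snd p) S = sum (snd q) S"
      by (rule sum.cong[OF refl], rule infl_state_unique[of S N "fst p" _ "fst q"]) (use p q eA ez in auto)
  qed
  then have "\<exists>M. \<forall>v\<in>(\<lambda>p. sum (snd p) S) ` ?X. v \<le> M"
    using Max_ge by blast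
  then show ?thesis by auto
next
  case False
  then show ?thesis unfolding infl_state_def by (auto dest: nonneg_formD)
qed

inductive infl_steps :: "'a set \<Rightarrow> ('a \<Rightarrow> 'a \<Rightarrow> int) \<Rightarrow> ('a \<Rightarrow> 'a \<Rightarrow> int) \<Rightarrow> bool" for S where
  none: "infl_steps S A A"
| more: "i \<in> S \<Longrightarrow> j \<in> S \<Longrightarrow> i \<noteq> j \<Longrightarrow> infl_steps S (infl i j A) A' \<Longrightarrow> infl_steps S A A'"

text \<open>The entries of \<open>z\<close> only grow, and their sum stays bounded because a state is determined by
  the finitely many possible values of the form and of its product with \<open>z\<close>.\<close>

lemma inflation:
  assumes "infl_state S N A z"
  shows "\<exists>A' z'. infl_steps S A A' \<and> infl_state S N A' z' \<and> (\<forall>i\<in>S. z i \<le> z' i) \<and>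
    (\<forall>i\<in>S. \<forall>j\<in>S. i \<noteq> j \<longrightarrow> A' i j \<le> 0)"
proof -
  obtain M where M: "\<And>A z. infl_state S N A z \<Longrightarrow> sum z S \<le> M"
    using infl_state_bounded by blast
  show ?thesis using assms
  proof (induction "nat (M - sum z S)" arbitrary: A z rule: less_induct)
    case less
    have nn: "nonneg_form S A" and pos: "\<And>i. i \<in> S \<Longrightarrow> 0 < z i"
      and rad: "\<And>x. (\<And>i. i \<in> S \<Longrightarrow> app S A x i = 0) \<Longrightarrow> \<exists>c. \<forall>i\<in>S. x i = c * z i"
      using less.prems unfolding infl_state_def by auto
    have u: "unit_form S A" and fin: "finite S" using nn by (auto dest: nonneg_formD)
    show ?case
    proof (cases "\<exists>i\<in>S. \<exists>j\<in>S. i \<noteq> j \<and> A i j > 0")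
      case False
      then show ?thesis using less.prems infl_steps.none by (metis linorder_not_less order_refl)
    next
      case True
      then obtain i j where ij: "i \<in> S" "j \<in> S" "i \<noteq> j" and p: "A i j > 0" by auto
      \<comment> \<open>An entry 2 would make \<open>e_j - e_i\<close> a null vector, hence a
        multiple of \<open>z\<close>; but its coordinates at \<open>i\<close> and \<open>j\<close>
        have opposite signs while those of \<open>z\<close> are positive.\<close>
      have "A i j \<noteq> 2"
      proof
        assume 2: "A i j = 2"
        let ?x = "\<lambda>k. 1 * unit_at j k + (-1) * unit_at i k"
        have "bil S A ?x ?x = 0"
          using bil_perturb[OF u ij(1), of 1 "unit_at j" "-1"] 2
            bil_unit_at_left[OF fin ij(2), of A] app_unit_at[OF fin ij(2), of A] unit_formD(2)[OF u ij(2)] by simp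
        then obtain c where "\<forall>k\<in>S. ?x k = c * z k"
          using rad null_vector_app[OF nn] by blast
        then have "-1 = c * z i" "1 = c * z j" using ij by (auto simp: unit_at_def)
        then show False using pos[OF ij(1)] pos[OF ij(2)]
          by (smt (verit) zero_less_mult_iff)
      qed
      then have 1: "A i j = 1" using p entry_bound[OF nn ij(1,2)] by linarith
      let ?z = "z(i := z i + z j)"
      have st: "infl_state S N (infl i j A) ?z" by (rule infl_state_step[OF less.prems ij 1])
      have "sum ?z S = sum z S + z j"
      proof -
        have "sum ?z S = (\<Sum>k\<in>S. z k + (if k = i then z j else 0))" by (intro sum.cong) auto
        then show ?thesis using ij fin by (simp add: sum.distrib sum.delta)
      qed
      then have "nat (M - sum ?z S) < nat (M - sum z S)"
        using M[OF st] pos[OF ij(2)] by linarith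
      from less.hyps[OF this st] obtain A' z' where
        "infl_steps S (infl i j A) A'" "infl_state S N A' z'" "\<forall>k\<in>S. ?z k \<le> z' k"
        "\<forall>i\<in>S. \<forall>j\<in>S. i \<noteq> j \<longrightarrow> A' i j \<le> 0" by auto
      moreover have "z k \<le> z' k" if "k \<in> S" for k
      proof -
        have "?z k \<le> z' k" using calculation(3) that by blast
        then show ?thesis using pos[OF ij(2)] by (cases "k = i") auto
      qed
      ultimately show ?thesis using infl_steps.more[OF ij] by blast
    qed
  qed
qed


subsection \<open>Dynkin graphs\<close>

definition graph_form :: "('a \<Rightarrow> 'a \<Rightarrow> bool) \<Rightarrow> 'a \<Rightarrow> 'a \<Rightarrow> int" where
  "graph_form E i j = (if i = j then 2 else if E i j then -1 else 0)"

abbreviation dyn_form :: "dynkin \<Rightarrow> nat \<Rightarrow> nat \<Rightarrow> int" where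
  "dyn_form D \<equiv> graph_form (dyn_edge D)"

definition dynkin_on :: "'a set \<Rightarrow> ('a \<Rightarrow> 'a \<Rightarrow> int) \<Rightarrow> bool" where
  "dynkin_on U A \<longleftrightarrow> (\<exists>D f. dyn_valid D \<and> bij_betw f {..<dyn_size D} U \<and>
     (\<forall>i<dyn_size D. \<forall>j<dyn_size D. A (f i) (f j) = dyn_form D i j))"

text \<open>On a non-negative form such a vector is radical. If moreover the radical consists of the
  integral multiples of one positive vector, the coefficient 1 forces that vector to have an entry
  1. The condition is an inequality so that graphs can be grown for unit forms whose sign is
  unknown.\<close>

definition small_null :: "'a set \<Rightarrow> ('a \<Rightarrow> 'a \<Rightarrow> int) \<Rightarrow> bool" where
  "small_null S A \<longleftrightarrow> (\<exists>x. \<exists>i\<in>S. x i = 1 \<and> bil S A x x \<le> 0)"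

lemma small_null_embed:
  assumes "inj_on g T" "g ` T \<subseteq> S" "finite S" "small_null T (\<lambda>a b. A (g a) (g b))"
  shows "small_null S A"
proof -
  obtain w i where i: "i \<in> T" "w i = 1" and w: "bil T (\<lambda>a b. A (g a) (g b)) w w \<le> 0"
    using assms(4) unfolding small_null_def by auto
  let ?x = "\<lambda>s. if s \<in> g ` T then w (the_inv_into T g s) else 0"
  have x: "?x (g a) = w a" if "a \<in> T" for a using that assms(1) by (simp add: the_inv_into_f_f)
  have "bil S A ?x ?x = bil (g ` T) A ?x ?x" using assms by (intro bil_support) auto
  also have "\<dots> = bil T (\<lambda>a b. A (g a) (g b)) w w"
    unfolding bil_image[OF assms(1)] using x by (intro bil_cong) auto
  finally have "bil S A ?x ?x \<le> 0" using w by simp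
  moreover have "?x (g i) = 1" "g i \<in> S" using x[OF i(1)] i assms(2) by auto
  ultimately show ?thesis unfolding small_null_def by (intro exI[of _ ?x] bexI[of _ "g i"] conjI)
qed

text \<open>A certificate format: \<open>g\<close> lists the vertices, \<open>w\<close> the
  coefficients, \<open>k\<close> the position of a coefficient 1. What remains is a finite sum to
  evaluate.\<close>

lemma small_null_list:
  assumes "(\<Sum>a<n. \<Sum>b<n. A (g ! a) (g ! b) * w ! a * w ! b) \<le> 0"
    "length g = n" "distinct g" "set g \<subseteq> S" "finite S" "k < n" "w ! k = 1"
  shows "small_null S A"
proof (rule small_null_embed[of "(!) g" "{..<n}"])
  show "inj_on ((!) g) {..<n}" using assms(2,3) by (auto simp: inj_on_def nth_eq_iff_index_eq)
  show "(!) g ` {..<n} \<subseteq> S" using assms(2,4) by (auto simp: subset_iff in_set_conv_nth)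
  show "small_null {..<n} (\<lambda>a b. A (g ! a) (g ! b))"
    unfolding small_null_def bil_def using assms(1,6,7) by (intro exI[of _ "(!) w"] bexI[of _ k]) auto
qed (rule assms(5))

lemma small_null_cong:
  assumes "\<And>i j. i \<in> S \<Longrightarrow> j \<in> S \<Longrightarrow> A i j = A' i j"
  shows "small_null S A \<longleftrightarrow> small_null S A'"
proof -
  have "bil S A x x = bil S A' x x" for x using assms by (intro bil_cong) auto
  then show ?thesis unfolding small_null_def by simp
qed

lemma dynkin_on_cong:
  assumes "\<And>i j. i \<in> S \<Longrightarrow> j \<in> S \<Longrightarrow> A i j = A' i j"
  shows "dynkin_on S A \<longleftrightarrow> dynkin_on S A'"
proof -
  have "(\<forall>i<n. \<forall>j<n. A (f i) (f j) = X i j) \<longleftrightarrow> (\<forall>i<n. \<forall>j<n. A' (f i) (f j) = X i j)"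
    if "bij_betw f {..<n} S" for f n X
    using assms bij_betwE[OF that] by simp
  then show ?thesis unfolding dynkin_on_def by blast
qed

lemma dynkin_on_image:
  assumes "bij_betw g T S" "dynkin_on T (\<lambda>a b. A (g a) (g b))"
  shows "dynkin_on S A"
proof -
  obtain D f where "dyn_valid D" "bij_betw f {..<dyn_size D} T"
    "\<forall>i<dyn_size D. \<forall>j<dyn_size D. A (g (f i)) (g (f j)) = dyn_form D i j"
    using assms(2) unfolding dynkin_on_def by auto
  then show ?thesis unfolding dynkin_on_def
    using bij_betw_trans[OF _ assms(1)] by (intro exI[of _ D] exI[of _ "g \<circ> f"]) auto
qed

lemma bil_insert:
  assumes "finite U" "v \<notin> U" "\<And>u. u \<in> U \<Longrightarrow> A u v = A v u"
  shows "bil (insert v U) A x x = bil U A x x + 2 * x v * (\<Sum>u\<in>U. A v u * x u) + A v v * (x v)^2"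
proof -
  have "(\<Sum>i\<in>U. A i v * x i * x v) = x v * (\<Sum>u\<in>U. A v u * x u)"
    unfolding sum_distrib_left using assms(3) by (intro sum.cong) auto
  moreover have "(\<Sum>j\<in>U. A v j * x v * x j) = x v * (\<Sum>u\<in>U. A v u * x u)"
    unfolding sum_distrib_left by (intro sum.cong) auto
  ultimately show ?thesis
    using assms by (simp add: bil_def sum.distrib power2_eq_square algebra_simps)
qed

text \<open>The exceptional cases are listed in the vertex order of \<open>dyn_edge\<close>: the
  branch vertex, then the three arms from the inside outwards.\<close>

fun highest_root :: "dynkin \<Rightarrow> nat \<Rightarrow> int" where
  "highest_root (Dyn_A m) i = 1"
| "highest_root (Dyn_D m) i = (if i = 0 \<or> i = m - 1 \<or> i = m - 2 then 1 else 2)"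
| "highest_root Dyn_E6 i = [3, 2, 2, 1, 2, 1] ! i"
| "highest_root Dyn_E7 i = [4, 2, 3, 2, 3, 2, 1] ! i"
| "highest_root Dyn_E8 i = [6, 3, 4, 2, 5, 4, 3, 2] ! i"

lemma app_dyn_A:
  assumes "i < m"
  shows "app {..<m} (dyn_form (Dyn_A m)) x i
    = 2 * x i - (if 0 < i then x (i - 1) else 0) - (if i + 1 < m then x (i + 1) else 0)"
proof -
  have "app {..<m} (dyn_form (Dyn_A m)) x i = (\<Sum>j<m. (if j = i then 2 * x i else 0)
      - (if j = i - 1 then (if 0 < i then x (i - 1) else 0) else 0)
      - (if j = i + 1 then x (i + 1) else 0))"
    unfolding app_def using assms by (intro sum.cong) (auto simp: graph_form_def)
  then show ?thesis using assms by (auto simp: sum_subtractf sum.delta)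
qed

lemma app_dyn_D:
  assumes "i < m" "4 \<le> m"
  shows "app {..<m} (dyn_form (Dyn_D m)) x i
    = (if i = m - 1 then 2 * x i - x 1 else
       2 * x i - (if 0 < i then x (i - 1) else 0) - (if i + 2 < m then x (i + 1) else 0)
         - (if i = 1 then x (m - 1) else 0))"
proof (cases "i = m - 1")
  case True
  have "app {..<m} (dyn_form (Dyn_D m)) x i = (\<Sum>j<m. (if j = i then 2 * x i else 0)
      - (if j = 1 then x 1 else 0))"
    unfolding app_def using assms True by (intro sum.cong) (auto simp: graph_form_def)
  then show ?thesis using assms True by (auto simp: sum_subtractf sum.delta)
next
  case False
  have "app {..<m} (dyn_form (Dyn_D m)) x i = (\<Sum>j<m. (if j = i then 2 * x i else 0)
      - (if j = i - 1 then (if 0 < i then x (i - 1) else 0) else 0)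
      - (if j = i + 1 then (if i + 2 < m then x (i + 1) else 0) else 0)
      - (if j = m - 1 then (if i = 1 then x (m - 1) else 0) else 0))"
    unfolding app_def using assms False by (intro sum.cong) (auto simp: graph_form_def)
  then show ?thesis using assms False by (auto simp: sum_subtractf sum.delta)
qed

lemma all_less_numeral:
  "(\<forall>i<numeral k. P i) \<longleftrightarrow> P (pred_numeral k) \<and> (\<forall>i<pred_numeral k. P i)"
  "(\<forall>i<(1::nat). Q i) \<longleftrightarrow> Q 0"
  by (simp_all add: numeral_eq_Suc All_less_Suc)

lemma sum_less_numeral:
  "(\<Sum>i<numeral k. f i) = (\<Sum>i<pred_numeral k. f i) + (f (pred_numeral k) :: 'a::comm_monoid_add)"
  "(\<Sum>i<(1::nat). g i) = (g 0 :: 'b::comm_monoid_add)"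
  by (simp_all add: numeral_eq_Suc lessThan_Suc add.commute)

lemmas expand_small = all_less_numeral sum_less_numeral pred_numeral_simps BitM.simps arith_simps

lemma highest_root_pos:
  assumes "dyn_valid D" "i < dyn_size D"
  shows "1 \<le> highest_root D i"
proof -
  have "\<forall>i<dyn_size D. 1 \<le> highest_root D i"
    by (cases D) (simp_all add: all_less_numeral)
  then show ?thesis using assms by blast
qed

text \<open>The highest root is dominant: its products \<open>r i\<close> with the simple roots are
  non-negative. They are supported where the extra vertex of the extended Dynkin graph is attached:
  both ends for A (with value 2 for a single vertex), vertex \<open>m - 3\<close> for D, and
  vertices 1, 3 and 7 for the three graphs of type E. The weighted sum is the value of a root,
  2.\<close>

lemma app_highest_root:
  assumes "dyn_valid D"
  shows "\<exists>r. \<forall>i<dyn_size D. app {..<dyn_size D} (dyn_form D) (highest_root D) i = r i \<and> 0 \<le> r i \<and>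
      (\<Sum>i<dyn_size D. highest_root D i * r i) = 2"
proof (cases D)
  case (Dyn_A m)
  let ?r = "\<lambda>i. (if i = 0 then 1 else 0) + (if i = m - 1 then 1 else 0 :: int)"
  have "(\<Sum>i<m. ?r i) = 2" using assms Dyn_A by (auto simp: sum.distrib sum.delta)
  moreover have "app {..<m} (dyn_form (Dyn_A m)) (highest_root (Dyn_A m)) i = ?r i" if "i < m" for i
    using assms that Dyn_A by (subst app_dyn_A) auto
  ultimately show ?thesis using assms Dyn_A by (intro exI[of _ ?r]) simp
next
  case (Dyn_D m)
  let ?r = "\<lambda>i. if i = m - 3 then 1 else 0 :: int"
  have "(\<Sum>i<m. highest_root D i * ?r i) = (\<Sum>i<m. if i = m - 3 then highest_root D (m - 3) else 0)"
    by (intro sum.cong) auto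
  also have "\<dots> = 2" using assms Dyn_D by (auto simp: sum.delta)
  finally have "(\<Sum>i<m. highest_root D i * ?r i) = 2" .
  moreover have "app {..<m} (dyn_form (Dyn_D m)) (highest_root (Dyn_D m)) i = ?r i" if "i < m" for i
  proof -
    obtain p where p: "m = p + 4" using assms Dyn_D le_Suc_ex[of 4 m] by auto
    consider "i = p + 3" | "i = p + 2" | "i = p + 1" "p = 0" | "i = p + 1" "0 < p" | "i = 0" "p > 0" | "i = 0" "p = 0"
      | "i = 1" "0 < p" | "1 < i" "i < p + 1"
      using p \<open>i < m\<close> by linarith
    then show ?thesis
      unfolding app_dyn_D[OF that, simplified p, simplified] p by cases (simp_all add: p, linarith)
  qed
  ultimately show ?thesis using assms Dyn_D by (intro exI[of _ ?r]) (simp del: highest_root.simps)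
next
  case Dyn_E6
  then show ?thesis
    apply (intro exI[of _ "(!) [0, 1, 0, 0, 0, 0]"])
    apply (simp only: app_def dyn_size.simps expand_small)
    apply (simp add: graph_form_def doubleton_eq_iff)
    done
next
  case Dyn_E7
  then show ?thesis
    apply (intro exI[of _ "(!) [0, 0, 0, 1, 0, 0, 0]"])
    apply (simp only: app_def dyn_size.simps expand_small)
    apply (simp add: graph_form_def doubleton_eq_iff)
    done
next
  case Dyn_E8
  then show ?thesis
    apply (intro exI[of _ "(!) [0, 0, 0, 0, 0, 0, 0, 1]"])
    apply (simp only: app_def dyn_size.simps expand_small)
    apply (simp add: graph_form_def doubleton_eq_iff)
    done
qed

lemma bil_highest_root:
  assumes "dyn_valid D"
  shows "bil {..<dyn_size D} (dyn_form D) (highest_root D) (highest_root D) = 2"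
proof -
  obtain r where r: "\<And>i. i<dyn_size D \<Longrightarrow> app {..<dyn_size D} (dyn_form D) (highest_root D) i = r i \<and>
      (\<Sum>i<dyn_size D. highest_root D i * r i) = 2"
    using app_highest_root[OF assms] by blast
  have "0 < dyn_size D" using assms by (cases D) auto
  moreover have "bil {..<dyn_size D} (dyn_form D) (highest_root D) (highest_root D)
      = (\<Sum>i<dyn_size D. highest_root D i * r i)"
    unfolding bil_app using r by (intro sum.cong) auto
  ultimately show ?thesis using r by simp
qed

text \<open>Pair \<open>z\<close> with the highest root: the result is 0, but it is also the sum of
  all \<open>z i * r i\<close> with \<open>z i\<close> positive and \<open>r i\<close> non-negative.
  So \<open>r\<close> vanishes, although the highest root has value 2.\<close>

lemma dyn_form_no_positive_null:
  assumes "dyn_valid D" "\<And>i. i < dyn_size D \<Longrightarrow> 0 < z i"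
    "\<And>i. i < dyn_size D \<Longrightarrow> app {..<dyn_size D} (dyn_form D) z i = 0"
  shows False
proof -
  let ?S = "{..<dyn_size D}"
  obtain r where r: "\<And>i. i<dyn_size D \<Longrightarrow> app ?S (dyn_form D) (highest_root D) i = r i \<and> 0 \<le> r i \<and>
      (\<Sum>i<dyn_size D. highest_root D i * r i) = 2"
    using app_highest_root[OF assms(1)] by blast
  have n0: "0 < dyn_size D" using assms(1) by (cases D) auto
  have "dyn_edge D i j = dyn_edge D j i" for i j by (cases D) (auto simp: insert_commute)
  then have u: "unit_form ?S (dyn_form D)" by (auto simp: unit_form_def graph_form_def)
  have "(\<Sum>i<dyn_size D. z i * r i) = bil ?S (dyn_form D) z (highest_root D)"
    unfolding bil_app using r by (intro sum.cong) auto
  also have "\<dots> = 0"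
    unfolding bil_sym[OF u, of z] using assms(3) by (intro app_zero_imp_null) auto
  finally have 0: "(\<Sum>i<dyn_size D. z i * r i) = 0" .
  have nn: "0 \<le> z i * r i" if "i < dyn_size D" for i using r assms(2) that by (simp add: less_imp_le)
  have "r i = 0" if "i < dyn_size D" for i
  proof -
    have "\<forall>i\<in>?S. z i * r i = 0"
      using 0 nn sum_nonneg_eq_0_iff[of ?S "\<lambda>i. z i * r i"] by blast
    then show ?thesis using assms(2)[OF that] that by (metis lessThan_iff less_irrefl mult_eq_0_iff)
  qed
  then have "(\<Sum>i<dyn_size D. highest_root D i * r i) = 0" by (intro sum.neutral) auto
  then show False using r[OF n0] by simp
qed

section \<open>Attaching a leaf to a Dynkin graph\<close>

definition leaf_edge :: "(nat \<Rightarrow> nat \<Rightarrow> bool) \<Rightarrow> nat \<Rightarrow> nat \<Rightarrow> nat \<Rightarrow> nat \<Rightarrow> bool" where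
  "leaf_edge E m i k l \<longleftrightarrow> (k < m \<and> l < m \<and> E k l) \<or> (k = m \<and> l = i) \<or> (k = i \<and> l = m)"

lemma dynkin_onI_list:
  assumes "\<forall>i<n. \<forall>j<n. A (g ! i) (g ! j) = dyn_form D i j"
    "dyn_valid D" "dyn_size D = n" "length g = n" "distinct g" "set g = S"
  shows "dynkin_on S A"
  unfolding dynkin_on_def using assms bij_betw_nth[of g "{..<n}" S]
  by (intro exI[of _ D] exI[of _ "(!) g"]) auto


lemma dyn_edge_sym: "dyn_edge D i j \<Longrightarrow> dyn_edge D j i"
  by (cases D) (auto simp: insert_commute)

lemma leaf_edge_sym: "leaf_edge (dyn_edge D) m i k l \<Longrightarrow> leaf_edge (dyn_edge D) m i l k"
  using dyn_edge_sym by (auto simp: leaf_edge_def)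

lemma dynkin_on_leafI:
  assumes "dyn_valid D'" "bij_betw f {..<dyn_size D'} S"
    "\<And>k l. k < l \<Longrightarrow> l < dyn_size D' \<Longrightarrow> leaf_edge (dyn_edge D) m i (f k) (f l) \<longleftrightarrow> dyn_edge D' k l"
  shows "dynkin_on S (graph_form (leaf_edge (dyn_edge D) m i))"
proof -
  have "graph_form (leaf_edge (dyn_edge D) m i) (f k) (f l) = dyn_form D' k l"
    if "k < dyn_size D'" "l < dyn_size D'" for k l
  proof -
    consider "k = l" | "k < l" | "l < k" by linarith
    then show ?thesis
    proof cases
      case 1
      then show ?thesis by (simp add: graph_form_def)
    next
      case 2
      then have "f k \<noteq> f l" using inj_on_eq_iff[OF bij_betw_imp_inj_on[OF assms(2)], of k l] that 2 by auto
      then show ?thesis using 2 that assms(3)[of k l] by (simp add: graph_form_def)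
    next
      case 3
      then have "f k \<noteq> f l" using inj_on_eq_iff[OF bij_betw_imp_inj_on[OF assms(2)], of k l] that 3 by auto
      moreover have "leaf_edge (dyn_edge D) m i (f k) (f l) \<longleftrightarrow> leaf_edge (dyn_edge D) m i (f l) (f k)"
        using leaf_edge_sym by blast
      moreover have "dyn_edge D' k l \<longleftrightarrow> dyn_edge D' l k"
        using dyn_edge_sym by blast
      ultimately show ?thesis using 3 that assms(3)[of l k] by (simp add: graph_form_def)
    qed
  qed
  then show ?thesis unfolding dynkin_on_def using assms(1,2) by blast
qed

text \<open>The leaf at \<open>i\<close> turns the path into a star with arms of 1, \<open>i\<close>
  and \<open>j\<close> vertices. An empty arm gives A and a second arm of length 1 gives D; the
  lengths 2 with 2, 3 or 4 give the three graphs of type E. All other stars contain the extended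
  graph of E8 (arms 1, 2, 5) or of E7 (arms 1, 3, 3), whose marks form a null vector.\<close>

lemma leaf_A:
  assumes i: "i < m"
  shows "small_null {..m} (graph_form (leaf_edge (dyn_edge (Dyn_A m)) m i))
    \<or> dynkin_on {..m} (graph_form (leaf_edge (dyn_edge (Dyn_A m)) m i))"
    (is "small_null _ (graph_form (leaf_edge (dyn_edge ?D) m i)) \<or> _")
proof -
  obtain j where j: "m = i + j + 1" using i less_imp_Suc_add[of i m] by auto
  have "i = 0 \<or> i = 1 \<or> i = 2 \<or> i = 3 \<or> i = 4 \<or> 5 \<le> i" "j = 0 \<or> j = 1 \<or> j = 2 \<or> j = 3 \<or> j = 4 \<or> 5 \<le> j"
    by linarith+
  then consider "i = 0" | "j = 0" | "i = 1" "1 \<le> j" | "j = 1" "1 \<le> i"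
    | "i = 2" "j = 2" | "i = 2" "j = 3" | "i = 2" "j = 4" | "i = 3" "j = 2" | "i = 4" "j = 2"
    | "i = 2" "5 \<le> j" | "j = 2" "5 \<le> i" | "3 \<le> i" "3 \<le> j"
    by (elim disjE) simp_all
  then show ?thesis
  proof cases
    case 1
    note c = this j
    let ?f = "\<lambda>k. if k = 0 then m else k - 1"
    have "bij_betw ?f {..<Suc m} {..m}"
      by (rule bij_betwI[of _ _ _ "\<lambda>k. if k = m then 0 else k + 1"]) (use i in auto)
    moreover have "leaf_edge (dyn_edge ?D) m i (?f k) (?f l) \<longleftrightarrow> dyn_edge (Dyn_A (Suc m)) k l" if "k < l" "l < Suc m" for k l
      using that c i by (cases l; cases k) (auto simp: leaf_edge_def)
    ultimately show ?thesis using c i by (intro disjI2 dynkin_on_leafI[of "Dyn_A (Suc m)" ?f]) auto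
  next
    case 2
    note c = this j
    have "bij_betw id {..<Suc m} {..m}" by (simp add: lessThan_Suc_atMost)
    moreover have "leaf_edge (dyn_edge ?D) m i (id k) (id l) \<longleftrightarrow> dyn_edge (Dyn_A (Suc m)) k l" if "k < l" "l < Suc m" for k l
      using that c i by (cases l; cases k) (auto simp: leaf_edge_def)
    ultimately show ?thesis using c i by (intro disjI2 dynkin_on_leafI[of "Dyn_A (Suc m)" id]) auto
  next
    case 3
    note c = this j
    have "bij_betw id {..<Suc m} {..m}" by (simp add: lessThan_Suc_atMost)
    moreover have "leaf_edge (dyn_edge ?D) m i (id k) (id l) \<longleftrightarrow> dyn_edge (Dyn_D (Suc m)) k l" if "k < l" "l < Suc m" for k l
      using that c i by (cases l; cases k) (auto simp: leaf_edge_def)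
    ultimately show ?thesis using c i by (intro disjI2 dynkin_on_leafI[of "Dyn_D (Suc m)" id]) auto
  next
    case 4
    note c = this j
    let ?f = "\<lambda>k. if k = m then m else m - 1 - k"
    have "bij_betw ?f {..<Suc m} {..m}"
      by (rule bij_betwI[of _ _ _ ?f]) (use i in auto)
    moreover have "leaf_edge (dyn_edge ?D) m i (?f k) (?f l) \<longleftrightarrow> dyn_edge (Dyn_D (Suc m)) k l" if "k < l" "l < Suc m" for k l
      using that c i by (cases l; cases k) (auto simp: leaf_edge_def)
    ultimately show ?thesis using c i by (intro disjI2 dynkin_on_leafI[of "Dyn_D (Suc m)" ?f]) auto
  next
    case 5
    note c = this j
    from c show ?thesis
      apply (intro disjI2)
      apply (rule dynkin_onI_list[of 6 _ "[2,5,1,0,3,4]" Dyn_E6])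
      apply (simp only: expand_small)
      apply (auto simp: graph_form_def leaf_edge_def doubleton_eq_iff)
      done
  next
    case 6
    note c = this j
    from c show ?thesis
      apply (intro disjI2)
      apply (rule dynkin_onI_list[of 7 _ "[2,6,1,0,3,4,5]" Dyn_E7])
      apply (simp only: expand_small)
      apply (auto simp: graph_form_def leaf_edge_def doubleton_eq_iff)
      done
  next
    case 7
    note c = this j
    from c show ?thesis
      apply (intro disjI2)
      apply (rule dynkin_onI_list[of 8 _ "[2,7,1,0,3,4,5,6]" Dyn_E8])
      apply (simp only: expand_small)
      apply (auto simp: graph_form_def leaf_edge_def doubleton_eq_iff)
      done
  next
    case 8
    note c = this j
    from c show ?thesis
      apply (intro disjI2)
      apply (rule dynkin_onI_list[of 7 _ "[3,6,4,5,2,1,0]" Dyn_E7])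
      apply (simp only: expand_small)
      apply (auto simp: graph_form_def leaf_edge_def doubleton_eq_iff)
      done
  next
    case 9
    note c = this j
    from c show ?thesis
      apply (intro disjI2)
      apply (rule dynkin_onI_list[of 8 _ "[4,7,5,6,3,2,1,0]" Dyn_E8])
      apply (simp only: expand_small)
      apply (auto simp: graph_form_def leaf_edge_def doubleton_eq_iff)
      done
  next
    case 10
    note c = this j
    from c show ?thesis
      apply (intro disjI1)
      \<comment> \<open>The marks of the extended E8 graph: branch vertex 6, then the arms of 1, 2
        and 5 vertices; the coefficient 1 is at the tip of the longest arm.\<close>
      apply (rule small_null_list[of _ "[2,m,1,0,3,4,5,6,7]" "[6,3,4,2,5,4,3,2,1]" 9 _ 8])
      apply (simp only: expand_small)
      apply (auto simp: graph_form_def leaf_edge_def)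
      done
  next
    case 11
    then obtain p where p: "i = p + 5" using le_Suc_ex[of 5 i] by auto
    then have "m = p + 8" using 11 j by simp
    with p show ?thesis
      apply (intro disjI1)
      apply (rule small_null_list[of _ "[p+5,m,p+6,p+7,p+4,p+3,p+2,p+1,p]" "[6,3,4,2,5,4,3,2,1]" 9 _ 8])
      apply (simp only: expand_small)
      apply (auto simp: graph_form_def leaf_edge_def)
      done
  next
    case 12
    then obtain p where p: "i = p + 3" using le_Suc_ex[of 3 i] by auto
    with 12 j show ?thesis
      apply (intro disjI1)
      \<comment> \<open>The marks of the extended E7 graph: branch vertex 4, then the arms of 1, 3
        and 3 vertices.\<close>
      apply (rule small_null_list[of _ "[p+3,m,p+2,p+1,p,p+4,p+5,p+6]" "[4,2,3,2,1,3,2,1]" 8 _ 4])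
      apply (simp only: expand_small)
      apply (auto simp: graph_form_def leaf_edge_def)
      done
  qed
qed

lemma leaf_D:
  assumes m: "4 \<le> m" and i: "i = 0 \<or> i = m - 1 \<or> i = m - 2"
  shows "small_null {..m} (graph_form (leaf_edge (dyn_edge (Dyn_D m)) m i))
    \<or> dynkin_on {..m} (graph_form (leaf_edge (dyn_edge (Dyn_D m)) m i))"
    (is "small_null _ (graph_form (leaf_edge (dyn_edge ?D) m i)) \<or> _")
proof -
  have "m = 4 \<or> m = 5 \<or> m = 6 \<or> m = 7 \<or> 8 \<le> m" using m by linarith
  with i consider "i = m - 2" | "i = 0" "m = 4" | "i = m - 1" "m = 4" | "i = 0" "m = 5" | "i = m - 1" "m = 5"
    | "i = 0" "m = 6" | "i = m - 1" "m = 6" | "i = 0" "m = 7" | "i = m - 1" "m = 7"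
    | "i = 0" "8 \<le> m" | "i = m - 1" "8 \<le> m"
    by (elim disjE) simp_all
  then show ?thesis
  proof cases
    case 1
    let ?f = "\<lambda>k. if k = m then m - 1 else if k = m - 1 then m else k"
    have "bij_betw ?f {..<Suc m} {..m}"
      by (rule bij_betwI[of _ _ _ ?f]) (use m in auto)
    moreover have "leaf_edge (dyn_edge ?D) m i (?f k) (?f l) \<longleftrightarrow> dyn_edge (Dyn_D (Suc m)) k l" if "k < l" "l < Suc m" for k l
      using that 1 m by (cases l; cases k) (auto simp: leaf_edge_def)
    ultimately show ?thesis using 1 m by (intro disjI2 dynkin_on_leafI[of "Dyn_D (Suc m)" ?f]) auto
  next
    case 2
    then show ?thesis
      apply (intro disjI2)
      apply (rule dynkin_onI_list[of 5 _ "[2,1,0,4,3]" "Dyn_D 5"])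
      apply (simp only: expand_small)
      apply (auto simp: graph_form_def leaf_edge_def doubleton_eq_iff)
      done
  next
    case 3
    then show ?thesis
      apply (intro disjI2)
      apply (rule dynkin_onI_list[of 5 _ "[2,1,3,4,0]" "Dyn_D 5"])
      apply (simp only: expand_small)
      apply (auto simp: graph_form_def leaf_edge_def doubleton_eq_iff)
      done
  next
    case 4
    then show ?thesis
      apply (intro disjI2)
      apply (rule dynkin_onI_list[of 6 _ "[1,4,0,5,2,3]" Dyn_E6])
      apply (simp only: expand_small)
      apply (auto simp: graph_form_def leaf_edge_def doubleton_eq_iff)
      done
  next
    case 5
    then show ?thesis
      apply (intro disjI2)
      apply (rule dynkin_onI_list[of 6 _ "[1,0,4,5,2,3]" Dyn_E6])
      apply (simp only: expand_small)
      apply (auto simp: graph_form_def leaf_edge_def doubleton_eq_iff)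
      done
  next
    case 6
    then show ?thesis
      apply (intro disjI2)
      apply (rule dynkin_onI_list[of 7 _ "[1,5,0,6,2,3,4]" Dyn_E7])
      apply (simp only: expand_small)
      apply (auto simp: graph_form_def leaf_edge_def doubleton_eq_iff)
      done
  next
    case 7
    then show ?thesis
      apply (intro disjI2)
      apply (rule dynkin_onI_list[of 7 _ "[1,0,5,6,2,3,4]" Dyn_E7])
      apply (simp only: expand_small)
      apply (auto simp: graph_form_def leaf_edge_def doubleton_eq_iff)
      done
  next
    case 8
    then show ?thesis
      apply (intro disjI2)
      apply (rule dynkin_onI_list[of 8 _ "[1,6,0,7,2,3,4,5]" Dyn_E8])
      apply (simp only: expand_small)
      apply (auto simp: graph_form_def leaf_edge_def doubleton_eq_iff)
      done
  next
    case 9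
    then show ?thesis
      apply (intro disjI2)
      apply (rule dynkin_onI_list[of 8 _ "[1,0,6,7,2,3,4,5]" Dyn_E8])
      apply (simp only: expand_small)
      apply (auto simp: graph_form_def leaf_edge_def doubleton_eq_iff)
      done
  next
    case 10
    then obtain p where p: "m = p + 8" using le_Suc_ex[of 8 m] by auto
    with 10 show ?thesis
      apply (intro disjI1)
      apply (rule small_null_list[of _ "[1,p+7,0,p+8,2,3,4,5,6]" "[6,3,4,2,5,4,3,2,1]" 9 _ 8])
      apply (simp only: expand_small)
      apply (auto simp: graph_form_def leaf_edge_def)
      done
  next
    case 11
    then obtain p where p: "m = p + 8" using le_Suc_ex[of 8 m] by auto
    with 11 show ?thesis
      apply (intro disjI1)
      apply (rule small_null_list[of _ "[1,0,p+7,p+8,2,3,4,5,6]" "[6,3,4,2,5,4,3,2,1]" 9 _ 8])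
      apply (simp only: expand_small)
      apply (auto simp: graph_form_def leaf_edge_def)
      done
  qed
qed


text \<open>In type E the vertices of coefficient 1 are the tips of the two longer arms of E6 and
  the tip of the longest arm of E7; a leaf there leads to the next graph. The highest root of E8 has
  no coefficient 1.\<close>

lemma leaf_dynkin:
  assumes D: "dyn_valid D" and i: "i < dyn_size D" "highest_root D i = 1"
  shows "small_null {..dyn_size D} (graph_form (leaf_edge (dyn_edge D) (dyn_size D) i))
    \<or> dynkin_on {..dyn_size D} (graph_form (leaf_edge (dyn_edge D) (dyn_size D) i))"
proof (cases D)
  case (Dyn_A m)
  then show ?thesis using leaf_A[of i m] i by simp
next
  case (Dyn_D m)
  then show ?thesis using leaf_D[of m i] i D by (auto split: if_splits)
next
  case Dyn_E6
  have "\<forall>k<6. highest_root Dyn_E6 k = 1 \<longrightarrow> k = 3 \<or> k = 5"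
    by (simp only: expand_small) simp
  then have "i = 3 \<or> i = 5" using i Dyn_E6 by simp
  then show ?thesis
  proof
    assume "i = 3"
    then show ?thesis unfolding Dyn_E6
      apply (intro disjI2)
      apply (rule dynkin_onI_list[of 7 _ "[0,1,4,5,2,3,6]" Dyn_E7])
      apply (simp only: expand_small)
      apply (auto simp: graph_form_def leaf_edge_def doubleton_eq_iff)
      done
  next
    assume "i = 5"
    then show ?thesis unfolding Dyn_E6
      apply (intro disjI2)
      apply (rule dynkin_onI_list[of 7 _ "[0,1,2,3,4,5,6]" Dyn_E7])
      apply (simp only: expand_small)
      apply (auto simp: graph_form_def leaf_edge_def doubleton_eq_iff)
      done
  qed
next
  case Dyn_E7
  have "\<forall>k<7. highest_root Dyn_E7 k = 1 \<longrightarrow> k = 6"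
    by (simp only: expand_small) simp
  then have "i = 6" using i Dyn_E7 by simp
  then show ?thesis unfolding Dyn_E7
      apply (intro disjI2)
      apply (rule dynkin_onI_list[of 8 _ "[0,1,2,3,4,5,6,7]" Dyn_E8])
      apply (simp only: expand_small)
      apply (auto simp: graph_form_def leaf_edge_def doubleton_eq_iff)
      done
next
  case Dyn_E8
  have "\<forall>k<8. highest_root Dyn_E8 k \<noteq> 1"
    by (simp only: expand_small) simp
  then show ?thesis using i Dyn_E8 by simp
qed

text \<open>A new vertex pairs with the highest root either to at most \<open>-2\<close>, which produces a null vector,
  or to \<open>-1\<close>, and then it is a leaf attached where the highest root has coefficient 1.\<close>

lemma extend_labelled:
  assumes D: "dyn_valid D" and m: "m = dyn_size D"
    and B: "\<And>i j. i < m \<Longrightarrow> j < m \<Longrightarrow> B i j = dyn_form D i j" "B m m = 2"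
      "\<And>i. i < m \<Longrightarrow> B i m = B m i" "\<And>i. i < m \<Longrightarrow> B m i \<le> 0" "\<exists>i<m. B m i \<noteq> 0"
  shows "small_null {..m} B \<or> dynkin_on {..m} B"
proof -
  let ?h = "highest_root D"
  have h1: "1 \<le> ?h i" if "i < m" for i using highest_root_pos[OF D] that m by simp
  have ins: "{..m} = insert m {..<m}" by auto
  have nonpos: "B m i * ?h i \<le> 0" if "i < m" for i using h1[OF that] B(4)[OF that] by (simp add: mult_le_0_iff)
  show ?thesis
  proof (cases "(\<Sum>i<m. B m i * ?h i) \<le> -2")
    case True
    \<comment> \<open>The highest root plus the new unit vector has value 2 + 2p + 2, where p is the
      pairing of the two; for p at most -2 this is not positive.\<close>
    let ?x = "\<lambda>i. if i = m then 1 else ?h i"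
    have "bil {..m} B ?x ?x = bil {..<m} B ?x ?x + 2 * ?x m * (\<Sum>u<m. B m u * ?x u) + B m m * (?x m)^2"
      unfolding ins using B(3) by (intro bil_insert) auto
    also have "bil {..<m} B ?x ?x = bil {..<m} (dyn_form D) ?h ?h" using B(1) by (intro bil_cong) auto
    also have "\<dots> = 2" using bil_highest_root[OF D] m by simp
    also have "(\<Sum>u<m. B m u * ?x u) = (\<Sum>i<m. B m i * ?h i)" by (intro sum.cong) auto
    finally have "bil {..m} B ?x ?x \<le> 0" using True B(2) by simp
    then show ?thesis unfolding small_null_def by (intro disjI1 exI[of _ ?x] bexI[of _ m]) auto
  next
    case False
    obtain i where i: "i < m" "B m i \<noteq> 0" using B(5) by auto
    have rest: "(\<Sum>k\<in>{..<m} - {i}. B m k * ?h k) \<le> 0" using nonpos by (intro sum_nonpos) auto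
    have split: "(\<Sum>k<m. B m k * ?h k) = B m i * ?h i + (\<Sum>k\<in>{..<m} - {i}. B m k * ?h k)"
      using i by (intro sum.remove) auto
    have "B m i * ?h i \<noteq> 0" using i h1[OF i(1)] by simp
    \<comment> \<open>All summands are non-positive integers, their total exceeds -2 and the one at
      \<open>i\<close> is nonzero, so the total -1 is carried by \<open>i\<close> alone.\<close>
    then have e: "B m i * ?h i = -1" "(\<Sum>k\<in>{..<m} - {i}. B m k * ?h k) = 0"
      using nonpos[OF i(1)] rest split False by linarith+
    then have "?h i dvd 1" by (metis dvd_minus_iff dvd_triv_right)
    then have hi: "?h i = 1" using h1[OF i(1)] by simp
    then have bi: "B m i = -1" using e by simp
    have "B m k * ?h k = 0" if "k < m" "k \<noteq> i" for k
    proof -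
      have "\<forall>k\<in>{..<m} - {i}. - (B m k * ?h k) = 0"
        using e(2) nonpos by (subst sum_nonneg_eq_0_iff[symmetric]) (auto simp: sum_negf)
      then show ?thesis using that by simp
    qed
    then have bk: "B m k = 0" if "k < m" "k \<noteq> i" for k using h1[OF that(1)] that by fastforce
    have eq: "B k l = graph_form (leaf_edge (dyn_edge D) m i) k l" if "k \<in> {..m}" "l \<in> {..m}" for k l
      using that i(1) bi bk B(1-3) by (cases "k = m"; cases "l = m"; cases "k = i"; cases "l = i")
        (auto simp: graph_form_def leaf_edge_def)
    let ?G = "graph_form (leaf_edge (dyn_edge D) m i)"
    have "small_null {..m} B \<longleftrightarrow> small_null {..m} ?G" by (rule small_null_cong) (rule eq)
    moreover have "dynkin_on {..m} B \<longleftrightarrow> dynkin_on {..m} ?G" by (rule dynkin_on_cong) (rule eq)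
    ultimately show ?thesis using leaf_dynkin[OF D, of i] i(1) hi m by simp
  qed
qed

lemma extend_dynkin:
  assumes "unit_form (insert v U) A" "v \<notin> U" "dynkin_on U A"
    "\<And>u. u \<in> U \<Longrightarrow> A v u \<le> 0" "\<exists>u\<in>U. A v u \<noteq> 0"
  shows "small_null (insert v U) A \<or> dynkin_on (insert v U) A"
proof -
  obtain D f where D: "dyn_valid D" and f: "bij_betw f {..<dyn_size D} U"
    and eq: "\<And>i j. i < dyn_size D \<Longrightarrow> j < dyn_size D \<Longrightarrow> A (f i) (f j) = dyn_form D i j"
    using assms(3) unfolding dynkin_on_def by blast
  let ?m = "dyn_size D"
  let ?g = "f(?m := v)"
  have im: "f ` {..<?m} = U" and inj: "inj_on f {..<?m}" using f by (auto simp: bij_betw_def)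
  have fU: "f i \<in> U" if "i < ?m" for i using im that by auto
  have g: "bij_betw ?g {..?m} (insert v U)"
  proof -
    have "bij_betw ?g {..<?m} U" using f by (subst bij_betw_cong[where g = f]) auto
    moreover have "?g ?m \<notin> U" using assms(2) by simp
    ultimately have "bij_betw ?g ({..<?m} \<union> {?m}) (U \<union> {?g ?m})" by (intro notIn_Un_bij_betw) auto
    then show ?thesis by (simp add: lessThan_Suc_atMost lessThan_Suc[symmetric])
  qed
  have "small_null {..?m} (\<lambda>i j. A (?g i) (?g j)) \<or> dynkin_on {..?m} (\<lambda>i j. A (?g i) (?g j))"
  proof (rule extend_labelled[OF D refl])
    obtain i where "i < ?m" "A v (f i) \<noteq> 0" using assms(5) im by auto
    then show "\<exists>i<?m. A (?g ?m) (?g i) \<noteq> 0" by (intro exI[of _ i]) auto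
    show "A (?g ?m) (?g i) \<le> 0" if "i < ?m" for i using assms(4)[OF fU[OF that]] that by simp
    show "A (?g i) (?g ?m) = A (?g ?m) (?g i)" if "i < ?m" for i
      using unit_formD(3)[OF assms(1), of v "f i"] fU[OF that] that by simp
    show "A (?g ?m) (?g ?m) = 2" using unit_formD(2)[OF assms(1), of v] by simp
  qed (use eq in auto)
  then show ?thesis
    using dynkin_on_image[OF g] small_null_embed[of ?g "{..?m}" "insert v U" A] g unit_formD(1)[OF assms(1)]
    by (auto simp: bij_betw_def)
qed

lemma dynkin_on_singleton:
  assumes "A v v = 2"
  shows "dynkin_on {v} A"
  unfolding dynkin_on_def
  by (intro exI[of _ "Dyn_A 1"] exI[of _ "\<lambda>_. v"]) (use assms in \<open>auto simp: graph_form_def bij_betw_def lessThan_Suc\<close>)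

text \<open>Take a maximal subset carrying a Dynkin graph. If it is not everything, connectedness
  supplies an adjacent vertex; adding it cannot give a larger Dynkin graph, so it gives the null
  vector.\<close>

lemma dynkin_or_small_null:
  assumes u: "unit_form S A" and ne: "S \<noteq> {}" and cn: "conn_form S A"
    and np: "\<And>i j. i \<in> S \<Longrightarrow> j \<in> S \<Longrightarrow> i \<noteq> j \<Longrightarrow> A i j \<le> 0"
  shows "small_null S A \<or> dynkin_on S A"
proof -
  let ?F = "{U. U \<subseteq> S \<and> dynkin_on U A}"
  have fin: "finite S" using u by (rule unit_formD)
  obtain v where "v \<in> S" using ne by auto
  then have "{v} \<in> ?F" using dynkin_on_singleton[of A v] unit_formD(2)[OF u] by auto
  then obtain U where U: "U \<in> ?F" "{v} \<subseteq> U" and max: "\<And>W. W \<in> ?F \<Longrightarrow> U \<subseteq> W \<Longrightarrow> U = W"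
    using finite_has_maximal2[of ?F "{v}"] fin by auto
  show ?thesis
  proof (cases "U = S")
    case True
    then show ?thesis using U by simp
  next
    case False
    then have "U \<subseteq> S \<and> U \<noteq> {} \<and> U \<noteq> S" using U by auto
    then obtain w x where w: "w \<in> U" "x \<in> S - U" "A w x \<noteq> 0"
      using cn[unfolded conn_form_def, rule_format, of U] by auto
    have "finite U" using U fin by (auto intro: finite_subset)
    then have u': "unit_form (insert x U) A"
      using unit_formD[OF u] U w unfolding unit_form_def by blast
    have "A x w \<noteq> 0" using unit_formD(3)[OF u, of x w] w U by auto
    then have "small_null (insert x U) A \<or> dynkin_on (insert x U) A"
      using u' U w np by (intro extend_dynkin) auto
    moreover have "\<not> dynkin_on (insert x U) A" using max[of "insert x U"] U w by auto
    ultimately have "small_null (insert x U) A" by blast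
    then show ?thesis using small_null_embed[of id "insert x U" S A] U w fin by auto
  qed
qed

subsection \<open>Circuits\<close>

text \<open>After inflation, a Dynkin graph is excluded by the positive radical vector, so there is
  a null vector with a coefficient 1. It is a multiple of \<open>z'\<close>, hence
  \<open>z' i = 1\<close> at that place, and \<open>z i\<close> is positive and at most
  \<open>z' i\<close>.\<close>

lemma circuit_positive:
  fixes A :: "'a \<Rightarrow> 'a \<Rightarrow> int"
  assumes nn: "nonneg_form S A" and z: "\<And>i. i \<in> S \<Longrightarrow> 0 < z i" and ne: "S \<noteq> {}"
    and z0: "\<And>i. i \<in> S \<Longrightarrow> app S A z i = 0"
    and rad: "\<And>x. (\<And>i. i \<in> S \<Longrightarrow> app S A x i = 0) \<Longrightarrow> \<exists>c. \<forall>i\<in>S. x i = c * z i"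
  shows "\<exists>i\<in>S. z i = 1"
proof -
  have u: "unit_form S A" and fin: "finite S" using nn by (auto dest: nonneg_formD)
  \<comment> \<open>If \<open>P\<close> were cut off, the restriction of \<open>z\<close> to
    \<open>P\<close> would be radical as well, yet no multiple of \<open>z\<close>.\<close>
  have cn: "conn_form S A" unfolding conn_form_def
  proof (intro allI impI, rule ccontr)
    fix P assume P: "P \<subseteq> S \<and> P \<noteq> {} \<and> P \<noteq> S"
    assume "\<not> (\<exists>i\<in>P. \<exists>j\<in>S - P. A i j \<noteq> 0)"
    then have 0: "A i j = 0" if "i \<in> P" "j \<in> S - P" for i j using that by blast
    let ?x = "\<lambda>i. if i \<in> P then z i else 0"
    have "app S A ?x i = 0" if i: "i \<in> S" for i
    proof (cases "i \<in> P")
      case True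
      have "app S A ?x i = app S A z i" unfolding app_def
        using 0[OF True] by (intro sum.cong) auto
      then show ?thesis using z0[OF i] by simp
    next
      case False
      have "A i j = 0" if "j \<in> P" for j
        using 0[of j i] that False i P unit_formD(3)[OF u, of i j] by auto
      then show ?thesis unfolding app_def by (intro sum.neutral) auto
    qed
    then obtain c where c: "\<forall>i\<in>S. ?x i = c * z i" using rad[of ?x] by blast
    obtain p q where "p \<in> P" "q \<in> S" "q \<notin> P" using P by blast
    then have "z p = c * z p" "0 = c * z q" "p \<in> S" using c P by force+
    then show False using z[of p] z[of q] \<open>q \<in> S\<close> by auto
  qed
  have "bil S A z z = 0" using z0 by (intro app_zero_imp_null)
  then have "infl_state S 0 A z" unfolding infl_state_def using nn cn z rad by auto
  from inflation[OF this] obtain A' z' where st: "infl_state S 0 A' z'" and le: "\<forall>i\<in>S. z i \<le> z' i"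
    and np: "\<forall>i\<in>S. \<forall>j\<in>S. i \<noteq> j \<longrightarrow> A' i j \<le> 0" by blast
  have nn': "nonneg_form S A'" and cn': "conn_form S A'" and pos: "\<And>i. i \<in> S \<Longrightarrow> 0 < z' i"
    and q0: "bil S A' z' z' = 0"
    and rad': "\<And>x. (\<And>i. i \<in> S \<Longrightarrow> app S A' x i = 0) \<Longrightarrow> \<exists>c. \<forall>i\<in>S. x i = c * z' i"
    using st unfolding infl_state_def by auto
  have "\<not> dynkin_on S A'"
  proof
    assume "dynkin_on S A'"
    then obtain D f where D: "dyn_valid D" and f: "bij_betw f {..<dyn_size D} S"
      and eq: "\<And>i j. i < dyn_size D \<Longrightarrow> j < dyn_size D \<Longrightarrow> A' (f i) (f j) = dyn_form D i j"
      unfolding dynkin_on_def by blast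
    have fS: "f i \<in> S" if "i < dyn_size D" for i using f that by (auto simp: bij_betw_def)
    show False
    proof (rule dyn_form_no_positive_null[OF D, of "z' \<circ> f"])
      fix i assume i: "i < dyn_size D"
      show "0 < (z' \<circ> f) i" using pos fS[OF i] by simp
      have "app {..<dyn_size D} (dyn_form D) (z' \<circ> f) i = (\<Sum>j<dyn_size D. A' (f i) (f j) * z' (f j))"
        unfolding app_def using eq i by (intro sum.cong) auto
      also have "\<dots> = app S A' z' (f i)"
        unfolding app_def by (rule sum.reindex_bij_betw[OF f])
      also have "\<dots> = 0" using null_vector_app[OF nn' q0 fS[OF i]] .
      finally show "app {..<dyn_size D} (dyn_form D) (z' \<circ> f) i = 0" .
    qed
  qed
  then have "small_null S A'"
    using dynkin_or_small_null[OF nonneg_formD(1)[OF nn'] ne cn'] np by blast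
  then obtain x i where i: "i \<in> S" "x i = 1" and x: "bil S A' x x \<le> 0" unfolding small_null_def by auto
  have "bil S A' x x = 0" using x nonneg_formD(3)[OF nn', of x] by simp
  then obtain c where "\<forall>i\<in>S. x i = c * z' i" using rad' null_vector_app[OF nn'] by blast
  then have "1 = c * z' i" using i by auto
  then have "z' i = 1" using pos[OF i(1)] zmult_eq_1_iff[of c "z' i"] by auto
  then have "z i = 1" using le z i by force
  then show ?thesis using i by blast
qed

text \<open>Replacing \<open>e_i\<close> by its negative where \<open>z i < 0\<close> turns the
  radical vector into its absolute values and reduces the claim to
  \<open>circuit_positive\<close>.\<close>

lemma circuit_unit_coefficient:
  fixes A :: "'a \<Rightarrow> 'a \<Rightarrow> int"
  assumes nn: "nonneg_form S A" and z: "\<And>i. i \<in> S \<Longrightarrow> z i \<noteq> 0" and ne: "S \<noteq> {}"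
    and z0: "\<And>i. i \<in> S \<Longrightarrow> app S A z i = 0"
    and rad: "\<And>x. (\<And>i. i \<in> S \<Longrightarrow> app S A x i = 0) \<Longrightarrow> \<exists>c. \<forall>i\<in>S. x i = c * z i"
  shows "\<exists>i\<in>S. \<bar>z i\<bar> = 1"
proof -
  let ?A = "\<lambda>i j. sgn (z i) * A i j * sgn (z j)"
  have ss: "sgn (z i) * sgn (z i) = 1" if "i \<in> S" for i using z[OF that] by (simp add: sgn_if)
  have app': "app S ?A x i = sgn (z i) * app S A (\<lambda>j. sgn (z j) * x j) i" for x i
    unfolding app_def sum_distrib_left by (intro sum.cong) (auto simp: mult_ac)
  have bil': "bil S ?A x x = bil S A (\<lambda>j. sgn (z j) * x j) (\<lambda>j. sgn (z j) * x j)" for x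
    unfolding bil_def by (intro sum.cong) (auto simp: mult_ac)
  have u: "unit_form S A" using nn by (rule nonneg_formD)
  have "unit_form S ?A" unfolding unit_form_def
    using unit_formD[OF u] ss by (auto simp: mult_ac)
  then have nn': "nonneg_form S ?A" unfolding nonneg_form_def bil' using nonneg_formD(3)[OF nn] by simp
  have "\<exists>i\<in>S. (\<lambda>i. \<bar>z i\<bar>) i = 1"
  proof (rule circuit_positive[OF nn' _ ne])
    fix i assume i: "i \<in> S"
    show "0 < \<bar>z i\<bar>" using z[OF i] by simp
    have "app S A (\<lambda>j. sgn (z j) * \<bar>z j\<bar>) i = app S A z i" by (simp add: sgn_mult_abs)
    then show "app S ?A (\<lambda>i. \<bar>z i\<bar>) i = 0" unfolding app' using z0[OF i] by simp
  next
    fix x assume x: "\<And>i. i \<in> S \<Longrightarrow> app S ?A x i = 0"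
    have "app S A (\<lambda>j. sgn (z j) * x j) i = 0" if "i \<in> S" for i
      using x[OF that] z[OF that] unfolding app' by (simp add: sgn_0_0)
    from rad[OF this] obtain c where c: "\<forall>i\<in>S. sgn (z i) * x i = c * z i" by blast
    have "x i = c * \<bar>z i\<bar>" if i: "i \<in> S" for i
    proof -
      have "x i = sgn (z i) * (sgn (z i) * x i)" using ss[OF i] by (simp add: mult.assoc[symmetric])
      also have "\<dots> = sgn (z i) * (c * z i)" using c i by simp
      also have "\<dots> = c * \<bar>z i\<bar>" by (simp add: abs_sgn mult_ac)
      finally show ?thesis .
    qed
    then show "\<exists>c. \<forall>i\<in>S. x i = c * \<bar>z i\<bar>" by blast
  qed
  then show ?thesis by simp
qed


subsection \<open>Bases of the lattice modulo the radical\<close>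

text \<open>For a non-negative form this says that the unit vectors of \<open>J\<close> are linearly
  independent modulo the radical, since there the null vectors are the radical vectors.\<close>

definition indep :: "'a set \<Rightarrow> ('a \<Rightarrow> 'a \<Rightarrow> int) \<Rightarrow> 'a set \<Rightarrow> bool" where
  "indep S A J \<longleftrightarrow> (\<forall>x. (\<forall>i. i \<notin> J \<longrightarrow> x i = 0) \<and> bil S A x x = 0 \<longrightarrow> (\<forall>i. x i = 0))"

lemma indepD:
  assumes "indep S A J" "\<forall>i. i \<notin> J \<longrightarrow> x i = 0" "bil S A x x = 0"
  shows "\<forall>i. x i = 0"
  using assms unfolding indep_def by simp

lemma null_combination:
  fixes A :: "'a \<Rightarrow> 'a \<Rightarrow> int"
  assumes nn: "nonneg_form S A" and "bil S A x x = 0" "bil S A y y = 0"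
  shows "bil S A (\<lambda>i. a * x i + b * y i) (\<lambda>i. a * x i + b * y i) = 0"
proof -
  have "bil S A x y = 0"
    using null_vector_app[OF nn assms(3)] by (intro app_zero_imp_null)
  then show ?thesis using assms bil_combination[OF nonneg_formD(1)[OF nn]] by simp
qed

text \<open>A relation whose coefficient at \<open>k\<close> is 0 is supported on \<open>J\<close>
  and therefore zero. So relations are determined by that coefficient, and one with the least
  positive coefficient generates them all.\<close>

lemma minimal_relation:
  fixes A :: "'a \<Rightarrow> 'a \<Rightarrow> int"
  assumes nn: "nonneg_form S A" and ind: "indep S A J" and dep: "\<not> indep S A (insert k J)"
  obtains z where "\<And>i. i \<notin> insert k J \<Longrightarrow> z i = 0" "bil S A z z = 0" "0 < z k"
    "\<And>x. (\<And>i. i \<notin> insert k J \<Longrightarrow> x i = 0) \<Longrightarrow> bil S A x x = 0 \<Longrightarrow> \<exists>c. \<forall>i. x i = c * z i"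
proof -
  let ?R = "\<lambda>x. (\<forall>i. i \<notin> insert k J \<longrightarrow> x i = 0) \<and> bil S A x x = 0"
  let ?P = "\<lambda>n. 0 < n \<and> (\<exists>x. ?R x \<and> x k = int n)"
  obtain x j where x: "?R x" "x j \<noteq> 0" using dep unfolding indep_def by blast
  have "x k \<noteq> 0"
  proof
    assume "x k = 0"
    then have "\<forall>i. i \<notin> J \<longrightarrow> x i = 0" using x by (metis insert_iff)
    then show False using indepD[OF ind, of x] x by simp
  qed
  then have "?P (nat \<bar>x k\<bar>)"
  proof (cases "0 < x k")
    case True
    then show ?thesis using x by (intro conjI exI[of _ x]) auto
  next
    case False
    have "bil S A (\<lambda>i. (-1) * x i + 0 * x i) (\<lambda>i. (-1) * x i + 0 * x i) = 0"
      using null_combination[OF nn, of x x] x by blast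
    then show ?thesis using x False \<open>x k \<noteq> 0\<close> by (intro conjI exI[of _ "\<lambda>i. (-1) * x i + 0 * x i"]) auto
  qed
  then have n: "?P (LEAST n. ?P n)" by (rule LeastI)
  define n where "n = (LEAST n. ?P n)"
  note n = n[folded n_def]
  have min: "n \<le> n'" if "?P n'" for n' unfolding n_def using that by (rule Least_le)
  obtain z where z: "?R z" "z k = int n" using n by blast
  have "\<exists>c. \<forall>i. x i = c * z i" if x: "?R x" for x
  proof -
    \<comment> \<open>Division with remainder: the coefficient at \<open>k\<close> becomes
      \<open>x k mod z k\<close>, which minimality forces to be 0.\<close>
    let ?y = "\<lambda>i. 1 * x i + (- (x k div z k)) * z i"
    have y: "?R ?y" using x z null_combination[OF nn, of x z 1 "- (x k div z k)"] by auto
    have yk: "?y k = x k mod z k" by (simp add: minus_div_mult_eq_mod[symmetric])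
    have "?y k = 0"
    proof (rule ccontr)
      assume "?y k \<noteq> 0"
      moreover have "0 \<le> ?y k" "?y k < int n" unfolding yk using z n by auto
      ultimately have "?P (nat (?y k))" using y by (intro conjI exI[of _ ?y]) auto
      from min[OF this] show False using \<open>?y k < int n\<close> \<open>0 \<le> ?y k\<close> by linarith
    qed
    then have "\<forall>i. i \<notin> J \<longrightarrow> ?y i = 0" using y by (metis insert_iff)
    then have "\<forall>i. ?y i = 0" by (rule indepD[OF ind _ conjunct2[OF y]])
    then have "x i = (x k div z k) * z i" for i by (metis add.commute add_0 add_uminus_conv_diff diff_eq_eq mult_1 mult_minus_left)
    then show ?thesis by blast
  qed
  then show ?thesis using that[of z] z n by auto
qed

text \<open>When a new vertex depends on \<open>J\<close>, the support of the minimal relation is a circuit, so some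
  coefficient is \<open>1\<close> up to sign and the corresponding vertex can be exchanged.\<close>

lemma lattice_basis:
  fixes A :: "'a \<Rightarrow> 'a \<Rightarrow> int"
  assumes nn: "nonneg_form S A" and F: "F \<subseteq> S"
  shows "\<exists>J\<subseteq>F. indep S A J \<and>
    (\<forall>k\<in>F - J. \<exists>z. z k = 1 \<and> (\<forall>i. i \<notin> insert k J \<longrightarrow> z i = 0) \<and> bil S A z z = 0)"
proof -
  have fin: "finite S" using nn by (rule nonneg_formD)
  have "finite F" using fin F by (rule finite_subset[rotated])
  then show ?thesis using F
  proof (induction F rule: finite_induct)
    case empty
    then show ?case by (auto simp: indep_def)
  next
    case (insert k F)
    then obtain J where J: "J \<subseteq> F" "indep S A J"
      and rel: "\<And>l. l \<in> F - J \<Longrightarrow> \<exists>z. z l = 1 \<and> (\<forall>i. i \<notin> insert l J \<longrightarrow> z i = 0) \<and> bil S A z z = 0"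
      by auto
    show ?case
    proof (cases "indep S A (insert k J)")
      case True
      have "\<exists>z. z l = 1 \<and> (\<forall>i. i \<notin> insert l (insert k J) \<longrightarrow> z i = 0) \<and> bil S A z z = 0"
        if l: "l \<in> insert k F - insert k J" for l
      proof -
        have "l \<in> F - J" using l by auto
        from rel[OF this] show ?thesis by blast
      qed
      then show ?thesis using True J by (intro exI[of _ "insert k J"]) auto
    next
      case False
      obtain z where z: "\<And>i. i \<notin> insert k J \<Longrightarrow> z i = 0" "bil S A z z = 0" "0 < z k"
        and uniq: "\<And>x. (\<And>i. i \<notin> insert k J \<Longrightarrow> x i = 0) \<Longrightarrow> bil S A x x = 0 \<Longrightarrow> \<exists>c. \<forall>i. x i = c * z i"
        by (rule minimal_relation[OF nn J(2) False]) blast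
      let ?T = "{i. z i \<noteq> 0}"
      have TJ: "?T \<subseteq> insert k J" using z(1) by auto
      then have TS: "?T \<subseteq> S" using J insert.prems by auto
      have appT: "app S A x i = app ?T A x i" if "\<And>j. j \<notin> ?T \<Longrightarrow> x j = 0" for x i
        using that by (intro app_support[OF TS fin]) blast
      have "\<exists>i\<in>?T. \<bar>z i\<bar> = 1"
      proof (rule circuit_unit_coefficient[OF nonneg_form_subset[OF nn TS]])
        show "?T \<noteq> {}" using z(3) by force
        show "app ?T A z i = 0" if "i \<in> ?T" for i
          using null_vector_app[OF nn z(2)] that TS appT[of z i] by auto
        show "\<exists>c. \<forall>i\<in>?T. x i = c * z i" if x: "\<And>i. i \<in> ?T \<Longrightarrow> app ?T A x i = 0" for x
        proof -
          let ?x = "\<lambda>i. if i \<in> ?T then x i else 0"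
          have "bil S A ?x ?x = bil ?T A ?x ?x" by (rule bil_support[OF TS fin]) auto
          also have "\<dots> = bil ?T A x x" by (rule bil_cong) auto
          also have "\<dots> = 0" using x by (rule app_zero_imp_null)
          finally have "bil S A ?x ?x = 0" .
          moreover have "?x i = 0" if "i \<notin> insert k J" for i using z(1)[OF that] by simp
          ultimately obtain c where "\<forall>i. ?x i = c * z i" using uniq[of ?x] by blast
          then show ?thesis by (intro exI[of _ c]) (metis (mono_tags, lifting))
        qed
      qed auto
      then obtain i where i: "z i \<noteq> 0" "\<bar>z i\<bar> = 1" by blast
      have ii: "z i * z i = 1" using i(2) by (metis abs_mult_self_eq mult_1)
      show ?thesis
      proof (cases "i = k")
        case True
        then have "z k = 1" using i z(3) by simp
        then have "\<exists>z. z l = 1 \<and> (\<forall>i. i \<notin> insert l J \<longrightarrow> z i = 0) \<and> bil S A z z = 0"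
          if "l \<in> insert k F - J" for l
          using rel[of l] z(1,2) that by (cases "l = k") blast+
        then show ?thesis using J by (intro exI[of _ J]) auto
      next
        case False
        then have iJ: "i \<in> J" using i TJ by auto
        \<comment> \<open>The exchange: \<open>i\<close>, whose coefficient in \<open>z\<close> is 1
          up to sign, leaves the basis and \<open>k\<close> enters.\<close>
        let ?J = "insert k (J - {i})"
        have "indep S A ?J" unfolding indep_def
        proof (intro allI impI, elim conjE)
          fix x j assume x: "\<forall>i'. i' \<notin> ?J \<longrightarrow> x i' = 0" "bil S A x x = 0"
          have "x i' = 0" if "i' \<notin> insert k J" for i' using x(1) that by blast
          then obtain c where c: "\<forall>i. x i = c * z i" using uniq[of x] x(2) by blast
          have "x i = 0" using x(1) False by blast
          then have "c = 0" using c i(1) by simp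
          then show "x j = 0" using c by simp
        qed
        moreover have "\<exists>z. z l = 1 \<and> (\<forall>i. i \<notin> insert l ?J \<longrightarrow> z i = 0) \<and> bil S A z z = 0"
          if l: "l \<in> insert k F - ?J" for l
        proof (cases "l = i")
          case True
          \<comment> \<open>The relation of the expelled vertex is \<open>z\<close> itself,
            multiplied by its sign \<open>z i\<close> so that the coefficient at \<open>i\<close> is
            1.\<close>
          let ?y = "\<lambda>j. z i * z j + 0 * z j"
          have "bil S A ?y ?y = 0" using z(2) by (intro null_combination[OF nn])
          moreover have "?y j = 0" if "j \<notin> insert l ?J" for j using z(1)[of j] that True by auto
          ultimately show ?thesis using True ii by (intro exI[of _ ?y]) auto
        next
          case False
          then have "l \<in> F - J" using l by auto
          then obtain y where y: "y l = 1" "\<And>i. i \<notin> insert l J \<Longrightarrow> y i = 0" "bil S A y y = 0"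
            using rel by blast
          \<comment> \<open>This clears the coordinate at \<open>i\<close>, because
            \<open>z i * z i = 1\<close>; the coefficient at \<open>l\<close> stays 1, because
            \<open>z l = 0\<close>.\<close>
          let ?y = "\<lambda>j. 1 * y j + (- (y i * z i)) * z j"
          have "bil S A ?y ?y = 0" using y(3) z(2) by (intro null_combination[OF nn])
          moreover have "?y j = 0" if "j \<notin> insert l ?J" for j
          proof (cases "j = i")
            case True
            then show ?thesis using ii by (simp add: mult.assoc)
          next
            case False
            then show ?thesis using y(2)[of j] z(1)[of j] that by auto
          qed
          moreover have "z l = 0" using z(1)[of l] l \<open>l \<in> F - J\<close> by auto
          ultimately show ?thesis using y(1) by (intro exI[of _ ?y]) auto
        qed
        moreover have "?J \<subseteq> insert k F" using J by auto
        ultimately show ?thesis by blast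
      qed
    qed
  qed
qed

lemma even_two_parts:
  fixes a b :: int
  assumes "a + b = 2" "even a" "even b" "0 \<le> a" "0 \<le> b"
  shows "a = 0 \<or> b = 0"
  using assms by presburger

text \<open>Modulo the radical every unit vector of \<open>S\<close> is an integral vector on
  \<open>J\<close> of value 2. If \<open>J\<close> splits into two orthogonal parts, the values of
  its two components are even and add up to 2, so one component vanishes. Thus every vertex belongs
  to one part, and no entry joins vertices of different parts, against the connectedness of
  \<open>S\<close>.\<close>

lemma lattice_basis_connected:
  fixes A :: "'a \<Rightarrow> 'a \<Rightarrow> int"
  assumes nn: "nonneg_form S A" and cn: "conn_form S A" and J: "J \<subseteq> S" "indep S A J"
    and rel: "\<And>k. k \<in> S - J \<Longrightarrow> \<exists>z. z k = 1 \<and> (\<forall>i. i \<notin> insert k J \<longrightarrow> z i = 0) \<and> bil S A z z = 0"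
  shows "conn_form J A"
  unfolding conn_form_def
proof (intro allI impI, rule ccontr)
  fix P assume P: "P \<subseteq> J \<and> P \<noteq> {} \<and> P \<noteq> J"
  assume "\<not> (\<exists>i\<in>P. \<exists>j\<in>J - P. A i j \<noteq> 0)"
  then have 0: "A i j = 0" if "i \<in> P" "j \<in> J - P" for i j using that by blast
  have u: "unit_form S A" and fin: "finite S" using nn by (auto dest: nonneg_formD)
  let ?Q = "J - P"
  have orth: "bil S A x y = 0" if "\<And>i. i \<notin> P \<Longrightarrow> x i = 0" "\<And>i. i \<notin> ?Q \<Longrightarrow> y i = 0" for x y
    unfolding bil_def using that 0 by (intro sum.neutral ballI) (metis mult_eq_0_iff)
  \<comment> \<open>\<open>x\<close> is supported on \<open>J\<close> and congruent to the unit
    vector of \<open>i\<close> modulo the radical.\<close>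
  let ?rep = "\<lambda>i x. (\<forall>j. j \<notin> J \<longrightarrow> x j = 0) \<and> bil S A (\<lambda>j. 1 * unit_at i j + (-1) * x j) (\<lambda>j. 1 * unit_at i j + (-1) * x j) = 0"
  have rep: "\<exists>x. ?rep i x" if i: "i \<in> S" for i
  proof (cases "i \<in> J")
    case True
    then show ?thesis by (intro exI[of _ "unit_at i"]) (auto simp: unit_at_def bil_def)
  next
    case False
    then obtain z where z: "z i = 1" "\<And>j. j \<notin> insert i J \<Longrightarrow> z j = 0" "bil S A z z = 0" using rel i by blast
    have "(\<lambda>j. 1 * unit_at i j + (-1) * (unit_at i j - z j)) = z" by auto
    then show ?thesis using z by (intro exI[of _ "\<lambda>j. unit_at i j - z j"]) (auto simp: unit_at_def)
  qed
  have part: "(\<forall>j. j \<notin> P \<longrightarrow> x j = 0) \<or> (\<forall>j. j \<notin> ?Q \<longrightarrow> x j = 0)" if i: "i \<in> S" and x: "?rep i x" for i x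
  proof -
    let ?p = "\<lambda>j. if j \<in> P then x j else 0" and ?q = "\<lambda>j. if j \<in> ?Q then x j else 0"
    let ?e = "unit_at i :: 'a \<Rightarrow> int"
    have xe: "x = (\<lambda>j. 1 * ?p j + 1 * ?q j)" using x P by (intro ext) auto
    have "app S A (\<lambda>j. 1 * ?e j + (-1) * x j) j = 0" if "j \<in> S" for j
      using null_vector_app[OF nn] x that by blast
    then have d: "app S A x j = app S A ?e j" if "j \<in> S" for j
      using that by (simp add: app_diff)
    have "bil S A x x = bil S A x ?e" unfolding bil_app using d by simp
    also have "\<dots> = bil S A ?e x" by (rule bil_sym[OF u])
    also have "\<dots> = bil S A ?e ?e" unfolding bil_app using d by simp
    also have "\<dots> = 2" using bil_unit_at_left[OF fin i, of A] app_unit_at[OF fin i, of A] unit_formD(2)[OF u i] by simp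
    finally have n2: "bil S A x x = 2" .
    have sp: "bil S A x x = bil S A ?p ?p + bil S A ?q ?q"
    proof -
      have "bil S A ?p ?q = 0" by (rule orth) auto
      then show ?thesis using bil_combination[OF u, of 1 ?p 1 ?q] unfolding xe[symmetric] by simp
    qed
    \<comment> \<open>The diagonal is 2 and every off-diagonal entry is counted twice.\<close>
    have ev: "even (bil S A y y)" for y
    proof -
      have "even (bil T A y y)" if "T \<subseteq> S" for T
        using finite_subset[OF that fin] that
      proof (induction T rule: finite_induct)
        case (insert v T)
        then show ?case using unit_formD(2,3)[OF u] by (subst bil_insert) auto
      qed (simp add: bil_def)
      then show ?thesis by blast
    qed
    have "bil S A ?p ?p = 0 \<or> bil S A ?q ?q = 0"
      by (rule even_two_parts[OF _ ev ev nonneg_formD(3)[OF nn] nonneg_formD(3)[OF nn]]) (simp only: n2 sp[symmetric])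
    then have "(\<forall>j. ?p j = 0) \<or> (\<forall>j. ?q j = 0)"
    proof
      assume "bil S A ?p ?p = 0"
      moreover have "\<forall>j. j \<notin> J \<longrightarrow> ?p j = 0" using P by auto
      ultimately show ?thesis by (intro disjI1 indepD[OF J(2)])
    next
      assume "bil S A ?q ?q = 0"
      moreover have "\<forall>j. j \<notin> J \<longrightarrow> ?q j = 0" by auto
      ultimately show ?thesis by (intro disjI2 indepD[OF J(2)])
    qed
    then show ?thesis
    proof
      assume a: "\<forall>j. ?p j = 0"
      have "x j = 0" if "j \<notin> ?Q" for j
        using a[rule_format, of j] conjunct1[OF x, rule_format, of j] that by (cases "j \<in> P") auto
      then show ?thesis by blast
    next
      assume a: "\<forall>j. ?q j = 0"
      have "x j = 0" if "j \<notin> P" for j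
        using a[rule_format, of j] conjunct1[OF x, rule_format, of j] that by (cases "j \<in> J") auto
      then show ?thesis by blast
    qed
  qed
  let ?inP = "\<lambda>i. \<exists>x. ?rep i x \<and> (\<forall>j. j \<notin> P \<longrightarrow> x j = 0)"
  have entry: "A i j = bil S A x y" if "i \<in> S" "j \<in> S" "?rep i x" "?rep j y" for i j x y
  proof -
    have "app S A (\<lambda>l. 1 * unit_at i l + (-1) * x l) l = 0" if "l \<in> S" for l
      using null_vector_app[OF nn] \<open>?rep i x\<close> that by blast
    then have di: "app S A x l = app S A (unit_at i) l" if "l \<in> S" for l using that by (simp add: app_diff)
    have "app S A (\<lambda>l. 1 * unit_at j l + (-1) * y l) l = 0" if "l \<in> S" for l
      using null_vector_app[OF nn] \<open>?rep j y\<close> that by blast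
    then have dj: "app S A y l = app S A (unit_at j) l" if "l \<in> S" for l using that by (simp add: app_diff)
    have "bil S A x y = bil S A x (unit_at j)" unfolding bil_app using dj by simp
    also have "\<dots> = bil S A (unit_at j) x" by (rule bil_sym[OF u])
    also have "\<dots> = bil S A (unit_at j) (unit_at i)" unfolding bil_app using di by simp
    also have "\<dots> = A j i" using bil_unit_at_left[OF fin that(2), of A] app_unit_at[OF fin that(1), of A] by simp
    finally show ?thesis using unit_formD(3)[OF u that(1,2)] by simp
  qed
  have J0: "\<forall>j. x j = 0" if "\<forall>j. j \<notin> P \<longrightarrow> x j = 0" "\<forall>j. j \<notin> ?Q \<longrightarrow> x j = 0" for x :: "'a \<Rightarrow> int"
    using that by blast
  have repJ: "?rep i (unit_at i)" if "i \<in> J" for i using that by (auto simp: unit_at_def bil_def)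
  \<comment> \<open>The vertices represented on \<open>P\<close>. This set contains \<open>p\<close>
    and misses \<open>q\<close>, so connectedness of \<open>S\<close> yields a nonzero entry across
    it, which is the product of a vector on \<open>P\<close> with one on the rest of
    \<open>J\<close>.\<close>
  let ?X = "{i\<in>S. ?inP i}"
  obtain p q where p: "p \<in> P" and q: "q \<in> J" "q \<notin> P" using P by blast
  have "p \<in> ?X" using repJ[of p] p P J(1) by (intro CollectI conjI exI[of _ "unit_at p"]) (auto simp: unit_at_def)
  moreover have "q \<notin> ?X"
  proof
    assume "q \<in> ?X"
    then obtain x where x: "?rep q x" "\<forall>j. j \<notin> P \<longrightarrow> x j = 0" by blast
    have "A q q = bil S A x (unit_at q)"
      using entry[of q q x "unit_at q"] x(1) repJ[OF q(1)] q J(1) by blast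
    also have "\<dots> = 0" using x(2) q by (intro orth) (auto simp: unit_at_def)
    finally show False using unit_formD(2)[OF u] q J(1) by auto
  qed
  ultimately have X: "?X \<subseteq> S \<and> ?X \<noteq> {} \<and> ?X \<noteq> S" using q J(1) by blast
  obtain i j where ij: "i \<in> ?X" "j \<in> S - ?X" "A i j \<noteq> 0"
    using cn[unfolded conn_form_def, rule_format, OF X] by blast
  obtain x where x: "?rep i x" "\<forall>j. j \<notin> P \<longrightarrow> x j = 0" using ij(1) by blast
  obtain y where y: "?rep j y" using rep[of j] ij(2) by blast
  then have "\<forall>l. l \<notin> ?Q \<longrightarrow> y l = 0" using part[of j y] ij(2) by blast
  then have "bil S A x y = 0" using x(2) by (intro orth) auto
  then show False using entry[of i j x y] ij x(1) y by auto
qed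


subsection \<open>Gram matrices of posets\<close>

text \<open>Over the reals the null vector can be scaled freely: with coefficient
  \<open>-2 / app S A x i\<close> the perturbed vector has value -2.\<close>

lemma null_vector_app_real:
  fixes A :: "'a \<Rightarrow> 'a \<Rightarrow> real"
  assumes "nonneg_form S A" "bil S A x x = 0" "i \<in> S"
  shows "app S A x i = 0"
proof (rule ccontr)
  assume n: "app S A x i \<noteq> 0"
  let ?t = "-2 / app S A x i"
  let ?y = "\<lambda>k. ?t * x k + 1 * unit_at i k"
  have "0 \<le> bil S A ?y ?y" by (rule nonneg_formD(3)[OF assms(1)])
  also have "\<dots> = 2 * ?t * app S A x i + 2"
    using assms(2) by (subst bil_perturb[OF nonneg_formD(1)[OF assms(1)] assms(3)]) simp
  also have "\<dots> = -2" using n by simp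
  finally show False by simp
qed

lemma bil_of_int:
  "bil S (\<lambda>i j. of_int (A i j)) (\<lambda>i. of_int (x i)) (\<lambda>i. of_int (y i)) = of_int (bil S A x y)"
  by (simp add: bil_def)

text \<open>The determinant of the form on \<open>J\<close> is an integer. If it were 0, there would
  be an integral kernel vector, hence an integral null vector on \<open>J\<close>; being nonzero, it
  also excludes real kernel vectors.\<close>

lemma real_independent:
  fixes A :: "'a \<Rightarrow> 'a \<Rightarrow> int" and x :: "'a \<Rightarrow> real"
  assumes nn: "nonneg_form S (\<lambda>i j. real_of_int (A i j))" and J: "J \<subseteq> S" "indep S A J"
    and x: "\<And>i. i \<notin> J \<Longrightarrow> x i = 0" "bil S (\<lambda>i j. real_of_int (A i j)) x x = 0"
  shows "x i = 0"
proof -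
  have fin: "finite S" using nn by (rule nonneg_formD)
  define m where "m = card J"
  obtain f where f: "bij_betw f {..<m} J"
    using ex_bij_betw_nat_finite[OF finite_subset[OF J(1) fin]] unfolding m_def by (auto simp: atLeast0LessThan)
  have inj: "inj_on f {..<m}" and im: "f ` {..<m} = J" using f by (auto simp: bij_betw_def)
  define M where "M = mat m m (\<lambda>(a, b). A (f a) (f b))"
  have M: "M \<in> carrier_mat m m" by (simp add: M_def)
  have "det M \<noteq> 0"
  proof
    assume "det M = 0"
    then obtain v where v: "v \<in> carrier_vec m" "v \<noteq> 0\<^sub>v m" "M *\<^sub>v v = 0\<^sub>v m"
      using det_0_iff_vec_prod_zero[OF M] by blast
    have Mv: "(\<Sum>b<m. A (f a) (f b) * v $ b) = 0" if "a < m" for a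
    proof -
      have "(M *\<^sub>v v) $ a = (\<Sum>b<m. A (f a) (f b) * v $ b)"
        using that v(1) by (simp add: M_def scalar_prod_def atLeast0LessThan)
      then show ?thesis using v(3) that by simp
    qed
    let ?y = "\<lambda>i. if i \<in> J then v $ (the_inv_into {..<m} f i) else 0"
    have y: "?y (f a) = v $ a" if "a < m" for a using that im the_inv_into_f_f[OF inj] by auto
    have "bil S A ?y ?y = bil J A ?y ?y" by (rule bil_support[OF J(1) fin]) auto
    also have "\<dots> = bil {..<m} (\<lambda>a b. A (f a) (f b)) (\<lambda>a. v $ a) (\<lambda>a. v $ a)"
      unfolding im[symmetric] bil_image[OF inj] using y im by (intro bil_cong) auto
    also have "\<dots> = 0" using Mv by (intro app_zero_imp_null) (auto simp: app_def)
    finally have "\<forall>i. ?y i = 0" by (intro indepD[OF J(2)]) auto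
    then have "v $ a = 0" if "a < m" for a using y[OF that] by metis
    then have "v = 0\<^sub>v m" using v(1) by (intro eq_vecI) auto
    then show False using v(2) by simp
  qed
  then have "det (map_mat real_of_int M) \<noteq> 0" by (simp add: of_int_hom.hom_det)
  moreover have "map_mat real_of_int M *\<^sub>v vec m (\<lambda>a. x (f a)) = 0\<^sub>v m"
  proof (rule eq_vecI)
    fix a assume "a < dim_vec (0\<^sub>v m :: real vec)"
    then have a: "a < m" by simp
    have "(map_mat real_of_int M *\<^sub>v vec m (\<lambda>a. x (f a))) $ a = (\<Sum>b<m. real_of_int (A (f a) (f b)) * x (f b))"
      using a by (simp add: M_def scalar_prod_def atLeast0LessThan)
    also have "\<dots> = app J (\<lambda>i j. real_of_int (A i j)) x (f a)"
      unfolding app_def by (rule sum.reindex_bij_betw[OF f])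
    also have "\<dots> = app S (\<lambda>i j. real_of_int (A i j)) x (f a)"
      using x(1) by (intro app_support[symmetric] J(1) fin) auto
    also have "\<dots> = 0" using null_vector_app_real[OF nn x(2)] im a J(1) by auto
    finally show "(map_mat real_of_int M *\<^sub>v vec m (\<lambda>a. x (f a))) $ a = 0\<^sub>v m $ a" using a by simp
  qed (simp add: M_def)
  ultimately have "vec m (\<lambda>a. x (f a)) = 0\<^sub>v m"
    using det_0_iff_vec_prod_zero[of "map_mat real_of_int M" m] M by (metis map_carrier_mat vec_carrier)
  then have "x (f a) = 0" if "a < m" for a using that by (metis index_vec index_zero_vec(1))
  then show ?thesis using x(1) im by (cases "i \<in> J") auto
qed

definition pform :: "('a \<times> 'a) set \<Rightarrow> 'a \<Rightarrow> 'a \<Rightarrow> int" where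
  "pform R i j = of_bool ((i, j) \<in> R) + of_bool ((j, i) \<in> R)"

abbreviation rform :: "('a \<times> 'a) set \<Rightarrow> 'a \<Rightarrow> 'a \<Rightarrow> real" where
  "rform R i j \<equiv> real_of_int (pform R i j)"

lemma gram_carrier [simp]: "gram n R \<in> carrier_mat n n"
  by (simp add: gram_def incmat_def)

lemma gram_index: "i < n \<Longrightarrow> j < n \<Longrightarrow> gram n R $$ (i, j) = rform R i j / 2"
  by (auto simp: gram_def incmat_def pform_def)

lemma qform_sum:
  assumes "G \<in> carrier_mat n n" "v \<in> carrier_vec n"
  shows "qform G v = (\<Sum>i<n. \<Sum>j<n. G $$ (i, j) * v $ i * v $ j)"
  using assms unfolding qform_def
  by (auto simp: scalar_prod_def sum_distrib_left atLeast0LessThan row_def mult_ac intro!: sum.cong)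

lemma qform_gram:
  assumes "v \<in> carrier_vec n"
  shows "qform (gram n R) v = bil {..<n} (rform R) (($) v) (($) v) / 2"
  unfolding qform_sum[OF gram_carrier assms] bil_def sum_divide_distrib
  by (intro sum.cong) (auto simp: gram_index)

lemma qform_gram_vec: "qform (gram n R) (vec n x) = bil {..<n} (rform R) x x / 2"
proof -
  have "bil {..<n} (rform R) (($) (vec n x)) (($) (vec n x)) = bil {..<n} (rform R) x x"
    by (intro bil_cong) auto
  then show ?thesis unfolding qform_gram[OF vec_carrier] by simp
qed

lemma qform_gram_int:
  assumes "v \<in> carrier_vec n"
  shows "qform (gram n R) (map_vec real_of_int v) = real_of_int (bil {..<n} (pform R) (($) v) (($) v)) / 2"
proof -
  have "bil {..<n} (rform R) (($) (map_vec real_of_int v)) (($) (map_vec real_of_int v))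
     = bil {..<n} (rform R) (\<lambda>i. real_of_int (v $ i)) (\<lambda>i. real_of_int (v $ i))"
    using assms by (intro bil_cong) auto
  then show ?thesis using assms by (simp add: qform_gram bil_of_int)
qed

lemma is_posetD:
  assumes "is_poset n R"
  shows "i < n \<Longrightarrow> (i, i) \<in> R" "(i, j) \<in> R \<Longrightarrow> i < n \<and> j < n"
    "(i, j) \<in> R \<Longrightarrow> (j, i) \<in> R \<Longrightarrow> i = j" "(i, j) \<in> R \<Longrightarrow> (j, k) \<in> R \<Longrightarrow> (i, k) \<in> R"
  using assms unfolding is_poset_def partial_order_on_def preorder_on_def refl_on_def antisym_def trans_def
  by auto

lemma unit_form_pform:
  assumes "is_poset n R"
  shows "unit_form {..<n} (pform R)" "unit_form {..<n} (rform R)"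
  using is_posetD(1)[OF assms] by (auto simp: unit_form_def pform_def)

lemma nonneg_form_rform:
  assumes "is_poset n R"
  shows "nonneg_form {..<n} (rform R) \<longleftrightarrow> nonneg_poset n R"
proof
  assume "nonneg_form {..<n} (rform R)"
  then show "nonneg_poset n R" unfolding nonneg_poset_def psd_def
    using nonneg_formD(3)[of "{..<n}" "rform R"] by (auto simp: qform_gram)
next
  assume a: "nonneg_poset n R"
  have "0 \<le> bil {..<n} (rform R) x x" for x
  proof -
    have "0 \<le> qform (gram n R) (vec n x)" using a unfolding nonneg_poset_def psd_def by simp
    then show ?thesis by (simp add: qform_gram_vec)
  qed
  then show "nonneg_form {..<n} (rform R)" unfolding nonneg_form_def using unit_form_pform[OF assms] by blast
qed

lemma nonneg_form_pform:
  assumes "is_poset n R" "nonneg_poset n R"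
  shows "nonneg_form {..<n} (pform R)"
proof -
  have "0 \<le> bil {..<n} (pform R) x x" for x
    using nonneg_formD(3)[OF iffD2[OF nonneg_form_rform[OF assms(1)] assms(2)], of "\<lambda>i. real_of_int (x i)"]
    unfolding bil_of_int by simp
  then show ?thesis unfolding nonneg_form_def using unit_form_pform[OF assms(1)] by blast
qed

subsection \<open>Rank\<close>

text \<open>The columns indexed by \<open>J\<close> are independent by \<open>ind\<close>, and
  \<open>rel\<close> expresses every other column through them, so they form a maximal independent
  set of columns.\<close>

lemma rank_eq_card:
  fixes G :: "real mat"
  assumes G: "G \<in> carrier_mat n n" and J: "J \<subseteq> {..<n}"
    and ind: "\<And>x. (\<And>i. i \<notin> J \<Longrightarrow> x i = 0) \<Longrightarrow> (\<And>i. i < n \<Longrightarrow> (\<Sum>j<n. G $$ (i, j) * x j) = 0) \<Longrightarrow> (\<And>i. x i = 0)"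
    and rel: "\<And>k. k < n \<Longrightarrow> k \<notin> J \<Longrightarrow>
      \<exists>x. x k = 1 \<and> (\<forall>i. i \<notin> insert k J \<longrightarrow> x i = 0) \<and> (\<forall>i<n. (\<Sum>j<n. G $$ (i, j) * x j) = 0)"
  shows "vec_space.rank n G = card J"
proof -
  interpret vec_space "TYPE(real)" n .
  have fJ: "finite J" using J finite_subset by blast
  have Jn: "j < n" if "j \<in> J" for j using J that by auto
  have cols: "set (cols G) = col G ` {..<n}" using G by (auto simp: cols_def)
  have colG: "col G j $ i = G $$ (i, j)" if "i < n" "j < n" for i j using that G by simp
  have sumJ: "(\<Sum>j<n. G $$ (i, j) * x j) = (\<Sum>j\<in>J. G $$ (i, j) * x j)" if "\<And>i. i \<notin> J \<Longrightarrow> x i = 0" for x i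
    using J that by (intro sum.mono_neutral_right) auto
  \<comment> \<open>The rank is computed from a set of columns, so equal columns would be counted
    once; they are excluded by the relation \<open>e_a - e_b\<close>.\<close>
  have inj: "inj_on (col G) J"
  proof (rule inj_onI, rule ccontr)
    fix a b assume ab: "a \<in> J" "b \<in> J" "col G a = col G b" "a \<noteq> b"
    let ?x = "\<lambda>i. (if i = a then 1 else 0) - (if i = b then 1 else 0) :: real"
    have z: "(\<Sum>j<n. G $$ (i, j) * ?x j) = 0" if "i < n" for i
    proof -
      have "(\<Sum>j<n. G $$ (i, j) * ?x j) = G $$ (i, a) - G $$ (i, b)"
        using Jn[OF ab(1)] Jn[OF ab(2)]
        by (simp add: right_diff_distrib sum_subtractf if_distrib[of "(*) _"] sum.delta cong: if_cong)
      moreover have "G $$ (i, a) = G $$ (i, b)"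
        using colG[OF that Jn[OF ab(1)]] colG[OF that Jn[OF ab(2)]] ab(3) by metis
      ultimately show ?thesis by linarith
    qed
    have "?x i = 0" if "i \<notin> J" for i using that ab(1,2) by auto
    then have "?x a = 0" using z by (rule ind[of ?x])
    then show False using ab(4) by simp
  qed
  let ?S = "col G ` J"
  have car: "col G ` X \<subseteq> carrier_vec n" for X using G by auto
  have lincombS: "lincomb a ?S $ i = (\<Sum>j\<in>J. a (col G j) * G $$ (i, j))" if "i < n" for a i
  proof -
    have "lincomb a ?S $ i = (\<Sum>v\<in>?S. a v * v $ i)" by (rule lincomb_index[OF that car])
    also have "\<dots> = (\<Sum>j\<in>J. a (col G j) * col G j $ i)" by (simp add: sum.reindex[OF inj])
    also have "\<dots> = (\<Sum>j\<in>J. a (col G j) * G $$ (i, j))" using Jn colG that by (intro sum.cong) auto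
    finally show ?thesis .
  qed
  have li: "lin_indpt ?S"
  proof
    assume "lin_dep ?S"
    then obtain a w where a: "lincomb a ?S = 0\<^sub>v n" "w \<in> ?S" "a w \<noteq> 0"
      using finite_lin_dep[of ?S] fJ car by blast
    let ?x = "\<lambda>j. if j \<in> J then a (col G j) else 0"
    have z: "(\<Sum>j<n. G $$ (i, j) * ?x j) = 0" if "i < n" for i
    proof -
      have "(\<Sum>j<n. G $$ (i, j) * ?x j) = (\<Sum>j\<in>J. G $$ (i, j) * ?x j)" by (rule sumJ) auto
      also have "\<dots> = lincomb a ?S $ i" unfolding lincombS[OF that] by (intro sum.cong) auto
      finally show ?thesis using a(1) that by simp
    qed
    have "?x i = 0" if "i \<notin> J" for i using that by auto
    then have x0: "?x j = 0" for j using z by (rule ind[of ?x])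
    obtain j where "j \<in> J" "w = col G j" using a(2) by blast
    then show False using x0[of j] a(3) by simp
  qed
  have max: "T = ?S" if T: "?S \<subseteq> T" "T \<subseteq> set (cols G)" "lin_indpt T" for T
  proof (rule ccontr)
    assume "T \<noteq> ?S"
    then obtain c where c: "c \<in> T" "c \<notin> ?S" using T(1) by blast
    then obtain k where k: "k < n" "c = col G k" using T(2) cols by auto
    have kJ: "k \<notin> J" using c k by auto
    obtain x where x: "x k = 1" "\<And>i. i \<notin> insert k J \<Longrightarrow> x i = 0" "\<And>i. i < n \<Longrightarrow> (\<Sum>j<n. G $$ (i, j) * x j) = 0"
      using rel[OF k(1) kJ] by blast
    have inj': "inj_on (col G) (insert k J)" using inj c(2) k(2) by auto
    let ?a = "\<lambda>v. x (the_inv_into (insert k J) (col G) v)"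
    have a: "?a (col G j) = x j" if "j \<in> insert k J" for j using that the_inv_into_f_f[OF inj'] by simp
    let ?S' = "col G ` insert k J"
    have l0: "lincomb ?a ?S' = 0\<^sub>v n"
    proof (rule eq_vecI)
      fix i assume "i < dim_vec (0\<^sub>v n :: real vec)"
      then have i: "i < n" by simp
      have "lincomb ?a ?S' $ i = (\<Sum>v\<in>?S'. ?a v * v $ i)" by (rule lincomb_index[OF i car])
      also have "\<dots> = (\<Sum>j\<in>insert k J. ?a (col G j) * col G j $ i)" by (simp only: sum.reindex[OF inj'] o_def)
      also have "\<dots> = (\<Sum>j\<in>insert k J. G $$ (i, j) * x j)"
        using a Jn k(1) colG[OF i] by (intro sum.cong) auto
      also have "\<dots> = (\<Sum>j<n. G $$ (i, j) * x j)"
        using J k(1) x(2) by (intro sum.mono_neutral_left) auto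
      finally show "lincomb ?a ?S' $ i = 0\<^sub>v n $ i" using x(3)[OF i] i by simp
    next
      show "dim_vec (lincomb ?a ?S') = dim_vec (0\<^sub>v n :: real vec)"
        using carrier_vecD[OF lincomb_closed[OF car, of _ "insert k J"]] by (metis index_zero_vec(2))
    qed
    have l1: "?S' \<subseteq> T" using T(1) c(1) k(2) by auto
    have l2: "?a c \<noteq> 0" using a[of k] x(1) k(2) by simp
    have "lin_dep T" by (rule lin_dep_crit[OF _ l1 _ _ l2 l0]) (use fJ k(2) in auto)
    then show False using T(3) by simp
  qed
  have "rank G = card ?S"
    using li max J cols by (intro rank_card_indpt[OF G]) (auto simp: maximal_def)
  then show ?thesis using inj by (simp add: card_image)
qed


subsection \<open>Integral congruence\<close>

lemma congr_index:
  fixes G :: "real mat"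
  assumes "G \<in> carrier_mat m m" "B \<in> carrier_mat m m" "k < m" "l < m"
  shows "(transpose_mat (map_mat real_of_int B) * G * map_mat real_of_int B) $$ (k, l)
    = (\<Sum>a<m. real_of_int (B $$ (a, k)) * (\<Sum>b<m. real_of_int (B $$ (b, l)) * G $$ (a, b)))"
proof -
  have "(transpose_mat (map_mat real_of_int B) * G * map_mat real_of_int B)
      = transpose_mat (map_mat real_of_int B) * (G * map_mat real_of_int B)"
    using assms by (intro assoc_mult_mat[of _ m m _ m _ m]) auto
  moreover have "(transpose_mat (map_mat real_of_int B) * (G * map_mat real_of_int B)) $$ (k, l)
      = (\<Sum>a<m. real_of_int (B $$ (a, k)) * (G * map_mat real_of_int B) $$ (a, l))"
    using assms by (simp add: scalar_prod_def atLeast0LessThan)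
  moreover have "(G * map_mat real_of_int B) $$ (a, l) = (\<Sum>b<m. real_of_int (B $$ (b, l)) * G $$ (a, b))"
    if "a < m" for a
    using assms that by (simp add: scalar_prod_def atLeast0LessThan mult.commute)
  ultimately show ?thesis by simp
qed

lemma Z_congruentI:
  fixes G G' :: "real mat"
  assumes "G \<in> carrier_mat m m" "G' \<in> carrier_mat m m" "B \<in> carrier_mat m m" "det B = 1 \<or> det B = -1"
    "\<And>k l. k < m \<Longrightarrow> l < m \<Longrightarrow> G' $$ (k, l)
      = (\<Sum>a<m. real_of_int (B $$ (a, k)) * (\<Sum>b<m. real_of_int (B $$ (b, l)) * G $$ (a, b)))"
  shows "Z_congruent m G' G"
proof -
  have "G' = transpose_mat (map_mat real_of_int B) * G * map_mat real_of_int B"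
  proof (rule eq_matI)
    fix k l assume "k < dim_row (transpose_mat (map_mat real_of_int B) * G * map_mat real_of_int B)"
      "l < dim_col (transpose_mat (map_mat real_of_int B) * G * map_mat real_of_int B)"
    then have "k < m" "l < m" using assms(1,3) by auto
    then show "G' $$ (k, l) = (transpose_mat (map_mat real_of_int B) * G * map_mat real_of_int B) $$ (k, l)"
      using assms(5) congr_index[OF assms(1,3)] by simp
  qed (use assms in auto)
  then show ?thesis unfolding Z_congruent_def using assms(3,4) by blast
qed

lemma Z_congruent_trans:
  fixes G1 G2 G3 :: "real mat"
  assumes "Z_congruent m G1 G2" "Z_congruent m G2 G3" and G3: "G3 \<in> carrier_mat m m"
  shows "Z_congruent m G1 G3"
proof -
  obtain B1 where B1: "B1 \<in> carrier_mat m m" "det B1 = 1 \<or> det B1 = -1"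
    and e1: "G1 = transpose_mat (map_mat real_of_int B1) * G2 * map_mat real_of_int B1"
    using assms(1) unfolding Z_congruent_def by blast
  obtain B2 where B2: "B2 \<in> carrier_mat m m" "det B2 = 1 \<or> det B2 = -1"
    and e2: "G2 = transpose_mat (map_mat real_of_int B2) * G3 * map_mat real_of_int B2"
    using assms(2) unfolding Z_congruent_def by blast
  let ?b1 = "map_mat real_of_int B1" and ?b2 = "map_mat real_of_int B2"
  have c: "?b1 \<in> carrier_mat m m" "?b2 \<in> carrier_mat m m"
    "transpose_mat ?b1 \<in> carrier_mat m m" "transpose_mat ?b2 \<in> carrier_mat m m"
    using B1 B2 by auto
  have h: "map_mat real_of_int (B2 * B1) = ?b2 * ?b1"
    by (rule of_int_hom.mat_hom_mult[OF B2(1) B1(1)])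
  have t: "transpose_mat (?b2 * ?b1) = transpose_mat ?b1 * transpose_mat ?b2"
    by (rule transpose_mult[OF c(2,1)])
  have "G1 = transpose_mat (map_mat real_of_int (B2 * B1)) * G3 * map_mat real_of_int (B2 * B1)"
    unfolding e1 e2 h t using c G3
    by (simp add: assoc_mult_mat[of _ m m _ m _ m])
  moreover have "det (B2 * B1) = 1 \<or> det (B2 * B1) = -1"
    using B1 B2 by (auto simp: det_mult)
  ultimately show ?thesis unfolding Z_congruent_def using B1 B2
    by (intro exI[of _ "B2 * B1"]) auto
qed

definition half_mat :: "nat \<Rightarrow> (nat \<Rightarrow> nat \<Rightarrow> int) \<Rightarrow> real mat" where
  "half_mat m A = mat m m (\<lambda>(i, j). real_of_int (A i j) / 2)"

lemma half_mat_carrier [simp]: "half_mat m A \<in> carrier_mat m m"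
  by (simp add: half_mat_def)

lemma Z_congruent_refl:
  assumes "G \<in> carrier_mat m m"
  shows "Z_congruent m G G"
  unfolding Z_congruent_def
proof (intro exI conjI)
  show "G = transpose_mat (map_mat real_of_int (1\<^sub>m m)) * G * map_mat real_of_int (1\<^sub>m m)"
    using assms by (simp add: of_int_hom.mat_hom_one)
qed auto

text \<open>\<open>A\<close> is recovered from its inflation by the inverse move, which adds
  \<open>e_i\<close> to \<open>e_j\<close> and has an elementary matrix of determinant 1.\<close>

lemma Z_congruent_infl:
  assumes ij: "i < m" "j < m" "i \<noteq> j"
  shows "Z_congruent m (half_mat m A) (half_mat m (infl i j A))"
proof (rule Z_congruentI[of _ _ _ "addrow_mat m 1 i j"])
  have col: "(\<Sum>a<m. real_of_int (addrow_mat m 1 i j $$ (a, k)) * f a) = f k + (if k = j then f i else 0)"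
    if k: "k < m" for k and f :: "nat \<Rightarrow> real"
  proof -
    have "(\<Sum>a<m. real_of_int (addrow_mat m 1 i j $$ (a, k)) * f a)
        = (\<Sum>a<m. (if a = k then f k else 0) + (if a = i then (if k = j then f i else 0) else 0))"
      using k ij by (intro sum.cong) (auto simp: algebra_simps)
    then show ?thesis using k ij by (simp add: sum.distrib sum.delta)
  qed
  fix k l assume kl: "k < m" "l < m"
  show "half_mat m A $$ (k, l) = (\<Sum>a<m. real_of_int (addrow_mat m 1 i j $$ (a, k)) *
      (\<Sum>b<m. real_of_int (addrow_mat m 1 i j $$ (b, l)) * half_mat m (infl i j A) $$ (a, b)))"
    unfolding col[OF kl(2)] col[OF kl(1)]
    using kl ij by (cases "k = j"; cases "l = j") (simp_all add: half_mat_def infl_def field_simps)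
qed (use ij in \<open>auto simp: det_addrow_mat\<close>)

lemma Z_congruent_infl_steps:
  assumes "infl_steps {..<m} A A'"
  shows "Z_congruent m (half_mat m A) (half_mat m A')"
  using assms
proof (induction rule: infl_steps.induct)
  case (none A)
  then show ?case by (simp add: Z_congruent_refl)
next
  case (more i j A A')
  then show ?case
    using Z_congruent_trans[OF Z_congruent_infl[of i m j A] more.IH] by simp
qed

lemma dyn_edge_irrefl: "dyn_valid D \<Longrightarrow> \<not> dyn_edge D i i"
  by (cases D) auto

lemma dyn_gram_index:
  assumes "dyn_valid D" "i < dyn_size D" "j < dyn_size D"
  shows "dyn_gram D $$ (i, j) = real_of_int (dyn_form D i j) / 2"
  using assms dyn_edge_irrefl[OF assms(1)] by (auto simp: dyn_gram_def graph_form_def)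

text \<open>The labelling is a permutation, and its matrix \<open>B\<close> satisfies
  \<open>B^T B = 1\<close>, so its determinant is 1 or -1.\<close>

lemma dynkin_on_Z_congruent:
  assumes "dynkin_on {..<m} A"
  shows "\<exists>D. dyn_valid D \<and> dyn_size D = m \<and> Z_congruent m (half_mat m A) (dyn_gram D)"
proof -
  obtain D f where D: "dyn_valid D" and f: "bij_betw f {..<dyn_size D} {..<m}"
    and eq: "\<And>i j. i < dyn_size D \<Longrightarrow> j < dyn_size D \<Longrightarrow> A (f i) (f j) = dyn_form D i j"
    using assms unfolding dynkin_on_def by blast
  have m: "dyn_size D = m" using bij_betw_same_card[OF f] by simp
  note f = f[unfolded m] and eq = eq[unfolded m]
  define g where "g = the_inv_into {..<m} f"
  have g: "g k < m" "f (g k) = k" if "k < m" for k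
    using that bij_betw_the_inv_into[OF f] f_the_inv_into_f_bij_betw[OF f, of k]
    unfolding g_def by (auto simp: bij_betw_def)
  have gf: "g (f a) = a" if "a < m" for a
    using that the_inv_into_f_f[of f "{..<m}" a] f unfolding g_def by (auto simp: bij_betw_def)
  let ?B = "mat m m (\<lambda>(a, k). if f a = k then 1 else 0 :: int)"
  have col: "(\<Sum>a<m. of_int (?B $$ (a, k)) * h a) = h (g k)"
    if k: "k < m" for k and h :: "nat \<Rightarrow> 'b::comm_ring_1"
  proof -
    have "(\<Sum>a<m. of_int (?B $$ (a, k)) * h a) = (\<Sum>a<m. if a = g k then h (g k) else 0)"
      using k g[OF k] gf by (intro sum.cong) auto
    then show ?thesis using g[OF k] by (simp add: sum.delta)
  qed
  have "transpose_mat ?B * ?B = 1\<^sub>m m"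
  proof (rule eq_matI)
    fix k l assume "k < dim_row (1\<^sub>m m :: int mat)" "l < dim_col (1\<^sub>m m :: int mat)"
    then have kl: "k < m" "l < m" by auto
    have "(transpose_mat ?B * ?B) $$ (k, l) = (\<Sum>a<m. of_int (?B $$ (a, k)) * ?B $$ (a, l))"
      using kl by (simp add: scalar_prod_def atLeast0LessThan)
    also have "\<dots> = ?B $$ (g k, l)" by (rule col[OF kl(1)])
    finally show "(transpose_mat ?B * ?B) $$ (k, l) = 1\<^sub>m m $$ (k, l)" using kl g by auto
  qed auto
  then have "det (transpose_mat ?B * ?B) = 1" by simp
  then have "det ?B * det ?B = 1" by (simp add: det_mult[of _ m] det_transpose[of _ m])
  then have "det ?B = 1 \<or> det ?B = -1" using zmult_eq_1_iff by blast
  then have "Z_congruent m (half_mat m A) (dyn_gram D)"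
  proof (intro Z_congruentI[of _ _ _ ?B])
    fix k l assume kl: "k < m" "l < m"
    show "half_mat m A $$ (k, l) = (\<Sum>a<m. real_of_int (?B $$ (a, k)) *
        (\<Sum>b<m. real_of_int (?B $$ (b, l)) * dyn_gram D $$ (a, b)))"
      unfolding col[OF kl(1)] col[OF kl(2)]
      using eq[OF g(1)[OF kl(1)] g(1)[OF kl(2)]] g kl dyn_gram_index[OF D] m by (simp add: half_mat_def)
  qed (auto simp: dyn_gram_def m)
  then show ?thesis using D m by blast
qed

text \<open>Inflate with the all-one vector. A null vector with a coefficient 1 in the result would
  be \<open>c\<close> times the tracked vector, whose value is nonzero; this gives
  \<open>c = 0\<close>. So only the Dynkin alternative remains.\<close>

lemma positive_form_dynkin:
  assumes nn: "nonneg_form {..<m} A" and cn: "conn_form {..<m} A" and ind: "indep {..<m} A {..<m}" and m: "0 < m"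
  shows "\<exists>D. dyn_valid D \<and> dyn_size D = m \<and> Z_congruent m (half_mat m A) (dyn_gram D)"
proof -
  let ?S = "{..<m}"
  have ind': "\<forall>i\<in>?S. x i = 0" if "bil ?S A x x = 0" for x
  proof -
    let ?x = "\<lambda>i. if i \<in> ?S then x i else 0"
    have "bil ?S A ?x ?x = bil ?S A x x" by (intro bil_cong) auto
    then have "\<forall>i. ?x i = 0" using that by (intro indepD[OF ind]) auto
    then show ?thesis by metis
  qed
  have "infl_state ?S (bil ?S A (\<lambda>_. 1) (\<lambda>_. 1)) A (\<lambda>_. 1)"
    unfolding infl_state_def
  proof (intro conjI allI impI)
    fix x assume "\<forall>i\<in>?S. app ?S A x i = 0"
    then have "bil ?S A x x = 0" by (intro app_zero_imp_null) auto
    then show "\<exists>c. \<forall>i\<in>?S. x i = c * 1" using ind' by (intro exI[of _ 0]) auto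
  qed (use nn cn in auto)
  from inflation[OF this] obtain A' z' where steps: "infl_steps ?S A A'"
    and st: "infl_state ?S (bil ?S A (\<lambda>_. 1) (\<lambda>_. 1)) A' z'"
    and np: "\<forall>i\<in>?S. \<forall>j\<in>?S. i \<noteq> j \<longrightarrow> A' i j \<le> 0" by blast
  have nn': "nonneg_form ?S A'" and cn': "conn_form ?S A'"
    and q: "bil ?S A' z' z' = bil ?S A (\<lambda>_. 1) (\<lambda>_. 1)"
    and rad': "\<And>x. (\<And>i. i \<in> ?S \<Longrightarrow> app ?S A' x i = 0) \<Longrightarrow> \<exists>c. \<forall>i\<in>?S. x i = c * z' i"
    using st unfolding infl_state_def by auto
  have "bil ?S A' z' z' \<noteq> 0" using ind'[of "\<lambda>_. 1"] q m by auto
  have "\<not> small_null ?S A'"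
  proof
    assume "small_null ?S A'"
    then obtain x i where i: "i \<in> ?S" "x i = 1" and x: "bil ?S A' x x \<le> 0" unfolding small_null_def by auto
    have x0: "bil ?S A' x x = 0" using x nonneg_formD(3)[OF nn', of x] by simp
    then obtain c where c: "\<forall>i\<in>?S. x i = c * z' i" using rad' null_vector_app[OF nn'] by blast
    have "bil ?S A' x x = bil ?S A' (\<lambda>i. c * z' i) (\<lambda>i. c * z' i)" using c by (intro bil_cong) auto
    then have "c * (c * bil ?S A' z' z') = 0" using x0 by (simp add: bil_scale_left bil_scale_right)
    then have "c = 0" using \<open>bil ?S A' z' z' \<noteq> 0\<close> by simp
    then show False using c i by auto
  qed
  moreover have "small_null ?S A' \<or> dynkin_on ?S A'"
    using nonneg_formD(1)[OF nn'] cn' np m by (intro dynkin_or_small_null) auto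
  ultimately obtain D where D: "dyn_valid D" "dyn_size D = m" "Z_congruent m (half_mat m A') (dyn_gram D)"
    using dynkin_on_Z_congruent by blast
  have "Z_congruent m (half_mat m A) (half_mat m A')"
    by (rule Z_congruent_infl_steps[OF steps])
  then have "Z_congruent m (half_mat m A) (dyn_gram D)"
    using D by (rule_tac Z_congruent_trans) (auto simp: dyn_gram_def)
  then show ?thesis using D by blast
qed

subsection \<open>Connectedness\<close>

lemma connected_conn_form:
  assumes "connected_poset n R"
  shows "conn_form {..<n} (pform R)"
  unfolding conn_form_def
proof (intro allI impI)
  fix P assume P: "P \<subseteq> {..<n} \<and> P \<noteq> {} \<and> P \<noteq> {..<n}"
  let ?E = "\<lambda>x y. hasse {0..<n} R x y \<or> hasse {0..<n} R y x"
  obtain i j where i: "i \<in> P" and j: "j < n" "j \<notin> P" using P by blast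
  then have "?E\<^sup>*\<^sup>* i j" using assms P unfolding connected_poset_def connected_on_def by auto
  then have "j \<notin> P \<longrightarrow> (\<exists>x\<in>P. \<exists>y\<in>{..<n} - P. ?E x y)"
  proof (induction rule: rtranclp_induct)
    case base
    then show ?case using i by simp
  next
    case (step y z)
    then show ?case by (cases "y \<in> P") (auto simp: hasse_def)
  qed
  then obtain x y where "x \<in> P" "y \<in> {..<n} - P" "?E x y" using j by blast
  then show "\<exists>i\<in>P. \<exists>j\<in>{..<n} - P. pform R i j \<noteq> 0"
    by (intro bexI[of _ x] bexI[of _ y]) (auto simp: hasse_def pform_def)
qed

text \<open>Induction on the size of the interval: a pair that is not a cover has an element
  strictly between, which splits the interval into two smaller ones.\<close>

lemma hasse_path:
  assumes po: "is_poset m Q" and pq: "(p, q) \<in> Q"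
  shows "(hasse {0..<m} Q)\<^sup>*\<^sup>* p q"
  using pq
proof (induction "card {k. (p, k) \<in> Q \<and> (k, q) \<in> Q}" arbitrary: p q rule: less_induct)
  case less
  have fin: "finite {k. (p, k) \<in> Q \<and> (k, q) \<in> Q}" for p q
    by (rule finite_subset[of _ "{..<m}"]) (use is_posetD(2)[OF po] in auto)
  have b: "p < m" "q < m" using is_posetD(2)[OF po less.prems] by auto
  show ?case
  proof (cases "p = q \<or> hasse {0..<m} Q p q")
    case True
    then show ?thesis by auto
  next
    case False
    then obtain k where k: "(p, k) \<in> Q" "(k, q) \<in> Q" "k \<noteq> p" "k \<noteq> q"
      using b less.prems unfolding hasse_def by auto
    have "{x. (p, x) \<in> Q \<and> (x, k) \<in> Q} \<subset> {x. (p, x) \<in> Q \<and> (x, q) \<in> Q}"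
      using k is_posetD(4)[OF po, of _ k q] is_posetD(3)[OF po, of q k] less.prems is_posetD(1)[OF po b(2)] by blast
    then have 1: "(hasse {0..<m} Q)\<^sup>*\<^sup>* p k" by (intro less.hyps psubset_card_mono fin k(1))
    have "{x. (k, x) \<in> Q \<and> (x, q) \<in> Q} \<subset> {x. (p, x) \<in> Q \<and> (x, q) \<in> Q}"
      using k is_posetD(4)[OF po, of p k] is_posetD(3)[OF po, of p k] less.prems is_posetD(1)[OF po b(1)] by blast
    then have "(hasse {0..<m} Q)\<^sup>*\<^sup>* k q" by (intro less.hyps psubset_card_mono fin k(2))
    with 1 show ?thesis by (rule rtranclp_trans)
  qed
qed

lemma conn_form_connected:
  assumes po: "is_poset m Q" and cn: "conn_form {..<m} (pform Q)"
  shows "connected_poset m Q"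
  unfolding connected_poset_def connected_on_def
proof (intro ballI)
  let ?E = "\<lambda>x y. hasse {0..<m} Q x y \<or> hasse {0..<m} Q y x"
  fix i j assume ij: "i \<in> {0..<m}" "j \<in> {0..<m}"
  have E1: "?E\<^sup>*\<^sup>* p q" if "(p, q) \<in> Q" for p q
    using hasse_path[OF po that] by (rule rtranclp_mono[THEN predicate2D, rotated]) auto
  have E2: "?E\<^sup>*\<^sup>* q p" if "(p, q) \<in> Q" for p q
    using E1[OF that]
  proof (induction rule: rtranclp_induct)
    case (step y z)
    then have "?E z y" by auto
    then show ?case using step.IH by (rule converse_rtranclp_into_rtranclp)
  qed simp
  let ?P = "{x. x < m \<and> ?E\<^sup>*\<^sup>* i x}"
  show "?E\<^sup>*\<^sup>* i j"
  proof (rule ccontr)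
    assume "\<not> ?E\<^sup>*\<^sup>* i j"
    then have "?P \<subseteq> {..<m} \<and> ?P \<noteq> {} \<and> ?P \<noteq> {..<m}" using ij by auto
    then obtain p q where pq: "p \<in> ?P" "q \<in> {..<m} - ?P" "pform Q p q \<noteq> 0"
      using cn[unfolded conn_form_def, rule_format, of ?P] by blast
    then have "(p, q) \<in> Q \<or> (q, p) \<in> Q" by (auto simp: pform_def)
    then have "?E\<^sup>*\<^sup>* p q" using E1 E2 by blast
    moreover have "?E\<^sup>*\<^sup>* i p" using pq(1) by simp
    ultimately have "?E\<^sup>*\<^sup>* i q" by (rule rtranclp_trans[rotated])
    then show False using pq(2) by auto
  qed
qed

lemma conn_form_bij:
  assumes f: "bij_betw f T S" and cn: "conn_form S A"
  shows "conn_form T (\<lambda>a b. A (f a) (f b))"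
  unfolding conn_form_def
proof (intro allI impI)
  fix P assume P: "P \<subseteq> T \<and> P \<noteq> {} \<and> P \<noteq> T"
  have im: "f ` T = S" and inj: "inj_on f T" using f by (auto simp: bij_betw_def)
  have "f ` P \<noteq> S" using P im inj inj_on_image_eq_iff[of f T P T] by auto
  then have "f ` P \<subseteq> S \<and> f ` P \<noteq> {} \<and> f ` P \<noteq> S" using P im by auto
  then obtain i j where "i \<in> f ` P" "j \<in> S - f ` P" "A i j \<noteq> 0"
    using cn[unfolded conn_form_def, rule_format, of "f ` P"] by blast
  then show "\<exists>i\<in>P. \<exists>j\<in>T - P. A (f i) (f j) \<noteq> 0" using im by blast
qed


subsection \<open>Existence of a Dynkin type\<close>

lemma app_sum: "app S A (\<lambda>l. \<Sum>i\<in>I. c i * z i l) k = (\<Sum>i\<in>I. c i * app S A (z i) k)"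
  unfolding app_def sum_distrib_left by (subst sum.swap) (simp add: mult_ac)

lemma rest_list:
  "set (rest_list n K) = {..<n} - K" "distinct (rest_list n K)"
  "length (rest_list n K) = card ({..<n} - K)"
proof -
  show s: "set (rest_list n K) = {..<n} - K" by (auto simp: rest_list_def)
  show d: "distinct (rest_list n K)" by (simp add: rest_list_def)
  show "length (rest_list n K) = card ({..<n} - K)" using distinct_card[OF d] s by simp
qed

lemma rest_list_bij:
  assumes "m = card ({..<n} - K)"
  shows "bij_betw ((!) (rest_list n K)) {..<m} ({..<n} - K)"
  using bij_betw_nth[OF rest_list(2), of "{..<m}"] rest_list(1,3) assms by simp

lemma sub_poset_is_poset:
  assumes po: "is_poset n R" and m: "m = card ({..<n} - K)"
  shows "is_poset m (sub_poset n K R)"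
proof -
  let ?f = "(!) (rest_list n K)"
  have f: "bij_betw ?f {..<m} ({..<n} - K)" by (rule rest_list_bij[OF m])
  have fn: "?f a < n" if "a < m" for a using f that by (auto simp: bij_betw_def)
  have inj: "a = b" if "a < m" "b < m" "?f a = ?f b" for a b
    using bij_betw_imp_inj_on[OF f] that by (auto simp: inj_on_def)
  have mem: "(a, b) \<in> sub_poset n K R \<longleftrightarrow> a < m \<and> b < m \<and> (?f a, ?f b) \<in> R" for a b
    by (simp add: sub_poset_def rest_list(3) m)
  show ?thesis
    unfolding is_poset_def partial_order_on_def preorder_on_def
  proof (intro conjI)
    show "sub_poset n K R \<subseteq> {0..<m} \<times> {0..<m}" using mem by auto
    show "refl_on {0..<m} (sub_poset n K R)" 
      using is_posetD(1)[OF po] mem fn by (auto simp: refl_on_def)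
    show "trans (sub_poset n K R)" 
      using is_posetD(4)[OF po] mem unfolding trans_def by blast
    show "antisym (sub_poset n K R)" 
      using is_posetD(3)[OF po] mem inj unfolding antisym_def by blast
  qed
qed

lemma pform_sub_poset:
  assumes m: "m = card ({..<n} - K)" and "a < m" "b < m"
  shows "pform (sub_poset n K R) a b = pform R (rest_list n K ! a) (rest_list n K ! b)"
  using assms by (simp add: pform_def sub_poset_def rest_list(3))

text \<open>\<open>J\<close> is the complement of \<open>k\<^sub>1, \<dots>, k\<^sub>r\<close>: a basis of the lattice modulo the radical, whose
  relations \<open>z k\<close> form the required basis of the integral kernel.\<close>

locale kernel_basis =
  fixes n :: nat and R :: "(nat \<times> nat) set" and J :: "nat set" and z :: "nat \<Rightarrow> nat \<Rightarrow> int"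
  assumes po: "is_poset n R" and nnp: "nonneg_poset n R"
    and J: "J \<subseteq> {..<n}" and ind: "indep {..<n} (pform R) J"
    and z1: "\<And>k. k \<in> {..<n} - J \<Longrightarrow> z k k = 1"
    and z0: "\<And>k i. k \<in> {..<n} - J \<Longrightarrow> i \<notin> insert k J \<Longrightarrow> z k i = 0"
    and zq: "\<And>k. k \<in> {..<n} - J \<Longrightarrow> bil {..<n} (pform R) (z k) (z k) = 0"
begin

abbreviation "K \<equiv> {..<n} - J"
abbreviation "A \<equiv> pform R"

lemma nn: "nonneg_form {..<n} A"
  by (rule nonneg_form_pform[OF po nnp])

lemma nnr: "nonneg_form {..<n} (rform R)"
  using nonneg_form_rform[OF po] nnp by simp

lemma K_compl: "{..<n} - K = J"
  using J by auto

lemma finJ: "finite J"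
  using J finite_subset by blast

lemma z_app: "k \<in> K \<Longrightarrow> i < n \<Longrightarrow> app {..<n} A (z k) i = 0"
  using null_vector_app[OF nn zq] by simp

lemma rank: "vec_space.rank n (gram n R) = card J"
proof (rule rank_eq_card[OF gram_carrier J])
  fix x :: "nat \<Rightarrow> real" and i
  assume x: "\<And>i. i \<notin> J \<Longrightarrow> x i = 0" "\<And>i. i < n \<Longrightarrow> (\<Sum>j<n. gram n R $$ (i, j) * x j) = 0"
  have "app {..<n} (rform R) x i = 0" if "i \<in> {..<n}" for i
  proof -
    have "(\<Sum>j<n. gram n R $$ (i, j) * x j) = app {..<n} (rform R) x i / 2"
      unfolding app_def sum_divide_distrib using that by (intro sum.cong) (auto simp: gram_index)
    then show ?thesis using x(2)[of i] that by simp
  qed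
  then have "bil {..<n} (rform R) x x = 0" by (rule app_zero_imp_null)
  then show "x i = 0" using real_independent[OF nnr J ind, of x i] x(1) by blast
next
  fix k assume k: "k < n" "k \<notin> J"
  have "(\<Sum>j<n. gram n R $$ (i, j) * real_of_int (z k j)) = 0" if "i < n" for i
  proof -
    have "(\<Sum>j<n. gram n R $$ (i, j) * real_of_int (z k j)) = real_of_int (app {..<n} A (z k) i) / 2"
      unfolding app_def of_int_sum sum_divide_distrib using that by (intro sum.cong) (auto simp: gram_index)
    then show ?thesis using z_app[of k i] k that by simp
  qed
  then show "\<exists>x. x k = 1 \<and> (\<forall>i. i \<notin> insert k J \<longrightarrow> x i = 0) \<and> (\<forall>i<n. (\<Sum>j<n. gram n R $$ (i, j) * x j) = 0)"
    using z1[of k] z0[of k] k by (intro exI[of _ "\<lambda>i. real_of_int (z k i)"]) auto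
qed

lemma corank: "corank n R = card K"
  using card_Diff_subset[OF finJ J] by (simp add: corank_def rank)

definition kk :: "nat \<Rightarrow> nat" where
  "kk i = sorted_list_of_set K ! i"

definition hh :: "nat \<Rightarrow> int vec" where
  "hh i = vec n (z (kk i))"

lemma kk_bij: "bij_betw kk {..<card K} K"
  unfolding kk_def[abs_def] by (rule bij_betw_nth) auto

lemma kk_in: "i < card K \<Longrightarrow> kk i \<in> K"
  using kk_bij by (auto simp: bij_betw_def)

lemma kk_mono: "strict_mono_on {..<card K} kk"
  unfolding kk_def[abs_def] strict_mono_on_def
  by (auto intro!: sorted_wrt_nth_less[OF strict_sorted_list_of_set])

lemma hh_delta: "i < card K \<Longrightarrow> j < card K \<Longrightarrow> hh i $ kk j = (if i = j then 1 else 0)"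
proof -
  assume ij: "i < card K" "j < card K"
  have "kk i = kk j \<longleftrightarrow> i = j" using inj_on_eq_iff[OF bij_betw_imp_inj_on[OF kk_bij]] ij by simp
  then show ?thesis
    using kk_in[OF ij(1)] kk_in[OF ij(2)] z1[of "kk i"] z0[of "kk i" "kk j"] by (auto simp: hh_def)
qed

lemma hh_kernel: "i < card K \<Longrightarrow> hh i \<in> int_kernel n R"
proof -
  assume i: "i < card K"
  have "bil {..<n} A (($) (hh i)) (($) (hh i)) = bil {..<n} A (z (kk i)) (z (kk i))"
    by (intro bil_cong) (auto simp: hh_def)
  then have "bil {..<n} A (($) (hh i)) (($) (hh i)) = 0" using zq[OF kk_in[OF i]] by simp
  then show ?thesis unfolding int_kernel_def using qform_gram_int[of "hh i" n R] by (simp add: hh_def)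
qed

lemma finsum_hh:
  assumes "l < n"
  shows "finsum_vec TYPE(int) n (\<lambda>i. c i \<cdot>\<^sub>v hh i) {..<card K} $ l = (\<Sum>i<card K. c i * z (kk i) l)"
  using assms by (subst index_finsum_vec) (auto simp: hh_def)

lemma finsum_hh_kk:
  assumes "j < card K"
  shows "(\<Sum>i<card K. c i * z (kk i) (kk j)) = c j"
proof -
  have "(\<Sum>i<card K. c i * z (kk i) (kk j)) = (\<Sum>i<card K. if i = j then c j else 0)"
  proof (intro sum.cong refl)
    fix i assume "i \<in> {..<card K}"
    then show "c i * z (kk i) (kk j) = (if i = j then c j else 0)"
      using hh_delta[of i j] kk_in[OF assms] assms by (auto simp: hh_def)
  qed
  then show ?thesis using assms by (simp add: sum.delta)
qed

lemma finsum_hh_carrier: "finsum_vec TYPE(int) n (\<lambda>i. c i \<cdot>\<^sub>v hh i) {..<card K} \<in> carrier_vec n"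
  by (rule finsum_vec_closed) (auto simp: hh_def)

lemma basis: "is_Z_basis n (int_kernel n R) (card K) hh"
  unfolding is_Z_basis_def
proof (intro conjI allI impI ballI)
  fix v assume v: "v \<in> int_kernel n R"
  then have vc: "v \<in> carrier_vec n" by (simp add: int_kernel_def)
  let ?x = "\<lambda>l. if l < n then v $ l else 0"
  \<comment> \<open>Each \<open>hh i\<close> is 1 at its own position \<open>kk i\<close> and 0 at
    the others, so the coefficients can be read off there. What is left of \<open>v\<close> is null
    and supported on \<open>J\<close>, hence zero.\<close>
  let ?c = "\<lambda>i. v $ kk i"
  let ?w = "\<lambda>l. \<Sum>i<card K. ?c i * z (kk i) l"
  let ?y = "\<lambda>l. ?x l - ?w l"
  have "bil {..<n} A ?x ?x = bil {..<n} A (($) v) (($) v)" by (intro bil_cong) auto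
  then have x0: "bil {..<n} A ?x ?x = 0"
    using v qform_gram_int[OF vc, of R] by (simp add: int_kernel_def)
  have "app {..<n} A ?y l = 0" if "l \<in> {..<n}" for l
  proof -
    have "app {..<n} A ?w l = (\<Sum>i<card K. ?c i * app {..<n} A (z (kk i)) l)" by (rule app_sum)
    also have "\<dots> = 0" using z_app kk_in that by (intro sum.neutral) auto
    finally show ?thesis unfolding app_diff using null_vector_app[OF nn x0 that] by simp
  qed
  then have y0: "bil {..<n} A ?y ?y = 0" by (rule app_zero_imp_null)
  have yJ: "\<forall>l. l \<notin> J \<longrightarrow> ?y l = 0"
  proof (intro allI impI)
    fix l assume l: "l \<notin> J"
    show "?y l = 0"
    proof (cases "l < n")
      case True
      then have "l \<in> kk ` {..<card K}" using l kk_bij by (auto simp: bij_betw_def)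
      then obtain j where j: "j < card K" "l = kk j" by auto
      then show ?thesis using finsum_hh_kk[OF j(1), of ?c] True by simp
    next
      case False
      have "z (kk i) l = 0" if "i < card K" for i
        using z0[OF kk_in[OF that], of l] l kk_in[OF that] False by auto
      then have "?w l = 0" by (intro sum.neutral) auto
      then show ?thesis using False by simp
    qed
  qed
  have y: "\<forall>l. ?y l = 0" by (rule indepD[OF ind yJ y0])
  have "v $ l = ?w l" if "l < n" for l using y[rule_format, of l] that by simp
  then have "v = finsum_vec TYPE(int) n (\<lambda>i. ?c i \<cdot>\<^sub>v hh i) {..<card K}"
    using vc finsum_hh_carrier[of ?c] finsum_hh[of _ ?c] by (intro eq_vecI) auto
  then show "\<exists>c. v = finsum_vec TYPE(int) n (\<lambda>i. c i \<cdot>\<^sub>v hh i) {..<card K}" by (rule exI[of _ ?c])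
next
  fix c :: "nat \<Rightarrow> int" and j
  assume c: "finsum_vec TYPE(int) n (\<lambda>i. c i \<cdot>\<^sub>v hh i) {..<card K} = 0\<^sub>v n" and j: "j < card K"
  have "c j = finsum_vec TYPE(int) n (\<lambda>i. c i \<cdot>\<^sub>v hh i) {..<card K} $ kk j"
    using finsum_hh[of "kk j" c] finsum_hh_kk[OF j, of c] kk_in[OF j] by simp
  then show "c j = 0" using c kk_in[OF j] by simp
qed (auto simp: hh_kernel, simp add: hh_def)

abbreviation "m \<equiv> card J"
abbreviation "Q \<equiv> sub_poset n K R"
abbreviation "f \<equiv> (!) (rest_list n K)"

lemma f_bij: "bij_betw f {..<m} J"
  using rest_list_bij[of m n K] by (simp only: K_compl)

lemma Q_poset: "is_poset m Q"
  by (rule sub_poset_is_poset[OF po]) (simp only: K_compl)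

lemma Q_pform: "a < m \<Longrightarrow> b < m \<Longrightarrow> pform Q a b = A (f a) (f b)"
  by (rule pform_sub_poset) (simp_all only: K_compl)

text \<open>Extension by zero along the enumeration of \<open>J\<close>. The coefficient ring is
  left open because non-negativity and positivity are needed for integral and for real
  vectors.\<close>

lemma Q_transfer:
  fixes v :: "nat \<Rightarrow> 'b::linordered_idom"
  shows "\<exists>x. (\<forall>i. i \<notin> J \<longrightarrow> x i = 0) \<and> (\<forall>a<m. x (f a) = v a) \<and>
    bil {..<n} (\<lambda>i j. of_int (A i j)) x x = bil {..<m} (\<lambda>a b. of_int (pform Q a b)) v v"
proof -
  have inj: "inj_on f {..<m}" and im: "f ` {..<m} = J" using f_bij by (auto simp: bij_betw_def)
  let ?x = "\<lambda>i. if i \<in> J then v (the_inv_into {..<m} f i) else 0"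
  have x: "?x (f a) = v a" if "a < m" for a using that im the_inv_into_f_f[OF inj] by auto
  have "bil {..<n} (\<lambda>i j. of_int (A i j)) ?x ?x = bil J (\<lambda>i j. of_int (A i j)) ?x ?x"
    by (rule bil_support[OF J]) auto
  also have "\<dots> = bil (f ` {..<m}) (\<lambda>i j. of_int (A i j)) ?x ?x" by (simp only: im)
  also have "\<dots> = bil {..<m} (\<lambda>a b. of_int (A (f a) (f b))) (?x \<circ> f) (?x \<circ> f)" by (rule bil_image[OF inj])
  also have "\<dots> = bil {..<m} (\<lambda>a b. of_int (pform Q a b)) v v"
    using x Q_pform by (intro bil_cong) auto
  finally show ?thesis using x by (intro exI[of _ ?x]) auto
qed

lemma Q_nonneg: "nonneg_form {..<m} (pform Q)" "nonneg_form {..<m} (rform Q)"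
proof -
  have "0 \<le> bil {..<m} (pform Q) v v" for v :: "nat \<Rightarrow> int"
  proof -
    obtain x where "bil {..<n} A x x = bil {..<m} (pform Q) v v" using Q_transfer[of v] by auto
    then show ?thesis using nonneg_formD(3)[OF nn, of x] by linarith
  qed
  then show "nonneg_form {..<m} (pform Q)" unfolding nonneg_form_def using unit_form_pform[OF Q_poset] by blast
  have "0 \<le> bil {..<m} (rform Q) v v" for v :: "nat \<Rightarrow> real"
  proof -
    obtain x where "bil {..<n} (rform R) x x = bil {..<m} (rform Q) v v" using Q_transfer[of v] by auto
    then show ?thesis using nonneg_formD(3)[OF nnr, of x] by linarith
  qed
  then show "nonneg_form {..<m} (rform Q)" unfolding nonneg_form_def using unit_form_pform[OF Q_poset] by blast
qed

lemma Q_indep: "indep {..<m} (pform Q) {..<m}"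
  unfolding indep_def
proof (intro allI impI, elim conjE)
  fix v :: "nat \<Rightarrow> int" and a
  assume v: "\<forall>i. i \<notin> {..<m} \<longrightarrow> v i = 0" "bil {..<m} (pform Q) v v = 0"
  obtain x where x: "\<forall>i. i \<notin> J \<longrightarrow> x i = 0" "\<forall>a<m. x (f a) = v a"
    "bil {..<n} A x x = bil {..<m} (pform Q) v v"
    using Q_transfer[of v] by auto
  have "\<forall>i. x i = 0" using v(2) x(3) by (intro indepD[OF ind x(1)]) simp
  then show "v a = 0" using x(2) v(1) by (cases "a < m") auto
qed

lemma Q_pos_def: "pos_def m (gram m Q)"
  unfolding pos_def_def
proof (intro ballI impI)
  fix v :: "real vec" assume v: "v \<in> carrier_vec m" "v \<noteq> 0\<^sub>v m"
  obtain x where x: "\<forall>i. i \<notin> J \<longrightarrow> x i = 0" "\<forall>a<m. x (f a) = v $ a"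
    "bil {..<n} (rform R) x x = bil {..<m} (rform Q) (($) v) (($) v)"
    using Q_transfer[of "($) v"] by auto
  have "bil {..<m} (rform Q) (($) v) (($) v) \<noteq> 0"
  proof
    assume "bil {..<m} (rform Q) (($) v) (($) v) = 0"
    then have "bil {..<n} (rform R) x x = 0" using x(3) by (rule trans[rotated])
    then have x0: "x i = 0" for i using real_independent[OF nnr J ind, of x i] x(1) by blast
    have "v $ a = 0" if "a < m" for a using x(2)[rule_format, OF that] x0[of "f a"] by (rule trans[OF sym])
    then have "v = 0\<^sub>v m" using x(2) v(1) by (intro eq_vecI) auto
    then show False using v(2) by simp
  qed
  then show "0 < qform (gram m Q) v"
    using nonneg_formD(3)[OF Q_nonneg(2), of "($) v"] qform_gram[OF v(1), of Q] by linarith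
qed

lemma witness:
  assumes cn: "conn_form J A" and ne: "J \<noteq> {}"
  shows "\<exists>D. dyn_valid D \<and> dyn_witness n R kk hh D"
proof -
  have kK: "kk ` {..<corank n R} = K" using kk_bij by (simp add: corank bij_betw_def)
  have nr: "n - corank n R = m" using card_Diff_subset[OF finJ J] card_mono[OF _ J] by (simp add: corank)
  have "conn_form {..<m} (\<lambda>a b. A (f a) (f b))" by (rule conn_form_bij[OF f_bij cn])
  moreover have "conn_form {..<m} (\<lambda>a b. A (f a) (f b)) \<longleftrightarrow> conn_form {..<m} (pform Q)"
    unfolding conn_form_def using Q_pform by (metis (no_types, lifting) DiffD1 lessThan_iff subsetD)
  ultimately have cnQ: "conn_form {..<m} (pform Q)" by simp
  have "0 < m" using ne finJ by (simp add: card_gt_0_iff)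
  from positive_form_dynkin[OF Q_nonneg(1) cnQ Q_indep this]
  obtain D where D: "dyn_valid D" "dyn_size D = m" "Z_congruent m (half_mat m (pform Q)) (dyn_gram D)" by blast
  have "half_mat m (pform Q) = gram m Q"
    by (rule eq_matI) (auto simp: half_mat_def gram_index carrier_matD[OF gram_carrier])
  then have "dyn_witness n R kk hh D"
    unfolding dyn_witness_def Let_def kK nr
    using kk_in kk_mono basis hh_delta conn_form_connected[OF Q_poset cnQ] Q_pos_def D
    by (auto simp: corank)
  then show ?thesis using D(1) by blast
qed

end

text \<open>This makes the choice in \<open>Dyn\<close> meaningful: every non-empty connected
  non-negative poset has a witness.\<close>

theorem dynkin_type_exists:
  assumes po: "is_poset n R" and nnp: "nonneg_poset n R" and cp: "connected_poset n R" and n: "1 \<le> n"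
  shows "\<exists>D. dyn_valid D \<and> (\<exists>k h. dyn_witness n R k h D)"
proof -
  have nn: "nonneg_form {..<n} (pform R)" by (rule nonneg_form_pform[OF po nnp])
  obtain J where JJ: "J \<subseteq> {..<n}" "indep {..<n} (pform R) J"
    and rel: "\<And>k. k \<in> {..<n} - J \<Longrightarrow> \<exists>z. z k = 1 \<and> (\<forall>i. i \<notin> insert k J \<longrightarrow> z i = 0) \<and> bil {..<n} (pform R) z z = 0"
    using lattice_basis[OF nn subset_refl] by blast
  from rel have "\<exists>z. \<forall>k\<in>{..<n} - J. z k k = 1 \<and> (\<forall>i. i \<notin> insert k J \<longrightarrow> z k i = 0) \<and> bil {..<n} (pform R) (z k) (z k) = 0"
    by (intro bchoice) blast
  then obtain z where z: "\<And>k. k \<in> {..<n} - J \<Longrightarrow> z k k = 1 \<and> (\<forall>i. i \<notin> insert k J \<longrightarrow> z k i = 0) \<and> bil {..<n} (pform R) (z k) (z k) = 0"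
    by blast
  interpret kernel_basis n R J z
    by unfold_locales (use po nnp JJ z in auto)
  have cn: "conn_form {..<n} (pform R)" by (rule connected_conn_form[OF cp])
  have "conn_form J (pform R)" by (rule lattice_basis_connected[OF nn cn JJ rel])
  \<comment> \<open>For empty \<open>J\<close> the relation at vertex 0 would be the unit vector,
    which has value 2 instead of 0.\<close>
  moreover have "J \<noteq> {}"
  proof
    assume e: "J = {}"
    have 0: "0 \<in> {..<n}" using n by simp
    then have "z 0 0 = 1" "\<And>i. i \<noteq> 0 \<Longrightarrow> z 0 i = 0" "bil {..<n} (pform R) (z 0) (z 0) = 0" using z[of 0] e by auto
    moreover from this have "z 0 = unit_at 0" by (auto simp: unit_at_def)
    ultimately show False
      using bil_unit_at_left[OF _ 0, of "pform R" "unit_at 0"] app_unit_at[OF _ 0, of "pform R" 0]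
        unit_formD(2)[OF nonneg_formD(1)[OF nn] 0] by simp
  qed
  ultimately show ?thesis using witness by blast
qed


subsection \<open>Type A posets and root vectors\<close>

text \<open>The vectors \<open>\<rho> i\<close> lie in the sum-zero sublattice of the standard
  lattice over \<open>V\<close>. Where the diagonal of \<open>F\<close> is 2 they are roots of type
  A. They may be dependent, so the notion also applies to forms with a radical.\<close>

definition root_rep :: "nat \<Rightarrow> (nat \<Rightarrow> nat \<Rightarrow> int) \<Rightarrow> bool" where
  "root_rep p F \<longleftrightarrow> (\<exists>(V :: nat set) \<rho>. finite V \<and> (\<forall>i<p. (\<Sum>c\<in>V. \<rho> i c) = 0) \<and>
     (\<forall>i<p. \<forall>j<p. (\<Sum>c\<in>V. \<rho> i c * \<rho> j c) = F i j))"

text \<open>Take the combinations of the root vectors prescribed by \<open>X\<close>. A square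
  invertible \<open>X\<close> gives congruence; a rectangular one extends a representation from a
  sub-poset to the whole poset.\<close>

lemma root_rep_transform:
  assumes "root_rep p F"
    and F': "\<And>i j. i < p' \<Longrightarrow> j < p' \<Longrightarrow> F' i j = (\<Sum>a<p. X a i * (\<Sum>b<p. X b j * F a b))"
  shows "root_rep p' F'"
proof -
  obtain V :: "nat set" and \<rho> where V: "finite V" and s: "\<And>i. i < p \<Longrightarrow> (\<Sum>c\<in>V. \<rho> i c) = 0"
    and g: "\<And>i j. i < p \<Longrightarrow> j < p \<Longrightarrow> (\<Sum>c\<in>V. \<rho> i c * \<rho> j c) = F i j"
    using assms(1) unfolding root_rep_def by blast
  let ?r = "\<lambda>i c. \<Sum>a<p. X a i * \<rho> a c"
  have "(\<Sum>c\<in>V. ?r i c) = 0" for i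
  proof -
    have "(\<Sum>c\<in>V. ?r i c) = (\<Sum>a<p. X a i * (\<Sum>c\<in>V. \<rho> a c))"
      unfolding sum_distrib_left by (rule sum.swap)
    then show ?thesis using s by simp
  qed
  moreover have "(\<Sum>c\<in>V. ?r i c * ?r j c) = F' i j" if "i < p'" "j < p'" for i j
  proof -
    have "(\<Sum>c\<in>V. ?r i c * ?r j c) = (\<Sum>c\<in>V. \<Sum>a<p. \<Sum>b<p. X a i * (X b j * (\<rho> a c * \<rho> b c)))"
      by (simp add: sum_product mult_ac)
    also have "\<dots> = (\<Sum>a<p. \<Sum>c\<in>V. \<Sum>b<p. X a i * (X b j * (\<rho> a c * \<rho> b c)))" by (rule sum.swap)
    also have "\<dots> = (\<Sum>a<p. \<Sum>b<p. \<Sum>c\<in>V. X a i * (X b j * (\<rho> a c * \<rho> b c)))"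
      by (intro sum.cong refl sum.swap)
    also have "\<dots> = (\<Sum>a<p. X a i * (\<Sum>b<p. X b j * F a b))"
      using g by (simp add: sum_distrib_left[symmetric])
    finally show ?thesis using F'[OF that] by simp
  qed
  ultimately show ?thesis unfolding root_rep_def using V by (intro exI[of _ V] exI[of _ ?r]) auto
qed

lemma sum_unit_at: "finite V \<Longrightarrow> p \<in> V \<Longrightarrow> (\<Sum>c\<in>V. unit_at p c * g c) = (g p :: int)"
  by (simp add: unit_at_def if_distrib[of "\<lambda>x. x * _"] sum.delta cong: if_cong)

lemma root_product:
  assumes "finite V" "p \<in> V" "q \<in> V"
  shows "(\<Sum>c\<in>V. (unit_at p c - unit_at q c) * (unit_at p' c - unit_at q' c))
    = unit_at p' p - unit_at q' p - unit_at p' q + (unit_at q' q :: int)"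
  using sum_unit_at[OF assms(1,2), of "\<lambda>c. unit_at p' c - unit_at q' c"]
    sum_unit_at[OF assms(1,3), of "\<lambda>c. unit_at p' c - unit_at q' c"]
  by (simp add: left_diff_distrib sum_subtractf)

lemma root_rep_A: "root_rep m (dyn_form (Dyn_A m))"
proof -
  let ?r = "\<lambda>a c. unit_at a c - unit_at (Suc a) c :: int"
  have "(\<Sum>c\<in>{..m}. ?r a c) = 0" if "a < m" for a
    using sum_unit_at[of "{..m}" a "\<lambda>_. 1"] sum_unit_at[of "{..m}" "Suc a" "\<lambda>_. 1"] that
    by (simp add: sum_subtractf)
  moreover have "(\<Sum>c\<in>{..m}. ?r a c * ?r b c) = dyn_form (Dyn_A m) a b" if "a < m" "b < m" for a b
    using that by (subst root_product) (auto simp: unit_at_def graph_form_def)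
  ultimately show ?thesis unfolding root_rep_def by (intro exI[of _ "{..m}"] exI[of _ ?r]) auto
qed

text \<open>Since the sum is 0, there is an entry of at least 1 and one of at most -1; their squares
  already use up the total 2.\<close>

lemma root_vector:
  fixes v :: "'a \<Rightarrow> int"
  assumes V: "finite V" and s: "(\<Sum>c\<in>V. v c) = 0" and q: "(\<Sum>c\<in>V. v c * v c) = 2"
  obtains p q where "p \<in> V" "q \<in> V" "p \<noteq> q" "\<And>c. c \<in> V \<Longrightarrow> v c = unit_at p c - unit_at q c"
proof -
  have "\<exists>p\<in>V. 0 < v p"
  proof (rule ccontr)
    assume "\<not> ?thesis"
    then have "\<And>c. c \<in> V \<Longrightarrow> 0 \<le> - v c" by force
    then have "\<forall>c\<in>V. - v c = 0" using s V by (subst sum_nonneg_eq_0_iff[symmetric]) (auto simp: sum_negf)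
    then show False using q by simp
  qed
  then obtain p where p: "p \<in> V" "0 < v p" by blast
  have "\<exists>q\<in>V. v q < 0"
  proof (rule ccontr)
    assume "\<not> ?thesis"
    then have "\<And>c. c \<in> V \<Longrightarrow> 0 \<le> v c" by force
    then have "\<forall>c\<in>V. v c = 0" using s V by (subst sum_nonneg_eq_0_iff[symmetric]) auto
    then show False using q by simp
  qed
  then obtain r where r: "r \<in> V" "v r < 0" by blast
  have pr: "p \<noteq> r" using p r by auto
  let ?W = "V - {p} - {r}"
  have split: "(\<Sum>c\<in>V. v c * v c) = v p * v p + (v r * v r + (\<Sum>c\<in>?W. v c * v c))"
    using V p r pr by (simp add: sum.remove[of V p] sum.remove[of "V - {p}" r])
  have W: "0 \<le> (\<Sum>c\<in>?W. v c * v c)" by (intro sum_nonneg) auto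
  have p1: "1 \<le> v p" and r1: "v r \<le> -1" using p r by auto
  have "v p \<le> v p * v p" using mult_left_mono[of 1 "v p" "v p"] p1 by simp
  moreover have "- v r \<le> v r * v r" using mult_left_mono_neg[of "v r" "-1" "v r"] r1 by simp
  ultimately have e: "v p = 1" "v r = -1" "(\<Sum>c\<in>?W. v c * v c) = 0"
    using split q W p1 r1 by linarith+
  have "\<forall>c\<in>?W. v c * v c = 0" using e(3) V by (subst (asm) sum_nonneg_eq_0_iff) auto
  then have "v c = unit_at p c - unit_at r c" if "c \<in> V" for c
    using e that pr by (auto simp: unit_at_def)
  then show ?thesis using that p r pr by blast
qed

lemma root_rep_ends:
  assumes "root_rep p F" "\<forall>i<p. F i i = 2"
  shows "\<exists>t h :: nat \<Rightarrow> nat. (\<forall>i<p. t i \<noteq> h i) \<and> (\<forall>i<p. \<forall>j<p.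
      F i j = unit_at (t j) (t i) - unit_at (h j) (t i) - unit_at (t j) (h i) + unit_at (h j) (h i))"
proof -
  obtain V :: "nat set" and \<rho> where V: "finite V" and s: "\<And>i. i < p \<Longrightarrow> (\<Sum>c\<in>V. \<rho> i c) = 0"
    and g: "\<And>i j. i < p \<Longrightarrow> j < p \<Longrightarrow> (\<Sum>c\<in>V. \<rho> i c * \<rho> j c) = F i j"
    using assms(1) unfolding root_rep_def by blast
  have "\<exists>u w. u \<in> V \<and> w \<in> V \<and> u \<noteq> w \<and> (\<forall>c\<in>V. \<rho> i c = unit_at u c - unit_at w c)" if "i < p" for i
    using root_vector[OF V s[OF that]] g[OF that that] assms(2)[rule_format, OF that] by metis
  then obtain t h where th: "\<And>i. i < p \<Longrightarrow> t i \<in> V \<and> h i \<in> V \<and> t i \<noteq> h i \<and> (\<forall>c\<in>V. \<rho> i c = unit_at (t i) c - unit_at (h i) c)"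
    by metis
  show ?thesis
  proof (intro exI conjI allI impI)
    fix i j assume ij: "i < p" "j < p"
    have "F i j = (\<Sum>c\<in>V. (unit_at (t i) c - unit_at (h i) c) * (unit_at (t j) c - unit_at (h j) c))"
      unfolding g[OF ij, symmetric] using th[OF ij(1)] th[OF ij(2)] by (intro sum.cong) auto
    also have "\<dots> = unit_at (t j) (t i) - unit_at (h j) (t i) - unit_at (t j) (h i) + unit_at (h j) (h i)"
      using th[OF ij(1)] by (intro root_product V) auto
    finally show "F i j = unit_at (t j) (t i) - unit_at (h j) (t i) - unit_at (t j) (h i) + unit_at (h j) (h i)" .
  qed (use th in blast)
qed

text \<open>Differences \<open>e_a - e_b\<close> and \<open>e_p - e_q\<close> with a common tail or
  a common head have positive product, since the terms for a tail meeting a head then vanish by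
  \<open>a \<noteq> b\<close> and \<open>p \<noteq> q\<close>.\<close>

lemma root_product_cases:
  fixes a b p q :: nat
  assumes "a \<noteq> b" "p \<noteq> q" and v: "v = unit_at p a - unit_at q a - unit_at p b + (unit_at q b :: int)"
  shows "v = -1 \<Longrightarrow> (a = q \<and> b \<noteq> p) \<or> (b = p \<and> a \<noteq> q)"
    "v = 0 \<Longrightarrow> a \<noteq> p \<and> b \<noteq> q"
    "v = 1 \<Longrightarrow> (a = p \<or> b = q) \<and> \<not> (a = p \<and> b = q)"
  using assms by (auto simp: unit_at_def split: if_splits)

text \<open>Every Dynkin graph outside type A contains a vertex with three neighbours that are pairwise
  non-adjacent, and two of the three corresponding differences of unit vectors would share an end.\<close>

lemma root_rep_type_A:
  assumes D: "dyn_valid D" and rep: "root_rep (dyn_size D) (dyn_form D)"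
  shows "D = Dyn_A (dyn_size D)"
proof (rule ccontr)
  assume nA: "D \<noteq> Dyn_A (dyn_size D)"
  have "\<exists>c x y z. c < dyn_size D \<and> x < dyn_size D \<and> y < dyn_size D \<and> z < dyn_size D \<and>
    dyn_form D x c = -1 \<and> dyn_form D y c = -1 \<and> dyn_form D z c = -1 \<and>
    dyn_form D x y = 0 \<and> dyn_form D x z = 0 \<and> dyn_form D y z = 0"
  proof (cases D)
    case (Dyn_A m)
    then show ?thesis using nA by simp
  next
    case (Dyn_D m)
    then have "4 \<le> m" using D by simp
    then show ?thesis unfolding Dyn_D
      by (intro exI[of _ 1] exI[of _ 0] exI[of _ 2] exI[of _ "m - 1"] conjI) (simp_all add: graph_form_def)
  next
    case Dyn_E6
    show ?thesis unfolding Dyn_E6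
      by (intro exI[of _ 0] exI[of _ 1] exI[of _ 2] exI[of _ 4] conjI)
        (simp_all add: graph_form_def doubleton_eq_iff)
  next
    case Dyn_E7
    show ?thesis unfolding Dyn_E7
      by (intro exI[of _ 0] exI[of _ 1] exI[of _ 2] exI[of _ 4] conjI)
        (simp_all add: graph_form_def doubleton_eq_iff)
  next
    case Dyn_E8
    show ?thesis unfolding Dyn_E8
      by (intro exI[of _ 0] exI[of _ 1] exI[of _ 2] exI[of _ 4] conjI)
        (simp_all add: graph_form_def doubleton_eq_iff)
  qed
  then obtain c x y z where v: "c < dyn_size D" "x < dyn_size D" "y < dyn_size D" "z < dyn_size D"
    and f: "dyn_form D x c = -1" "dyn_form D y c = -1" "dyn_form D z c = -1"
      "dyn_form D x y = 0" "dyn_form D x z = 0" "dyn_form D y z = 0" by blast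
  have d: "\<forall>i<dyn_size D. dyn_form D i i = 2" by (simp add: graph_form_def)
  obtain t h :: "nat \<Rightarrow> nat" where ne': "\<forall>i<dyn_size D. t i \<noteq> h i"
    and F': "\<forall>i<dyn_size D. \<forall>j<dyn_size D.
      dyn_form D i j = unit_at (t j) (t i) - unit_at (h j) (t i) - unit_at (t j) (h i) + unit_at (h j) (h i)"
    using root_rep_ends[OF rep d] by (elim exE conjE)
  note ne = ne'[rule_format] and F = F'[rule_format]
  have adj: "(t i = h c \<and> h i \<noteq> t c) \<or> (h i = t c \<and> t i \<noteq> h c)"
    if "i < dyn_size D" "dyn_form D i c = -1" for i
    by (rule root_product_cases(1)[OF ne[OF that(1)] ne[OF v(1)] F[OF that(1) v(1)] that(2)])
  have orth: "t i \<noteq> t j \<and> h i \<noteq> h j" if "i < dyn_size D" "j < dyn_size D" "dyn_form D i j = 0" for i j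
    by (rule root_product_cases(2)[OF ne[OF that(1)] ne[OF that(2)] F[OF that(1,2)] that(3)])
  show False
    using adj[OF v(2) f(1)] adj[OF v(3) f(2)] adj[OF v(4) f(3)]
      orth[OF v(2,3) f(4)] orth[OF v(2,4) f(5)] orth[OF v(3,4) f(6)] by metis
qed

text \<open>Distinct elements of a poset have form value 0 or 1, never -1, so no tail meets the head
  of another element. The labels \<open>t\<close> and \<open>h\<close> behave as if taken from
  disjoint alphabets, and only equality in the same place is recorded.\<close>

definition arrow_rep :: "nat \<Rightarrow> (nat \<times> nat) set \<Rightarrow> (nat \<Rightarrow> nat) \<Rightarrow> (nat \<Rightarrow> nat) \<Rightarrow> bool" where
  "arrow_rep n R t h \<longleftrightarrow> (\<forall>i<n. \<forall>j<n. i \<noteq> j \<longrightarrow> \<not> (t i = t j \<and> h i = h j) \<and>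
     ((i, j) \<in> R \<or> (j, i) \<in> R \<longleftrightarrow> t i = t j \<or> h i = h j))"

lemma pform_values:
  assumes "is_poset n R" "i < n" "j < n"
  shows "pform R i j = (if i = j then 2 else if (i, j) \<in> R \<or> (j, i) \<in> R then 1 else 0)"
  using is_posetD(1)[OF assms(1,2)] is_posetD(3)[OF assms(1), of i j] by (auto simp: pform_def)

lemma arrow_rep_pform:
  assumes "is_poset n R" "arrow_rep n R t h" "i < n" "j < n"
  shows "pform R i j = of_bool (t i = t j) + of_bool (h i = h j)"
  using assms(2-4) unfolding pform_values[OF assms(1,3,4)] arrow_rep_def by auto

lemma root_rep_arrow_rep:
  assumes po: "is_poset n R"
  shows "root_rep n (pform R) \<longleftrightarrow> (\<exists>t h. arrow_rep n R t h)"
proof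
  assume rep: "root_rep n (pform R)"
  have d: "\<forall>i<n. pform R i i = 2" by (simp add: pform_values[OF po])
  obtain t h :: "nat \<Rightarrow> nat" where ne': "\<forall>i<n. t i \<noteq> h i"
    and F': "\<forall>i<n. \<forall>j<n.
      pform R i j = unit_at (t j) (t i) - unit_at (h j) (t i) - unit_at (t j) (h i) + unit_at (h j) (h i)"
    using root_rep_ends[OF rep d] by (elim exE conjE)
  note ne = ne'[rule_format] and F = F'[rule_format]
  have "\<not> (t i = t j \<and> h i = h j) \<and> ((i, j) \<in> R \<or> (j, i) \<in> R \<longleftrightarrow> t i = t j \<or> h i = h j)"
    if ij: "i < n" "j < n" "i \<noteq> j" for i j
  proof -
    have "pform R i j = (if (i, j) \<in> R \<or> (j, i) \<in> R then 1 else 0)" using pform_values[OF po ij(1,2)] ij(3) by simp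
    then show ?thesis
      using root_product_cases(2,3)[OF ne[OF ij(1)] ne[OF ij(2)] F[OF ij(1,2)]]
      by (cases "(i, j) \<in> R \<or> (j, i) \<in> R") auto
  qed
  then show "\<exists>t h. arrow_rep n R t h" unfolding arrow_rep_def by blast
next
  assume "\<exists>t h. arrow_rep n R t h"
  then obtain t h where th: "arrow_rep n R t h" by blast
  \<comment> \<open>Tails are coded by even and heads by odd numbers, so that a tail and a head
    never coincide and no negative term occurs.\<close>
  let ?V = "(\<lambda>i. 2 * t i) ` {..<n} \<union> (\<lambda>i. 2 * h i + 1) ` {..<n}"
  let ?r = "\<lambda>i c. unit_at (2 * t i) c - unit_at (2 * h i + 1) c :: int"
  have par: "2 * a \<noteq> Suc (2 * b)" "Suc (2 * b) \<noteq> 2 * a" for a b :: nat by presburger+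
  have "(\<Sum>c\<in>?V. ?r i c) = 0" if "i < n" for i
    using sum_unit_at[of ?V "2 * t i" "\<lambda>_. 1"] sum_unit_at[of ?V "2 * h i + 1" "\<lambda>_. 1"] that
    by (simp add: sum_subtractf)
  moreover have "(\<Sum>c\<in>?V. ?r i c * ?r j c) = pform R i j" if "i < n" "j < n" for i j
    unfolding arrow_rep_pform[OF po th that]
    using that by (subst root_product) (auto simp: unit_at_def par)
  ultimately show "root_rep n (pform R)" unfolding root_rep_def by (intro exI[of _ ?V] exI[of _ ?r]) auto
qed

text \<open>The value of the form at \<open>x\<close> is the squared length of the combination of
  the vectors \<open>\<rho> i\<close> with coefficients \<open>x i\<close>.\<close>

lemma root_rep_nonneg:
  assumes po: "is_poset n R" and rep: "root_rep n (pform R)"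
  shows "nonneg_poset n R"
proof -
  obtain V :: "nat set" and \<rho> where V: "finite V"
    and g: "\<And>i j. i < n \<Longrightarrow> j < n \<Longrightarrow> (\<Sum>c\<in>V. \<rho> i c * \<rho> j c) = pform R i j"
    using rep unfolding root_rep_def by blast
  have "0 \<le> bil {..<n} (rform R) x x" for x
  proof -
    have "bil {..<n} (rform R) x x = (\<Sum>i<n. \<Sum>j<n. \<Sum>c\<in>V. (x i * \<rho> i c) * (x j * \<rho> j c))"
      unfolding bil_def
    proof (intro sum.cong refl)
      fix i j assume "i \<in> {..<n}" "j \<in> {..<n}"
      then have "rform R i j = (\<Sum>c\<in>V. real_of_int (\<rho> i c) * real_of_int (\<rho> j c))"
        using g[of i j] by (simp flip: of_int_mult of_int_sum)
      then show "rform R i j * x i * x j = (\<Sum>c\<in>V. (x i * \<rho> i c) * (x j * \<rho> j c))"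
        by (simp add: sum_distrib_left mult_ac)
    qed
    also have "\<dots> = (\<Sum>c\<in>V. \<Sum>i<n. \<Sum>j<n. (x i * \<rho> i c) * (x j * \<rho> j c))"
      by (subst sum.swap[of _ V], intro sum.cong refl sum.swap)
    also have "\<dots> = (\<Sum>c\<in>V. (\<Sum>i<n. x i * \<rho> i c) * (\<Sum>i<n. x i * \<rho> i c))"
      by (simp add: sum_product)
    also have "0 \<le> \<dots>" by (intro sum_nonneg) auto
    finally show ?thesis .
  qed
  then show ?thesis using nonneg_form_rform[OF po] unit_form_pform[OF po] unfolding nonneg_form_def by blast
qed

section \<open>Transfer of root representations along a Dynkin witness\<close>

lemma Z_congruent_sym:
  fixes G G' :: "real mat"
  assumes "Z_congruent m G' G" "G \<in> carrier_mat m m"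
  shows "Z_congruent m G G'"
proof -
  obtain B where B: "B \<in> carrier_mat m m" "det B = 1 \<or> det B = -1"
    and e: "G' = transpose_mat (map_mat real_of_int B) * G * map_mat real_of_int B"
    using assms(1) unfolding Z_congruent_def by blast
  \<comment> \<open>The inverse of \<open>B\<close> over the integers: the determinant is its own
    inverse, so it may multiply the adjugate.\<close>
  let ?C = "det B \<cdot>\<^sub>m adj_mat B"
  have C: "?C \<in> carrier_mat m m" using adj_mat(1)[OF B(1)] by simp
  have "B * ?C = det B \<cdot>\<^sub>m (B * adj_mat B)"
    using B(1) adj_mat(1)[OF B(1)] by (rule mult_smult_distrib)
  also have "\<dots> = 1\<^sub>m m" unfolding adj_mat(2)[OF B(1)] using B(2) by (auto intro!: eq_matI)
  finally have BC: "B * ?C = 1\<^sub>m m" .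
  have "det B * det ?C = 1" using BC det_mult[OF B(1) C] by simp
  then have dC: "det ?C = 1 \<or> det ?C = -1" using B(2) by auto
  let ?b = "map_mat real_of_int B" and ?c = "map_mat real_of_int ?C"
  have bc: "?b * ?c = 1\<^sub>m m"
    by (simp only: of_int_hom.mat_hom_mult[OF B(1) C, symmetric] BC of_int_hom.mat_hom_one)
  have car: "?b \<in> carrier_mat m m" "?c \<in> carrier_mat m m"
    "transpose_mat ?b \<in> carrier_mat m m" "transpose_mat ?c \<in> carrier_mat m m"
    using B(1) C by auto
  have tt: "transpose_mat ?c * transpose_mat ?b = 1\<^sub>m m"
    using transpose_mult[OF car(1,2)] bc by simp
  have "transpose_mat ?c * G' * ?c = (transpose_mat ?c * transpose_mat ?b) * G * (?b * ?c)"
    unfolding e using car assms(2) by (simp add: assoc_mult_mat[of _ m m _ m _ m])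
  also have "\<dots> = G" unfolding tt bc using assms(2) by simp
  finally show ?thesis unfolding Z_congruent_def using C dC by (intro exI[of _ ?C]) auto
qed

lemma Z_congruent_root_rep:
  assumes cong: "Z_congruent m G' G" and G: "G \<in> carrier_mat m m"
    and F: "\<And>i j. i < m \<Longrightarrow> j < m \<Longrightarrow> G $$ (i, j) = real_of_int (F i j) / 2"
    and F': "\<And>i j. i < m \<Longrightarrow> j < m \<Longrightarrow> G' $$ (i, j) = real_of_int (F' i j) / 2"
    and rep: "root_rep m F"
  shows "root_rep m F'"
proof -
  obtain B where B: "B \<in> carrier_mat m m"
    and e: "G' = transpose_mat (map_mat real_of_int B) * G * map_mat real_of_int B"
    using cong unfolding Z_congruent_def by blast
  show ?thesis
  proof (rule root_rep_transform[OF rep, of _ _ "\<lambda>a i. B $$ (a, i)"])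
    fix i j assume ij: "i < m" "j < m"
    have "real_of_int (F' i j) / 2 = (\<Sum>a<m. real_of_int (B $$ (a, i)) * (\<Sum>b<m. real_of_int (B $$ (b, j)) * G $$ (a, b)))"
      using congr_index[OF G B ij] F'[OF ij] e by simp
    also have "\<dots> = (\<Sum>a<m. real_of_int (B $$ (a, i)) * (\<Sum>b<m. real_of_int (B $$ (b, j)) * real_of_int (F a b))) / 2"
    proof -
      have I: "(\<Sum>b<m. real_of_int (B $$ (b, j)) * G $$ (a, b)) = (\<Sum>b<m. real_of_int (B $$ (b, j)) * real_of_int (F a b)) / 2"
        if "a < m" for a
        unfolding sum_divide_distrib using F[OF that] by (intro sum.cong) auto
      have "(\<Sum>a<m. real_of_int (B $$ (a, i)) * (\<Sum>b<m. real_of_int (B $$ (b, j)) * G $$ (a, b)))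
        = (\<Sum>a<m. real_of_int (B $$ (a, i)) * (\<Sum>b<m. real_of_int (B $$ (b, j)) * real_of_int (F a b)) / 2)"
        by (intro sum.cong refl) (simp only: lessThan_iff I times_divide_eq_right)
      then show ?thesis by (simp only: sum_divide_distrib[symmetric])
    qed
    finally have "real_of_int (F' i j) = real_of_int (\<Sum>a<m. B $$ (a, i) * (\<Sum>b<m. B $$ (b, j) * F a b))"
      by simp
    then show "F' i j = (\<Sum>a<m. B $$ (a, i) * (\<Sum>b<m. B $$ (b, j) * F a b))"
      by (simp only: of_int_eq_iff)
  qed
qed

text \<open>An arbitrary witness, not the one constructed before: the type returned by
  \<open>Dyn\<close> may come from any vertices \<open>k\<close> and any kernel basis
  \<open>h\<close>.\<close>

locale type_witness =
  fixes n R k h D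
  assumes po: "is_poset n R" and wit: "dyn_witness n R k h D" and valid: "dyn_valid D"
begin

abbreviation "r \<equiv> corank n R"
abbreviation "K \<equiv> k ` {..<r}"
abbreviation "m \<equiv> n - r"
abbreviation "Q \<equiv> sub_poset n K R"
abbreviation "f \<equiv> (!) (rest_list n K)"

lemma facts:
  "\<And>j. j < r \<Longrightarrow> k j < n" "strict_mono_on {..<r} k"
  "\<And>i. i < r \<Longrightarrow> h i \<in> int_kernel n R"
  "\<And>i j. i < r \<Longrightarrow> j < r \<Longrightarrow> h i $ k j = (if i = j then 1 else 0)"
  "dyn_size D = m" "Z_congruent m (gram m Q) (dyn_gram D)"
  using wit unfolding dyn_witness_def is_Z_basis_def by (auto simp: Let_def)

lemma Kn: "K \<subseteq> {..<n}"
  using facts(1) by auto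

lemma mcard: "m = card ({..<n} - K)"
proof -
  have "card K = r" using card_image[OF strict_mono_on_imp_inj_on[OF facts(2)]] by simp
  then show ?thesis using card_Diff_subset[OF _ Kn] by simp
qed

lemma Q_poset: "is_poset m Q"
  by (rule sub_poset_is_poset[OF po mcard])

lemma f_bij: "bij_betw f {..<m} ({..<n} - K)"
  by (rule rest_list_bij[OF mcard])

lemma Q_pform: "a < m \<Longrightarrow> b < m \<Longrightarrow> pform Q a b = pform R (f a) (f b)"
  by (rule pform_sub_poset[OF mcard])

lemma dyn_gram_carrier: "dyn_gram D \<in> carrier_mat m m"
  by (simp add: dyn_gram_def facts(5)[symmetric])

lemma root_rep_iff: "root_rep m (pform Q) \<longleftrightarrow> root_rep m (dyn_form D)"
proof
  have g: "gram m Q $$ (i, j) = rform Q i j / 2" if "i < m" "j < m" for i j using gram_index[OF that] .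
  have d: "dyn_gram D $$ (i, j) = real_of_int (dyn_form D i j) / 2" if "i < m" "j < m" for i j
    using dyn_gram_index[OF valid] that facts(5) by simp
  show "root_rep m (dyn_form D)" if "root_rep m (pform Q)"
    by (rule Z_congruent_root_rep[OF Z_congruent_sym[OF facts(6) dyn_gram_carrier] gram_carrier g d that])
  show "root_rep m (pform Q)" if "root_rep m (dyn_form D)"
    by (rule Z_congruent_root_rep[OF facts(6) dyn_gram_carrier d g that])
qed

lemma root_rep_restrict:
  assumes "root_rep n (pform R)"
  shows "root_rep m (pform Q)"
proof -
  obtain V :: "nat set" and \<rho> where V: "finite V" and s: "\<And>i. i < n \<Longrightarrow> (\<Sum>c\<in>V. \<rho> i c) = 0"
    and g: "\<And>i j. i < n \<Longrightarrow> j < n \<Longrightarrow> (\<Sum>c\<in>V. \<rho> i c * \<rho> j c) = pform R i j"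
    using assms unfolding root_rep_def by blast
  have fn: "f a < n" if "a < m" for a using f_bij that by (auto simp: bij_betw_def)
  show ?thesis unfolding root_rep_def
    using V s g fn Q_pform by (intro exI[of _ V] exI[of _ "\<lambda>a. \<rho> (f a)"]) auto
qed

text \<open>Modulo the radical every unit vector is an integral vector supported off
  \<open>K\<close>, so the whole form is obtained from its restriction by a rectangular integral
  matrix.\<close>

lemma root_rep_extend:
  assumes nnp: "nonneg_poset n R" and rep: "root_rep m (pform Q)"
  shows "root_rep n (pform R)"
proof -
  let ?A = "pform R" and ?J = "{..<n} - K"
  have nn: "nonneg_form {..<n} ?A" by (rule nonneg_form_pform[OF po nnp])
  have u: "unit_form {..<n} ?A" using nn by (rule nonneg_formD)
  let ?rep = "\<lambda>i x. (\<forall>j. j \<notin> ?J \<longrightarrow> x j = 0) \<and> (\<forall>l<n. app {..<n} ?A x l = app {..<n} ?A (unit_at i) l)"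
  have "\<exists>x. ?rep i x" if i: "i < n" for i
  proof (cases "i \<in> ?J")
    case True
    then show ?thesis by (intro exI[of _ "unit_at i"]) (auto simp: unit_at_def)
  next
    case False
    then obtain j where j: "j < r" "i = k j" using i by auto
    have hc: "h j \<in> carrier_vec n" and hq: "qform (gram n R) (map_vec real_of_int (h j)) = 0"
      using facts(3)[OF j(1)] by (auto simp: int_kernel_def)
    have "bil {..<n} ?A (($) (h j)) (($) (h j)) = 0" using hq unfolding qform_gram_int[OF hc] by simp
    then have h0: "app {..<n} ?A (($) (h j)) l = 0" if "l < n" for l using null_vector_app[OF nn] that by blast
    \<comment> \<open>Here \<open>i = k j\<close>. The kernel vector \<open>h j\<close> is 1 at
      \<open>k j\<close> and 0 at the other removed vertices, so the difference vanishes on all of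
      \<open>K\<close>.\<close>
    let ?x = "\<lambda>l. if l < n then unit_at i l - h j $ l else 0"
    have "?x l = 0" if l: "l \<notin> ?J" for l
    proof (cases "l < n")
      case True
      then obtain j' where j': "j' < r" "l = k j'" using l by auto
      then show ?thesis using facts(4)[OF j(1) j'(1)] j(2)
          strict_mono_on_imp_inj_on[OF facts(2)] j(1) by (auto simp: unit_at_def inj_on_def)
    qed simp
    moreover have "app {..<n} ?A ?x l = app {..<n} ?A (unit_at i) l" if "l < n" for l
    proof -
      have "app {..<n} ?A ?x l = app {..<n} ?A (\<lambda>l. unit_at i l - h j $ l) l" by (intro app_cong) auto
      then show ?thesis using h0[OF that] by (simp add: app_diff)
    qed
    ultimately show ?thesis by (intro exI[of _ ?x]) auto
  qed
  then obtain x where x: "\<And>i. i < n \<Longrightarrow> ?rep i (x i)" by metis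
  show ?thesis
  proof (rule root_rep_transform[OF rep, of _ _ "\<lambda>a i. x i (f a)"])
    fix i j assume ij: "i < n" "j < n"
    have xi: "\<And>l. l \<notin> ?J \<Longrightarrow> x i l = 0" "\<And>l. l < n \<Longrightarrow> app {..<n} ?A (x i) l = app {..<n} ?A (unit_at i) l"
      using x[OF ij(1)] by auto
    have xj: "\<And>l. l \<notin> ?J \<Longrightarrow> x j l = 0" "\<And>l. l < n \<Longrightarrow> app {..<n} ?A (x j) l = app {..<n} ?A (unit_at j) l"
      using x[OF ij(2)] by auto
    have inj: "inj_on f {..<m}" and im: "f ` {..<m} = ?J" using f_bij by (auto simp: bij_betw_def)
    have "bil {..<n} ?A (x i) (x j) = bil {..<n} ?A (x i) (unit_at j)" unfolding bil_app using xj by simp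
    also have "\<dots> = bil {..<n} ?A (unit_at j) (x i)" by (rule bil_sym[OF u])
    also have "\<dots> = bil {..<n} ?A (unit_at j) (unit_at i)" unfolding bil_app using xi by simp
    also have "\<dots> = ?A j i" using bil_unit_at_left[of "{..<n}" j ?A] app_unit_at[of "{..<n}" i ?A] ij by simp
    also have "\<dots> = ?A i j" using unit_formD(3)[OF u] ij by simp
    finally have "?A i j = bil {..<n} ?A (x i) (x j)" by simp
    also have "\<dots> = bil ?J ?A (x i) (x j)" using xi xj by (intro bil_support) auto
    also have "\<dots> = bil (f ` {..<m}) ?A (x i) (x j)" by (simp only: im)
    also have "\<dots> = bil {..<m} (\<lambda>a b. ?A (f a) (f b)) (x i \<circ> f) (x j \<circ> f)" by (rule bil_image[OF inj])
    also have "\<dots> = bil {..<m} (pform Q) (x i \<circ> f) (x j \<circ> f)" using Q_pform by (intro bil_cong) auto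
    also have "\<dots> = (\<Sum>a<m. x i (f a) * (\<Sum>b<m. x j (f b) * pform Q a b))"
      unfolding bil_app app_def by (simp add: mult.commute)
    finally show "?A i j = (\<Sum>a<m. x i (f a) * (\<Sum>b<m. x j (f b) * pform Q a b))" .
  qed
qed

end

text \<open>For every witnessed type, \<open>root_rep\<close> passes between the poset, its positive
  part and the Dynkin graph, and among Dynkin graphs it singles out type A. So the answer does not
  depend on which witness is chosen.\<close>

theorem type_A_iff_arrow_rep:
  assumes po: "is_poset n R" and cp: "connected_poset n R" and n: "1 \<le> n"
  shows "nonneg_poset n R \<and> Dyn n R = Dyn_A (n - corank n R) \<longleftrightarrow> (\<exists>t h. arrow_rep n R t h)"
proof -
  have wit: "\<exists>k h. dyn_valid (Dyn n R) \<and> dyn_witness n R k h (Dyn n R)" if "nonneg_poset n R"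
  proof -
    have "\<exists>D. dyn_valid D \<and> (\<exists>k h. dyn_witness n R k h D)" by (rule dynkin_type_exists[OF po that cp n])
    then have "dyn_valid (Dyn n R) \<and> (\<exists>k h. dyn_witness n R k h (Dyn n R))"
      unfolding Dyn_def by (rule someI_ex)
    then show ?thesis by blast
  qed
  show ?thesis
  proof
    assume a: "nonneg_poset n R \<and> Dyn n R = Dyn_A (n - corank n R)"
    then obtain k h where "dyn_valid (Dyn n R)" "dyn_witness n R k h (Dyn n R)" using wit by blast
    then interpret type_witness n R k h "Dyn n R" using po by unfold_locales
    have "root_rep m (dyn_form (Dyn n R))" using a root_rep_A by simp
    then have "root_rep n (pform R)" using root_rep_iff root_rep_extend a by blast
    then show "\<exists>t h. arrow_rep n R t h" using root_rep_arrow_rep[OF po] by simp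
  next
    assume "\<exists>t h. arrow_rep n R t h"
    then have rep: "root_rep n (pform R)" using root_rep_arrow_rep[OF po] by simp
    have nnp: "nonneg_poset n R" by (rule root_rep_nonneg[OF po rep])
    then obtain k h where "dyn_valid (Dyn n R)" "dyn_witness n R k h (Dyn n R)" using wit by blast
    then interpret type_witness n R k h "Dyn n R" using po by unfold_locales
    have "root_rep m (dyn_form (Dyn n R))" using root_rep_iff root_rep_restrict[OF rep] by blast
    then have "Dyn n R = Dyn_A m" using root_rep_type_A[OF valid] facts(5) by simp
    then show "nonneg_poset n R \<and> Dyn n R = Dyn_A (n - corank n R)" using nnp by simp
  qed
qed


subsection \<open>Path and cycle posets\<close>

text \<open>Both orders of \<open>a\<close> and \<open>b\<close> are allowed, which makes
  \<open>run s\<close> an equivalence relation on the vertices; its classes, the maximal ascending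
  stretches, later become labels, and those of the negated word the other labels.\<close>

definition run :: "(int \<Rightarrow> bool) \<Rightarrow> int \<Rightarrow> int \<Rightarrow> bool" where
  "run s a b \<longleftrightarrow> (\<forall>k. (a \<le> k \<and> k < b) \<or> (b \<le> k \<and> k < a) \<longrightarrow> s k)"

text \<open>The letter \<open>s k\<close> orients the edge between \<open>k\<close> and \<open>k + 1\<close>: upwards if true, downwards if false.\<close>

definition zle :: "(int \<Rightarrow> bool) \<Rightarrow> int \<Rightarrow> int \<Rightarrow> bool" where
  "zle s a b \<longleftrightarrow> (a \<le> b \<and> run s a b) \<or> (b \<le> a \<and> run (\<lambda>k. \<not> s k) a b)"

definition path_poset :: "nat \<Rightarrow> (int \<Rightarrow> bool) \<Rightarrow> (nat \<times> nat) set" where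
  "path_poset n s = {(i, j). i < n \<and> j < n \<and> zle s (int i) (int j)}"

text \<open>The cycle is unrolled to the integers: \<open>q\<close> selects the lift of
  \<open>j\<close>, so both ways around the cycle are compared by the same relation
  \<open>zle\<close>.\<close>

definition cycle_poset :: "nat \<Rightarrow> (int \<Rightarrow> bool) \<Rightarrow> (nat \<times> nat) set" where
  "cycle_poset n s = {(i, j). i < n \<and> j < n \<and> (\<exists>q. zle s (int i) (int j + q * int n))}"

definition periodic :: "nat \<Rightarrow> (int \<Rightarrow> bool) \<Rightarrow> bool" where
  "periodic n s \<longleftrightarrow> (\<forall>k. s (k + int n) = s k)"

text \<open>For \<open>l = 0\<close> or \<open>l = n\<close> the cycle is directed, which
  contradicts antisymmetry; otherwise it has one minimum and one maximum, so that the interval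
  between them is the whole cycle.\<close>

definition two_runs :: "nat \<Rightarrow> (int \<Rightarrow> bool) \<Rightarrow> bool" where
  "two_runs n s \<longleftrightarrow> (\<exists>a l. 0 \<le> l \<and> l \<le> int n \<and> (\<forall>k. a \<le> k \<and> k < a + l \<longrightarrow> s k) \<and>
     (\<forall>k. a + l \<le> k \<and> k < a + int n \<longrightarrow> \<not> s k))"

definition zmod :: "nat \<Rightarrow> int \<Rightarrow> nat" where
  "zmod n k = nat (k mod int n)"

lemma zmod_less: "0 < n \<Longrightarrow> zmod n k < n"
  by (simp add: zmod_def nat_less_iff)

lemma int_zmod: "0 < n \<Longrightarrow> int (zmod n k) = k mod int n"
  by (simp add: zmod_def)

lemma zmod_int: "i < n \<Longrightarrow> zmod n (int i) = i"
  by (simp add: zmod_def)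

lemma zmod_eq_iff: "0 < n \<Longrightarrow> zmod n a = zmod n b \<longleftrightarrow> (\<exists>q. b = a + q * int n)"
proof -
  assume n: "0 < n"
  have "zmod n a = zmod n b \<longleftrightarrow> a mod int n = b mod int n"
    by (metis int_zmod[OF n] zmod_def)
  also have "\<dots> \<longleftrightarrow> int n dvd b - a" by (metis mod_eq_dvd_iff)
  also have "\<dots> \<longleftrightarrow> (\<exists>q. b = a + q * int n)" by (auto simp: dvd_def algebra_simps)
  finally show ?thesis .
qed

lemma zmod_add [simp]: "zmod n (a + q * int n) = zmod n a" "zmod n (a + int n) = zmod n a"
  by (simp_all add: zmod_def)

lemma periodic_shift:
  assumes "periodic n s"
  shows "s (k + q * int n) = s k"
proof -
  have nat: "s (k + int m * int n) = s k" for k m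
  proof (induction m)
    case (Suc m)
    have "s (k + int (Suc m) * int n) = s ((k + int m * int n) + int n)" by (simp add: algebra_simps)
    then show ?case using assms Suc unfolding periodic_def by simp
  qed simp
  show ?thesis
  proof (cases "0 \<le> q")
    case True
    then show ?thesis using nat[of k "nat q"] by simp
  next
    case False
    then show ?thesis using nat[of "k + q * int n" "nat (- q)"] by simp
  qed
qed

lemma periodic_not: "periodic n s \<Longrightarrow> periodic n (\<lambda>k. \<not> s k)"
  by (simp add: periodic_def)

lemma run_sym: "run s a b \<Longrightarrow> run s b a"
  by (auto simp: run_def)

lemma run_refl: "run s a a"
  by (auto simp: run_def)

lemma runD: "run s a b \<Longrightarrow> a \<le> k \<Longrightarrow> k < b \<Longrightarrow> s k" "run s a b \<Longrightarrow> b \<le> k \<Longrightarrow> k < a \<Longrightarrow> s k"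
  by (auto simp: run_def)

lemma run_trans: "run s a b \<Longrightarrow> run s b c \<Longrightarrow> run s a c"
  unfolding run_def by (metis linorder_not_less order_le_less_trans order_less_le_trans)

lemma run_both: "run s a b \<Longrightarrow> run (\<lambda>k. \<not> s k) a b \<Longrightarrow> a = b"
  unfolding run_def by (metis linorder_neqE order_refl)

lemma run_shift:
  assumes "periodic n s" "run s a b"
  shows "run s (a + q * int n) (b + q * int n)"
  unfolding run_def
proof (intro allI impI)
  fix k assume "(a + q * int n \<le> k \<and> k < b + q * int n) \<or> (b + q * int n \<le> k \<and> k < a + q * int n)"
  then have "s (k - q * int n)" using assms(2) unfolding run_def by (smt (verit))
  then show "s k" using periodic_shift[OF assms(1), of "k - q * int n" q] by simp
qed

lemma zle_shift:
  assumes "periodic n s" "zle s a b"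
  shows "zle s (a + q * int n) (b + q * int n)"
  using assms(2) run_shift[OF assms(1)] run_shift[OF periodic_not[OF assms(1)]] unfolding zle_def by auto

lemma zle_refl: "zle s a a"
  by (simp add: zle_def run_refl)

lemma zle_antisym: "zle s a b \<Longrightarrow> zle s b a \<Longrightarrow> a = b"
  unfolding zle_def using run_both run_sym by (metis order_antisym)

lemma zle_trans:
  assumes ab: "zle s a b" and bc: "zle s b c"
  shows "zle s a c"
proof -
  consider "a = b" | "b = c" | "a < b" "run s a b" "b < c" "run s b c"
    | "b < a" "run (\<lambda>k. \<not> s k) a b" "c < b" "run (\<lambda>k. \<not> s k) b c"
    | "a < b" "run s a b" "c < b" "run (\<lambda>k. \<not> s k) b c"
    | "b < a" "run (\<lambda>k. \<not> s k) a b" "b < c" "run s b c"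
    using ab bc unfolding zle_def by (metis order_le_less)
  then show ?thesis
  proof cases
    \<comment> \<open>A change of direction at \<open>b\<close> is impossible: the edge below
      \<open>b\<close> would have to be oriented both ways. In the next case it is the edge above
      \<open>b\<close>.\<close>
    case 5
    then show ?thesis using runD(1)[OF 5(2), of "b - 1"] runD(2)[OF 5(4), of "b - 1"] by simp
  next
    case 6
    then show ?thesis using runD(1)[OF 6(4), of b] runD(2)[OF 6(2), of b] by simp
  qed (use ab bc run_trans in \<open>auto simp: zle_def\<close>)
qed

lemma zle_total_run: "zle s a b \<or> zle s b a \<longleftrightarrow> run s a b \<or> run (\<lambda>k. \<not> s k) a b"
  unfolding zle_def using run_sym by (metis linorder_linear)

lemma zle_not: "zle (\<lambda>k. \<not> s k) a b \<longleftrightarrow> zle s b a"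
  unfolding zle_def using run_sym by auto

lemma zle_suc: "zle s a (a + 1) \<longleftrightarrow> s a" "zle s (a + 1) a \<longleftrightarrow> \<not> s a"
  by (auto simp: zle_def run_def)

lemma zle_up: "zle s a b \<Longrightarrow> a < b \<Longrightarrow> a \<le> k \<Longrightarrow> k < b \<Longrightarrow> s k"
  unfolding zle_def run_def by auto

lemma zle_down: "zle s a b \<Longrightarrow> b < a \<Longrightarrow> b \<le> k \<Longrightarrow> k < a \<Longrightarrow> \<not> s k"
  unfolding zle_def run_def by auto

lemma zle_first_up: "zle s a b \<Longrightarrow> a < b \<Longrightarrow> zle s a (a + 1) \<and> zle s (a + 1) b"
  unfolding zle_def run_def by auto

lemma zle_first_down: "zle s a b \<Longrightarrow> b < a \<Longrightarrow> zle s a (a - 1) \<and> zle s (a - 1) b"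
  unfolding zle_def run_def by auto

lemma two_runs_not:
  assumes "periodic n s" "two_runs n s"
  shows "two_runs n (\<lambda>k. \<not> s k)"
proof -
  obtain a l where l: "0 \<le> l" "l \<le> int n" and t: "\<And>k. a \<le> k \<Longrightarrow> k < a + l \<Longrightarrow> s k"
    and f: "\<And>k. a + l \<le> k \<Longrightarrow> k < a + int n \<Longrightarrow> \<not> s k"
    using assms(2) unfolding two_runs_def by blast
  have "s k" if "a + int n \<le> k" "k < a + int n + l" for k
    using t[of "k - int n"] that assms(1) unfolding periodic_def by (metis diff_add_cancel add.commute add_diff_eq diff_less_eq le_diff_eq)
  then show ?thesis unfolding two_runs_def
    using l f by (intro exI[of _ "a + l"] exI[of _ "int n - l"]) (auto simp: algebra_simps)
qed

text \<open>The window from \<open>b\<close> to \<open>c\<close> may exceed one period, so the first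
  run is cut off after at most \<open>n\<close> letters.\<close>

lemma two_runsI:
  assumes per: "periodic n s" and b: "b \<le> a" "a \<le> c" "int n \<le> c - b"
    and t: "\<And>k. b \<le> k \<Longrightarrow> k < a \<Longrightarrow> s k" and f: "\<And>k. a \<le> k \<Longrightarrow> k < c \<Longrightarrow> \<not> s k"
  shows "two_runs n s"
  unfolding two_runs_def
proof (intro exI conjI allI impI)
  show "0 \<le> min (a - b) (int n)" "min (a - b) (int n) \<le> int n" using b by auto
  fix k
  show "s k" if "b \<le> k \<and> k < b + min (a - b) (int n)" using t[of k] that by auto
  show "\<not> s k" if "b + min (a - b) (int n) \<le> k \<and> k < b + int n"
    using f[of k] that b by (auto simp: min_def split: if_splits)
qed

lemma two_runsI':
  assumes per: "periodic n s" and b: "b \<le> a" "a \<le> c" "int n \<le> c - b"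
    and f: "\<And>k. b \<le> k \<Longrightarrow> k < a \<Longrightarrow> \<not> s k" and t: "\<And>k. a \<le> k \<Longrightarrow> k < c \<Longrightarrow> s k"
  shows "two_runs n s"
  using two_runs_not[OF periodic_not[OF per] two_runsI[OF periodic_not[OF per] b]] f t by simp

lemma cycle_poset_zmod:
  assumes n: "0 < n" and per: "periodic n s"
  shows "(zmod n a, zmod n b) \<in> cycle_poset n s \<longleftrightarrow> (\<exists>q. zle s a (b + q * int n))"
proof -
  have a: "int (zmod n a) = a + (- (a div int n)) * int n" and b: "int (zmod n b) = b + (- (b div int n)) * int n"
    using int_zmod[OF n] by (simp_all add: minus_div_mult_eq_mod[symmetric])
  have "(\<exists>q. zle s (int (zmod n a)) (int (zmod n b) + q * int n)) \<longleftrightarrow> (\<exists>q. zle s a (b + q * int n))"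
  proof
    assume "\<exists>q. zle s (int (zmod n a)) (int (zmod n b) + q * int n)"
    then obtain q where "zle s (int (zmod n a)) (int (zmod n b) + q * int n)" ..
    from zle_shift[OF per this, of "a div int n"]
    have "zle s a (b + (q - b div int n + a div int n) * int n)" unfolding a b by (simp add: algebra_simps)
    then show "\<exists>q. zle s a (b + q * int n)" ..
  next
    assume "\<exists>q. zle s a (b + q * int n)"
    then obtain q where "zle s a (b + q * int n)" ..
    from zle_shift[OF per this, of "- (a div int n)"]
    have "zle s (int (zmod n a)) (int (zmod n b) + (q + b div int n - a div int n) * int n)"
      unfolding a b by (simp add: algebra_simps)
    then show "\<exists>q. zle s (int (zmod n a)) (int (zmod n b) + q * int n)" ..
  qed
  then show ?thesis using zmod_less[OF n] by (simp add: cycle_poset_def)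
qed

lemma path_poset_is_poset: "is_poset n (path_poset n s)"
  unfolding is_poset_def partial_order_on_def preorder_on_def
proof (intro conjI)
  show "path_poset n s \<subseteq> {0..<n} \<times> {0..<n}" by (auto simp: path_poset_def)
  show "refl_on {0..<n} (path_poset n s)" by (auto simp: refl_on_def path_poset_def zle_refl)
  show "trans (path_poset n s)" unfolding trans_def path_poset_def using zle_trans by blast
  show "antisym (path_poset n s)" unfolding antisym_def path_poset_def
    using zle_antisym of_nat_eq_iff by blast
qed

text \<open>A comparison of \<open>a\<close> with a translate of itself by a nonzero multiple of
  \<open>n\<close> is a monotone stretch containing a full period, and then the word is
  constant.\<close>

lemma no_full_turn:
  assumes n: "0 < n" and per: "periodic n s" and g: "\<not> two_runs n s" and z: "zle s a (a + q * int n)"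
  shows "q = 0"
proof (rule ccontr)
  assume "q \<noteq> 0"
  then consider "1 \<le> q" | "q \<le> -1" by linarith
  then show False
  proof cases
    case 1
    then have "int n \<le> q * int n" using n mult_right_mono[of 1 q "int n"] by simp
    then have "s k" if "a \<le> k" "k < a + int n" for k
      by (rule_tac zle_up[OF z]) (use that n in linarith)+
    then have "two_runs n s" by (intro two_runsI[OF per, of a "a + int n" "a + int n"]) auto
    then show False using g by simp
  next
    case 2
    then have "q * int n \<le> - int n" using n mult_right_mono[of q "-1" "int n"] by simp
    then have "\<not> s k" if "a - int n \<le> k" "k < a" for k
      by (rule_tac zle_down[OF z]) (use that n in linarith)+
    then have "two_runs n s" by (intro two_runsI[OF per, of "a - int n" "a - int n" a]) auto
    then show False using g by simp
  qed
qed

lemma cycle_poset_is_poset: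
  assumes n: "0 < n" and per: "periodic n s" and g: "\<not> two_runs n s"
  shows "is_poset n (cycle_poset n s)"
  unfolding is_poset_def partial_order_on_def preorder_on_def
proof (intro conjI)
  show "cycle_poset n s \<subseteq> {0..<n} \<times> {0..<n}" by (auto simp: cycle_poset_def)
  have "\<exists>q. zle s (int i) (int i + q * int n)" for i by (intro exI[of _ 0]) (simp add: zle_refl)
  then show "refl_on {0..<n} (cycle_poset n s)" by (auto simp: refl_on_def cycle_poset_def)
  have tr: "zle s a (c + (q + r) * int n)" if "zle s a (b + q * int n)" "zle s b (c + r * int n)" for a b c q r
    using zle_trans[OF that(1)] zle_shift[OF per that(2), of q] by (simp add: algebra_simps)
  show "trans (cycle_poset n s)" unfolding trans_def cycle_poset_def using tr by blast
  show "antisym (cycle_poset n s)"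
  proof (rule antisymI)
    fix i j assume "(i, j) \<in> cycle_poset n s" "(j, i) \<in> cycle_poset n s"
    then obtain q r where z: "zle s (int i) (int j + q * int n)" "zle s (int j) (int i + r * int n)"
      and ij: "i < n" "j < n" by (auto simp: cycle_poset_def)
    \<comment> \<open>Going from \<open>i\<close> to \<open>j\<close> and back compares
      \<open>i\<close> with its own translate by \<open>q + r\<close> periods.\<close>
    have "q + r = 0" by (rule no_full_turn[OF n per g tr[OF z]])
    then have "zle s (int j + q * int n) (int i)"
      using zle_shift[OF per z(2), of q] by (simp add: algebra_simps)
        (metis (no_types) add.commute add_0 distrib_right mult_zero_left)
    then have "int i = int j + q * int n" using z(1) by (intro zle_antisym)
    then have "zmod n (int i) = zmod n (int j)" by simp
    then show "i = j" using ij by (simp add: zmod_int)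
  qed
qed

text \<open>The least element of its class serves as the label of an element.\<close>

lemma equivalence_labels:
  fixes E :: "nat \<Rightarrow> nat \<Rightarrow> bool"
  assumes "\<And>i. E i i" "\<And>i j. E i j \<Longrightarrow> E j i" "\<And>i j k. E i j \<Longrightarrow> E j k \<Longrightarrow> E i k"
  shows "\<exists>t :: nat \<Rightarrow> nat. \<forall>i j. t i = t j \<longleftrightarrow> E i j"
proof (intro exI allI)
  fix i j
  have L: "E i (LEAST k. E i k)" for i using assms(1) by (rule LeastI)
  show "(LEAST k. E i k) = (LEAST k. E j k) \<longleftrightarrow> E i j"
  proof
    assume "(LEAST k. E i k) = (LEAST k. E j k)"
    then show "E i j" using L[of i] L[of j] assms(2,3) by metis
  next
    assume "E i j"
    then have "E i = E j" using assms(2,3) by blast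
    then show "(LEAST k. E i k) = (LEAST k. E j k)" by simp
  qed
qed

lemma arrow_repI:
  fixes T F :: "nat \<Rightarrow> nat \<Rightarrow> bool"
  assumes "\<And>i. T i i" "\<And>i j. T i j \<Longrightarrow> T j i" "\<And>i j k. T i j \<Longrightarrow> T j k \<Longrightarrow> T i k"
    and "\<And>i. F i i" "\<And>i j. F i j \<Longrightarrow> F j i" "\<And>i j k. F i j \<Longrightarrow> F j k \<Longrightarrow> F i k"
    and "\<And>i j. i < n \<Longrightarrow> j < n \<Longrightarrow> T i j \<Longrightarrow> F i j \<Longrightarrow> i = j"
    and "\<And>i j. i < n \<Longrightarrow> j < n \<Longrightarrow> (i, j) \<in> R \<or> (j, i) \<in> R \<longleftrightarrow> T i j \<or> F i j"
  shows "\<exists>t h. arrow_rep n R t h"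
proof -
  obtain t :: "nat \<Rightarrow> nat" where "\<And>i j. t i = t j \<longleftrightarrow> T i j" using equivalence_labels[of T] assms(1-3) by metis
  moreover obtain h :: "nat \<Rightarrow> nat" where "\<And>i j. h i = h j \<longleftrightarrow> F i j" using equivalence_labels[of F] assms(4-6) by metis
  ultimately have "arrow_rep n R t h" unfolding arrow_rep_def using assms(7,8) by auto
  then show ?thesis by blast
qed

lemma path_poset_arrow_rep: "\<exists>t h. arrow_rep n (path_poset n s) t h"
proof (rule arrow_repI[where T = "\<lambda>i j. run s (int i) (int j)" and F = "\<lambda>i j. run (\<lambda>k. \<not> s k) (int i) (int j)"])
  fix i j assume "run s (int i) (int j)" "run (\<lambda>k. \<not> s k) (int i) (int j)"
  then show "i = j" using run_both[of s "int i" "int j"] by simp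
next
  fix i j assume "i < n" "j < n"
  then show "(i, j) \<in> path_poset n s \<or> (j, i) \<in> path_poset n s
      \<longleftrightarrow> run s (int i) (int j) \<or> run (\<lambda>k. \<not> s k) (int i) (int j)"
    using zle_total_run[of s "int i" "int j"] by (simp add: path_poset_def)
qed (use run_refl run_sym run_trans in blast)+

text \<open>If the two lifts of \<open>b\<close> differ, the ascending and the descending stretch
  leave \<open>a\<close> in opposite directions and together cover a full period, so the word has at
  most two runs. This shows that two distinct elements never share both labels.\<close>

lemma run_opposite:
  assumes n: "0 < n" and per: "periodic n s" and g: "\<not> two_runs n s"
    and t: "run s a b" and f: "run (\<lambda>k. \<not> s k) a (b + q * int n)"
  shows "a = b"
proof (cases "q = 0")
  case True
  then show ?thesis using run_both[OF t] f by simp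
next
  case False
  let ?c = "b + q * int n"
  have d: "int n \<le> \<bar>?c - b\<bar>" using False n mult_right_mono[of 1 "\<bar>q\<bar>" "int n"] by (simp add: abs_mult)
  have "\<not> (a < b \<and> a < ?c)" using runD(1)[OF t, of a] runD(1)[OF f, of a] by auto
  moreover have "\<not> (b < a \<and> ?c < a)"
  proof
    assume "b < a \<and> ?c < a"
    then show False using runD(2)[OF t, of "a - 1"] runD(2)[OF f, of "a - 1"] by linarith
  qed
  ultimately consider "b \<le> a" "a \<le> ?c" | "?c \<le> a" "a \<le> b" by linarith
  then have "two_runs n s"
  proof cases
    case 1
    then show ?thesis using runD(2)[OF t] runD(1)[OF f] d by (intro two_runsI[OF per 1]) auto
  next
    case 2
    then show ?thesis using runD(1)[OF t] runD(2)[OF f] d by (intro two_runsI'[OF per 2]) auto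
  qed
  then show ?thesis using g by simp
qed

lemma cycle_poset_arrow_rep:
  assumes n: "0 < n" and per: "periodic n s" and g: "\<not> two_runs n s"
  shows "\<exists>t h. arrow_rep n (cycle_poset n s) t h"
proof -
  let ?T = "\<lambda>s i j. \<exists>q. run s (int i) (int j + q * int n)"
  have rf: "?T s i i" for s i by (intro exI[of _ 0]) (simp add: run_refl)
  have sy: "?T s j i" if p: "periodic n s" and "?T s i j" for s i j
  proof -
    obtain q where "run s (int i) (int j + q * int n)" using \<open>?T s i j\<close> by blast
    from run_sym[OF run_shift[OF p this, of "- q"]] show ?thesis by (intro exI[of _ "- q"]) simp
  qed
  have tr: "?T s i k" if p: "periodic n s" and "?T s i j" "?T s j k" for s i j k
  proof -
    obtain q r where q: "run s (int i) (int j + q * int n)" and r: "run s (int j) (int k + r * int n)"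
      using \<open>?T s i j\<close> \<open>?T s j k\<close> by blast
    from run_trans[OF q run_shift[OF p r, of q]] show ?thesis
      by (intro exI[of _ "r + q"]) (simp add: algebra_simps)
  qed
  show ?thesis
  proof (rule arrow_repI[where T = "?T s" and F = "?T (\<lambda>k. \<not> s k)"])
    fix i j assume ij: "i < n" "j < n" and "?T s i j" "?T (\<lambda>k. \<not> s k) i j"
    then obtain q r where q: "run s (int i) (int j + q * int n)"
      and r: "run (\<lambda>k. \<not> s k) (int i) (int j + r * int n)" by blast
    have "int i = int j + q * int n"
      by (rule run_opposite[OF n per g q, of "r - q"]) (use r in \<open>simp add: algebra_simps\<close>)
    then have "zmod n (int i) = zmod n (int j)" by simp
    then show "i = j" using ij by (simp add: zmod_int)
  next
    fix i j assume ij: "i < n" "j < n"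
    have "(\<exists>q. zle s (int j) (int i + q * int n)) \<longleftrightarrow> (\<exists>q. zle s (int j + q * int n) (int i))"
    proof
      assume "\<exists>q. zle s (int j) (int i + q * int n)"
      then obtain q where "zle s (int j) (int i + q * int n)" ..
      from zle_shift[OF per this, of "- q"] show "\<exists>q. zle s (int j + q * int n) (int i)"
        by (intro exI[of _ "- q"]) simp
    next
      assume "\<exists>q. zle s (int j + q * int n) (int i)"
      then obtain q where "zle s (int j + q * int n) (int i)" ..
      from zle_shift[OF per this, of "- q"] show "\<exists>q. zle s (int j) (int i + q * int n)"
        by (intro exI[of _ "- q"]) simp
    qed
    then show "(i, j) \<in> cycle_poset n s \<or> (j, i) \<in> cycle_poset n s \<longleftrightarrow> ?T s i j \<or> ?T (\<lambda>k. \<not> s k) i j"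
      using ij zle_total_run[of s "int i"] unfolding cycle_poset_def by blast
  next
    fix i j k
    show "?T s i i" "?T (\<lambda>k. \<not> s k) i i" by (rule rf)+
    show "?T s i j \<Longrightarrow> ?T s j i" by (rule sy[OF per])
    show "?T (\<lambda>k. \<not> s k) i j \<Longrightarrow> ?T (\<lambda>k. \<not> s k) j i" by (rule sy[OF periodic_not[OF per]])
    show "?T s i j \<Longrightarrow> ?T s j k \<Longrightarrow> ?T s i k" by (rule tr[OF per])
    show "?T (\<lambda>k. \<not> s k) i j \<Longrightarrow> ?T (\<lambda>k. \<not> s k) j k \<Longrightarrow> ?T (\<lambda>k. \<not> s k) i k" by (rule tr[OF periodic_not[OF per]])
  qed
qed

section \<open>Hasse diagrams of path and cycle posets\<close>

lemma hasse_path_poset: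
  "hasse {0..<n} (path_poset n s) i j \<longleftrightarrow> i < n \<and> j < n \<and> ((j = i + 1 \<and> s (int i)) \<or> (i = j + 1 \<and> \<not> s (int j)))"
  (is "?H \<longleftrightarrow> ?C")
proof
  assume H: ?H
  then have ij: "i < n" "j < n" "i \<noteq> j" and z: "zle s (int i) (int j)"
    and cov: "\<And>k. k < n \<Longrightarrow> zle s (int i) (int k) \<Longrightarrow> zle s (int k) (int j) \<Longrightarrow> k = i \<or> k = j"
    by (auto simp: hasse_def path_poset_def)
  consider "i < j" | "j < i" using ij(3) by linarith
  then show ?C
  proof cases
    case 1
    then have f: "zle s (int i) (int i + 1) \<and> zle s (int i + 1) (int j)" using zle_first_up[OF z] by simp
    then have "i + 1 = i \<or> i + 1 = j" using 1 ij by (intro cov) (auto simp: add.commute)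
    then show ?thesis using f ij zle_suc(1)[of s "int i"] by auto
  next
    case 2
    then obtain i' where i': "i = Suc i'" by (cases i) auto
    have f: "zle s (int i) (int i - 1) \<and> zle s (int i - 1) (int j)" using zle_first_down[OF z] 2 by simp
    then have "i' = i \<or> i' = j" using i' ij by (intro cov) auto
    then show ?thesis using f ij i' zle_suc(2)[of s "int j"] by (auto simp: add.commute)
  qed
next
  assume C: ?C
  have "k = i \<or> k = j" if k: "zle s (int i) (int k)" "zle s (int k) (int j)" for k
  proof (rule ccontr)
    assume "\<not> (k = i \<or> k = j)"
    then have ne: "k \<noteq> i" "k \<noteq> j" by auto
    from C consider "j = i + 1" "s (int i)" | "i = j + 1" "\<not> s (int j)" by blast
    then show False
    proof cases
      case 1
      then consider "i + 1 < k" | "k < i" using ne by linarith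
      then show False
      proof cases
        assume "i + 1 < k"
        then show False using zle_up[OF k(1), of "int k - 1"] zle_down[OF k(2), of "int k - 1"] 1 by auto
      next
        assume "k < i"
        then show False using zle_down[OF k(1), of "int k"] zle_up[OF k(2), of "int k"] 1 by auto
      qed
    next
      case 2
      then consider "i < k" | "k < j" using ne by linarith
      then show False
      proof cases
        assume "i < k"
        then show False using zle_up[OF k(1), of "int k - 1"] zle_down[OF k(2), of "int k - 1"] 2 by auto
      next
        assume "k < j"
        then show False using zle_down[OF k(1), of "int k"] zle_up[OF k(2), of "int k"] 2 by auto
      qed
    qed
  qed
  moreover have "zle s (int i) (int j)" using C zle_suc[of s "int i"] zle_suc[of s "int j"] by (auto simp: add.commute)
  moreover have "i \<noteq> j" "i < n" "j < n" using C by auto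
  ultimately show ?H unfolding hasse_def path_poset_def by auto
qed

lemma hasse_converse: "hasse A (R\<inverse>) i j \<longleftrightarrow> hasse A R j i"
  unfolding hasse_def by auto

lemma cycle_poset_not:
  assumes "periodic n s"
  shows "cycle_poset n (\<lambda>k. \<not> s k) = (cycle_poset n s)\<inverse>"
proof -
  have "(\<exists>q. zle s (int j + q * int n) (int i)) \<longleftrightarrow> (\<exists>q. zle s (int j) (int i + q * int n))" for i j
  proof
    assume "\<exists>q. zle s (int j) (int i + q * int n)"
    then obtain q where "zle s (int j) (int i + q * int n)" ..
    from zle_shift[OF assms this, of "- q"] show "\<exists>q. zle s (int j + q * int n) (int i)"
      by (intro exI[of _ "- q"]) simp
  next
    assume "\<exists>q. zle s (int j + q * int n) (int i)"
    then obtain q where "zle s (int j + q * int n) (int i)" ..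
    from zle_shift[OF assms this, of "- q"] show "\<exists>q. zle s (int j) (int i + q * int n)"
      by (intro exI[of _ "- q"]) simp
  qed
  then show ?thesis unfolding cycle_poset_def zle_not by auto
qed


abbreviation hasse_adj :: "nat \<Rightarrow> (nat \<times> nat) set \<Rightarrow> nat \<Rightarrow> nat \<Rightarrow> bool" where
  "hasse_adj n R i j \<equiv> hasse {0..<n} R i j \<or> hasse {0..<n} R j i"

lemma zmod_shift: "0 < n \<Longrightarrow> zmod n (int (zmod n a) + b) = zmod n (a + b)"
  by (simp add: int_zmod) (simp add: zmod_def mod_add_left_eq)

lemma zmod_neq: "0 < d \<Longrightarrow> d < int n \<Longrightarrow> zmod n (a + d) \<noteq> zmod n a"
proof
  assume d: "0 < d" "d < int n" and e: "zmod n (a + d) = zmod n a"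
  then have n: "0 < n" by linarith
  obtain q where "a = a + d + q * int n" using e zmod_eq_iff[OF n] by blast
  then have q: "d = (- q) * int n" by simp
  then have "0 < (- q) * int n" using d(1) by simp
  then have "0 < - q" unfolding zero_less_mult_iff using n by auto
  then have "int n \<le> (- q) * int n" using mult_right_mono[of 1 "- q" "int n"] by simp
  then show False using q d by simp
qed

text \<open>The edge from \<open>a\<close> to \<open>a + 1\<close> is not a cover only if a detour
  around the cycle also leads upwards; such a detour is monotone along the unrolled line and forces
  at most two runs.\<close>

lemma hasse_cycle_up:
  assumes n: "3 \<le> n" and per: "periodic n s" and g: "\<not> two_runs n s" and sa: "s a"
  shows "hasse {0..<n} (cycle_poset n s) (zmod n a) (zmod n (a + 1))"
proof -
  have n0: "0 < n" using n by simp
  note mem = cycle_poset_zmod[OF n0 per]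
  have "(zmod n a, zmod n (a + 1)) \<in> cycle_poset n s"
    unfolding mem using sa by (intro exI[of _ 0]) (simp add: zle_suc)
  moreover have "zmod n a \<noteq> zmod n (a + 1)" using zmod_neq[of 1 n a] n by simp
  moreover have False if k: "(zmod n a, k) \<in> cycle_poset n s" "(k, zmod n (a + 1)) \<in> cycle_poset n s"
    "k \<noteq> zmod n a" "k \<noteq> zmod n (a + 1)" for k
  proof -
    have kn: "k < n" using k(1) by (simp add: cycle_poset_def)
    have kk: "k = zmod n (int k)" using zmod_int[OF kn] by simp
    obtain q where q: "zle s a (int k + q * int n)" using k(1) mem[of a "int k"] kk by auto
    obtain r where r: "zle s (int k) (a + 1 + r * int n)" using k(2) mem[of "int k" "a + 1"] kk by auto
    let ?c = "int k + q * int n"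
    let ?d = "a + 1 + (r + q) * int n"
    have ck: "zmod n ?c = k" using kk by simp
    have cd: "zle s ?c ?d" using zle_shift[OF per r, of q] by (simp add: algebra_simps)
    have ne: "?c \<noteq> a" "?c \<noteq> a + 1" using k(3,4) ck by metis+
    have ad: "zle s a ?d" by (rule zle_trans[OF q cd])
    consider "a + 1 < ?c" "?c \<le> ?d" | "a + 1 < ?c" "?d < ?c" | "?c < a" "?c < ?d" | "?c < a" "?d \<le> ?c"
      using ne by linarith
    then show False
    proof cases
      case 1
      then have "zle s (a + 1) ?d" using zle_first_up[OF ad] by auto
      then have "r + q = 0" by (rule no_full_turn[OF n0 per g])
      then show False using 1 by simp
    next
      case 2
      then show False using zle_up[OF q, of "?c - 1"] zle_down[OF cd, of "?c - 1"] by simp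
    next
      case 3
      then show False using zle_up[OF cd, of ?c] zle_down[OF q, of ?c] by simp
    next
      \<comment> \<open>The detour runs backwards over at least \<open>n - 1\<close> descending
        edges; with the ascending edge at \<open>a\<close> these fill a period with two
        runs.\<close>
      case 4
      then have "(r + q) * int n < 0" by linarith
      then have "r + q \<le> -1" using n0 by (simp add: mult_less_0_iff)
      then have "(r + q) * int n \<le> - int n" using mult_right_mono[of "r + q" "-1" "int n"] by simp
      then have "?d \<le> a + 1 - int n" by linarith
      then have "\<not> s l" if "a + 1 - int n \<le> l" "l < a" for l
        using zle_down[OF ad, of l] that 4 by linarith
      moreover have "s l" if "a \<le> l" "l < a + 1" for l using that sa by (metis zle_add1_eq_le order_antisym add.commute)
      ultimately have "two_runs n s" using n by (intro two_runsI'[OF per, of "a + 1 - int n" a "a + 1"]) auto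
      then show False using g by simp
    qed
  qed
  ultimately show ?thesis using zmod_less[OF n0] unfolding hasse_def by auto
qed

lemma hasse_cycle_down:
  assumes n: "3 \<le> n" and per: "periodic n s" and g: "\<not> two_runs n s" and sa: "\<not> s a"
  shows "hasse {0..<n} (cycle_poset n s) (zmod n (a + 1)) (zmod n a)"
proof -
  have "\<not> two_runs n (\<lambda>k. \<not> s k)" using two_runs_not[OF periodic_not[OF per]] g by auto
  from hasse_cycle_up[OF n periodic_not[OF per] this, of a] sa
  show ?thesis unfolding cycle_poset_not[OF per] hasse_converse by simp
qed

lemma hasse_cycleE:
  assumes n: "3 \<le> n" and per: "periodic n s" and H: "hasse {0..<n} (cycle_poset n s) i j"
  shows "\<exists>a. (i = zmod n a \<and> j = zmod n (a + 1) \<and> s a) \<or> (i = zmod n (a + 1) \<and> j = zmod n a \<and> \<not> s a)"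
proof -
  have n0: "0 < n" using n by simp
  note mem = cycle_poset_zmod[OF n0 per]
  have ij: "i < n" "j < n" "i \<noteq> j" and C: "(i, j) \<in> cycle_poset n s"
    and cov: "\<And>k. (i, k) \<in> cycle_poset n s \<Longrightarrow> (k, j) \<in> cycle_poset n s \<Longrightarrow> k < n \<Longrightarrow> k = i \<or> k = j"
    using H by (auto simp: hasse_def)
  obtain q where z: "zle s (int i) (int j + q * int n)" using C by (auto simp: cycle_poset_def)
  let ?b = "int j + q * int n"
  have ii: "zmod n (int i) = i" and bj: "zmod n ?b = j" using ij by (simp_all add: zmod_int)
  have "int i \<noteq> ?b" using ii bj ij(3) by metis
  then consider "int i < ?b" | "?b < int i" by linarith
  then show ?thesis
  proof cases
    case 1
    then have f: "zle s (int i) (int i + 1)" "zle s (int i + 1) ?b" using zle_first_up[OF z] by auto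
    have "(i, zmod n (int i + 1)) \<in> cycle_poset n s"
      using mem[of "int i" "int i + 1"] f(1) ii by (metis add.right_neutral mult_zero_left)
    moreover have "(zmod n (int i + 1), j) \<in> cycle_poset n s"
      using mem[of "int i + 1" ?b] f(2) bj by (metis add.right_neutral mult_zero_left)
    ultimately have "zmod n (int i + 1) = i \<or> zmod n (int i + 1) = j" by (rule cov) (rule zmod_less[OF n0])
    moreover have "zmod n (int i + 1) \<noteq> i" using zmod_neq[of 1 n "int i"] n ii by simp
    ultimately show ?thesis using f(1) ii zle_suc(1) by metis
  next
    case 2
    then have f: "zle s (int i) (int i - 1)" "zle s (int i - 1) ?b" using zle_first_down[OF z] by auto
    have "(i, zmod n (int i - 1)) \<in> cycle_poset n s"
      using mem[of "int i" "int i - 1"] f(1) ii by (metis add.right_neutral mult_zero_left)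
    moreover have "(zmod n (int i - 1), j) \<in> cycle_poset n s"
      using mem[of "int i - 1" ?b] f(2) bj by (metis add.right_neutral mult_zero_left)
    ultimately have "zmod n (int i - 1) = i \<or> zmod n (int i - 1) = j" by (rule cov) (rule zmod_less[OF n0])
    moreover have "zmod n (int i - 1) \<noteq> i" using zmod_neq[of 1 n "int i - 1"] n ii by simp
    ultimately have "zmod n (int i - 1) = j" by blast
    moreover have "\<not> s (int i - 1)" using f(1) zle_suc(2)[of s "int i - 1"] by simp
    ultimately show ?thesis using ii by (intro exI[of _ "int i - 1"]) simp
  qed
qed

lemma hasse_cycle_iff:
  assumes n: "3 \<le> n" and per: "periodic n s" and g: "\<not> two_runs n s"
  shows "hasse {0..<n} (cycle_poset n s) (zmod n a) (zmod n (a + 1)) \<longleftrightarrow> s a"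
    "hasse {0..<n} (cycle_poset n s) (zmod n (a + 1)) (zmod n a) \<longleftrightarrow> \<not> s a"
proof -
  have n0: "0 < n" using n by simp
  have "\<not> (hasse {0..<n} (cycle_poset n s) (zmod n a) (zmod n (a + 1))
      \<and> hasse {0..<n} (cycle_poset n s) (zmod n (a + 1)) (zmod n a))"
    using is_posetD(3)[OF cycle_poset_is_poset[OF n0 per g]] unfolding hasse_def by blast
  then show "hasse {0..<n} (cycle_poset n s) (zmod n a) (zmod n (a + 1)) \<longleftrightarrow> s a"
    "hasse {0..<n} (cycle_poset n s) (zmod n (a + 1)) (zmod n a) \<longleftrightarrow> \<not> s a"
    using hasse_cycle_up[OF n per g, of a] hasse_cycle_down[OF n per g, of a] by blast+
qed

lemma connected_consecutive:
  assumes "\<And>i. Suc i < n \<Longrightarrow> hasse_adj n R i (Suc i)"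
  shows "connected_poset n R"
  unfolding connected_poset_def connected_on_def
proof (intro ballI)
  have up: "(hasse_adj n R)\<^sup>*\<^sup>* 0 i \<and> (hasse_adj n R)\<^sup>*\<^sup>* i 0" if "i < n" for i
    using that
  proof (induction i)
    case (Suc i)
    have a: "hasse_adj n R i (Suc i)" "hasse_adj n R (Suc i) i" using assms[OF Suc.prems] by auto
    have "(hasse_adj n R)\<^sup>*\<^sup>* 0 i" "(hasse_adj n R)\<^sup>*\<^sup>* i 0" using Suc by auto
    then show ?case
      using rtranclp.rtrancl_into_rtrancl[of "hasse_adj n R", OF _ a(1)]
        converse_rtranclp_into_rtranclp[of "hasse_adj n R", OF a(2)] by blast
  qed simp
  fix i j assume "i \<in> {0..<n}" "j \<in> {0..<n}"
  then have "(hasse_adj n R)\<^sup>*\<^sup>* i 0" "(hasse_adj n R)\<^sup>*\<^sup>* 0 j" using up by auto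
  then show "(hasse_adj n R)\<^sup>*\<^sup>* i j" by (rule rtranclp_trans)
qed

lemma path_poset_connected: "connected_poset n (path_poset n s)"
  by (rule connected_consecutive) (auto simp: hasse_path_poset)

lemma cycle_poset_connected:
  assumes n: "3 \<le> n" and per: "periodic n s" and g: "\<not> two_runs n s"
  shows "connected_poset n (cycle_poset n s)"
proof (rule connected_consecutive)
  fix i assume i: "Suc i < n"
  then have "zmod n (int i) = i" "zmod n (int i + 1) = Suc i"
    using zmod_int[of i n] zmod_int[of "Suc i" n] by (simp_all add: add.commute)
  then show "hasse_adj n (cycle_poset n s) i (Suc i)" using hasse_cycle_iff[OF n per g, of "int i"] by auto
qed

subsection \<open>Classification\<close>

lemma poset_iso_refl: "poset_iso n R R"
  unfolding poset_iso_def by (intro exI[of _ id]) auto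

lemma poset_iso_sym:
  assumes "poset_iso n R S"
  shows "poset_iso n S R"
proof -
  obtain f where f: "bij_betw f {0..<n} {0..<n}" and iso: "\<And>i j. i < n \<Longrightarrow> j < n \<Longrightarrow> (i, j) \<in> R \<longleftrightarrow> (f i, f j) \<in> S"
    using assms unfolding poset_iso_def by blast
  let ?g = "the_inv_into {0..<n} f"
  have g: "bij_betw ?g {0..<n} {0..<n}" by (rule bij_betw_the_inv_into[OF f])
  have "f (?g i) = i" "?g i < n" if "i < n" for i
    using f_the_inv_into_f_bij_betw[OF f, of i] g that by (auto simp: bij_betw_def)
  then have "(i, j) \<in> S \<longleftrightarrow> (?g i, ?g j) \<in> R" if "i < n" "j < n" for i j
    using iso[of "?g i" "?g j"] that by simp
  then show ?thesis unfolding poset_iso_def using g by blast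
qed

lemma poset_iso_trans:
  assumes "poset_iso n R S" "poset_iso n S T"
  shows "poset_iso n R T"
proof -
  obtain f where f: "bij_betw f {0..<n} {0..<n}" and isof: "\<And>i j. i < n \<Longrightarrow> j < n \<Longrightarrow> (i, j) \<in> R \<longleftrightarrow> (f i, f j) \<in> S"
    using assms(1) unfolding poset_iso_def by blast
  obtain g where g: "bij_betw g {0..<n} {0..<n}" and isog: "\<And>i j. i < n \<Longrightarrow> j < n \<Longrightarrow> (i, j) \<in> S \<longleftrightarrow> (g i, g j) \<in> T"
    using assms(2) unfolding poset_iso_def by blast
  have "f i < n" if "i < n" for i using f that by (auto simp: bij_betw_def)
  then show ?thesis unfolding poset_iso_def
    using bij_betw_trans[OF f g] isof isog by (intro exI[of _ "g \<circ> f"]) auto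
qed

lemma iso_hasse:
  assumes f: "bij_betw f {0..<n} {0..<n}" and iso: "\<And>i j. i < n \<Longrightarrow> j < n \<Longrightarrow> (i, j) \<in> R \<longleftrightarrow> (f i, f j) \<in> S"
    and ij: "i < n" "j < n"
  shows "hasse {0..<n} R i j \<longleftrightarrow> hasse {0..<n} S (f i) (f j)"
proof -
  have inj: "f a = f b \<longleftrightarrow> a = b" if "a < n" "b < n" for a b
    using inj_on_eq_iff[OF bij_betw_imp_inj_on[OF f]] that by simp
  have im: "f ` {0..<n} = {0..<n}" using f by (simp add: bij_betw_def)
  have fn: "f a < n" if "a < n" for a using im that by auto
  have ex: "(\<exists>k\<in>{0..<n}. P k) \<longleftrightarrow> (\<exists>k\<in>{0..<n}. P (f k))" for P using im by (metis imageE imageI)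
  show ?thesis unfolding hasse_def ex[of "\<lambda>k. (f i, k) \<in> S \<and> (k, f j) \<in> S \<and> k \<noteq> f i \<and> k \<noteq> f j"]
    using iso inj fn ij by auto
qed

text \<open>A longest simple path is closed under adjacency, hence spans the connected graph. The
  degree bound leaves room for one further edge only, which joins the two ends; \<open>w\<close>
  records it. For \<open>n = 2\<close> the ends are adjacent anyway, whence
  \<open>3 \<le> n\<close>.\<close>

lemma path_or_cycle:
  fixes E :: "nat \<Rightarrow> nat \<Rightarrow> bool"
  assumes n: "1 \<le> n" and sym: "\<And>x y. E x y \<Longrightarrow> E y x" and irr: "\<And>x. \<not> E x x"
    and dom: "\<And>x y. E x y \<Longrightarrow> x < n \<and> y < n"
    and deg: "\<And>x a b c. E x a \<Longrightarrow> E x b \<Longrightarrow> E x c \<Longrightarrow> a = b \<or> a = c \<or> b = c"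
    and conn: "\<And>i j. i < n \<Longrightarrow> j < n \<Longrightarrow> E\<^sup>*\<^sup>* i j"
  obtains p w where "bij_betw ((!) p) {0..<n} {0..<n}"
    "\<And>i j. i < n \<Longrightarrow> j < n \<Longrightarrow> E (p ! i) (p ! j) \<longleftrightarrow> j = Suc i \<or> i = Suc j \<or>
      (w \<and> 3 \<le> n \<and> ((i = 0 \<and> Suc j = n) \<or> (j = 0 \<and> Suc i = n)))"
proof -
  let ?P = "\<lambda>p. p \<noteq> [] \<and> distinct p \<and> set p \<subseteq> {0..<n} \<and> (\<forall>i. Suc i < length p \<longrightarrow> E (p ! i) (p ! Suc i))"
  have len: "length p \<le> n" if "?P p" for p
    using that card_mono[of "{0..<n}" "set p"] distinct_card[of p] by auto
  have "?P [0]" using n by auto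
  then obtain p where p: "?P p" and max: "\<And>p'. ?P p' \<Longrightarrow> length p' \<le> length p"
    using ex_has_greatest_nat[of ?P "[0]" length "Suc n"] len by (metis less_Suc_eq_le)
  let ?m = "length p"
  have m0: "0 < ?m" and dist: "distinct p" and pE: "\<And>i. Suc i < ?m \<Longrightarrow> E (p ! i) (p ! Suc i)" using p by auto
  have neq: "p ! i = p ! j \<longleftrightarrow> i = j" if "i < ?m" "j < ?m" for i j using nth_eq_iff_index_eq[OF dist that] .
  \<comment> \<open>An outside neighbour of an end would lengthen the path, and one of an inner
    vertex would be its third neighbour.\<close>
  have closed: "y \<in> set p" if "x \<in> set p" "E x y" for x y
  proof (rule ccontr)
    assume y: "y \<notin> set p"
    obtain i where i: "i < ?m" "x = p ! i" using \<open>x \<in> set p\<close> by (auto simp: in_set_conv_nth)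
    have yn: "y < n" using dom[OF \<open>E x y\<close>] by simp
    consider "i = 0" | "Suc i = ?m" | "0 < i" "Suc i < ?m" using i(1) by linarith
    then show False
    proof cases
      case 1
      have "E ((y # p) ! k) ((y # p) ! Suc k)" if "Suc k < length (y # p)" for k
        using that pE sym[OF \<open>E x y\<close>] i(2) 1 by (cases k) auto
      then have "?P (y # p)" using p y yn by auto
      from max[OF this] show False by simp
    next
      case 2
      have "E ((p @ [y]) ! k) ((p @ [y]) ! Suc k)" if "Suc k < length (p @ [y])" for k
      proof (cases "Suc k < ?m")
        case True
        then show ?thesis using pE[of k] by (simp add: nth_append)
      next
        case False
        then have "k = i" using that 2 by simp
        then show ?thesis using \<open>E x y\<close> i 2 by (simp add: nth_append)
      qed
      then have "?P (p @ [y])" using p y yn by auto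
      from max[OF this] show False by simp
    next
      case 3
      then have "E x (p ! (i - 1))" "E x (p ! Suc i)" using pE[of "i - 1"] pE[of i] sym i(2) by auto
      from deg[OF this \<open>E x y\<close>] have "p ! (i - 1) = p ! Suc i \<or> y = p ! (i - 1) \<or> y = p ! Suc i" by auto
      moreover have "p ! (i - 1) \<noteq> p ! Suc i" using neq[of "i - 1" "Suc i"] 3 by simp
      moreover have "p ! (i - 1) \<in> set p" "p ! Suc i \<in> set p" using 3 i(1) by simp_all
      ultimately show False using y by metis
    qed
  qed
  have all: "set p = {0..<n}"
  proof
    show "{0..<n} \<subseteq> set p"
    proof
      fix j assume "j \<in> {0..<n}"
      moreover have "p ! 0 < n" using p m0 nth_mem by fastforce
      ultimately have "E\<^sup>*\<^sup>* (p ! 0) j" using conn by simp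
      then show "j \<in> set p"
        by (induction rule: rtranclp_induct) (use m0 closed in auto)
    qed
  qed (use p in auto)
  have mn: "?m = n" using distinct_card[OF dist] all by simp
  note pE = pE[unfolded mn] and neq = neq[unfolded mn]
  let ?w = "E (p ! 0) (p ! (n - 1))"
  have far: "i = 0 \<and> Suc j = n" if ij: "Suc i < j" "j < n" "E (p ! i) (p ! j)" for i j
  proof (intro conjI; rule ccontr)
    assume "i \<noteq> 0"
    then have "E (p ! i) (p ! (i - 1))" "E (p ! i) (p ! Suc i)" using pE[of "i - 1"] pE[of i] sym ij by auto
    from deg[OF this ij(3)] show False using neq[of "i - 1" "Suc i"] neq[of "i - 1" j] neq[of "Suc i" j] ij by auto
  next
    assume "Suc j \<noteq> n"
    then have jn: "Suc j < n" using ij by simp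
    then have "E (p ! j) (p ! (j - 1))" "E (p ! j) (p ! Suc j)" using pE[of "j - 1"] pE[of j] sym ij by auto
    from deg[OF this sym[OF ij(3)]] show False using neq[of "j - 1" "Suc j"] neq[of "j - 1" i] neq[of "Suc j" i] ij jn by auto
  qed
  have adj: "E (p ! i) (p ! j) \<longleftrightarrow> j = Suc i \<or> (?w \<and> 3 \<le> n \<and> i = 0 \<and> Suc j = n)" if "i < j" "j < n" for i j
  proof
    assume e: "E (p ! i) (p ! j)"
    show "j = Suc i \<or> (?w \<and> 3 \<le> n \<and> i = 0 \<and> Suc j = n)"
    proof (cases "j = Suc i")
      case False
      then have "i = 0 \<and> Suc j = n" using far[OF _ that(2) e] that(1) by simp
      moreover from this have "n - 1 = j" by linarith
      ultimately show ?thesis using e False that by auto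
    qed simp
  next
    assume "j = Suc i \<or> (?w \<and> 3 \<le> n \<and> i = 0 \<and> Suc j = n)"
    then show "E (p ! i) (p ! j)"
    proof
      assume "?w \<and> 3 \<le> n \<and> i = 0 \<and> Suc j = n"
      moreover from this have "n - 1 = j" by linarith
      ultimately show ?thesis by auto
    qed (use pE that in auto)
  qed
  show ?thesis
  proof (rule that[of p ?w])
    show "bij_betw ((!) p) {0..<n} {0..<n}"
      using bij_betw_nth[OF dist, of "{..<n}" "{0..<n}"] mn all by (simp add: atLeast0LessThan)
    fix i j assume ij: "i < n" "j < n"
    consider "i = j" | "i < j" | "j < i" by linarith
    then show "E (p ! i) (p ! j) \<longleftrightarrow> j = Suc i \<or> i = Suc j \<or>
      (?w \<and> 3 \<le> n \<and> ((i = 0 \<and> Suc j = n) \<or> (j = 0 \<and> Suc i = n)))"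
    proof cases
      case 1
      then show ?thesis using irr ij by auto
    next
      case 2
      then show ?thesis using adj[of i j] ij by auto
    next
      case 3
      have "E (p ! i) (p ! j) \<longleftrightarrow> E (p ! j) (p ! i)" using sym by blast
      then show ?thesis using adj[of j i] 3 ij by auto
    qed
  qed
qed

text \<open>Two elements above (or below) \<open>x\<close> in its Hasse diagram carry different labels shared with
  \<open>x\<close>, whereas an element above and an element below share the same one; hence at most two neighbours.\<close>

lemma arrow_rep_degree:
  assumes po: "is_poset n R" and ar: "arrow_rep n R t h"
    and adj: "hasse_adj n R x a" "hasse_adj n R x b" "hasse_adj n R x c"
  shows "a = b \<or> a = c \<or> b = c"
proof (rule ccontr)
  assume ne: "\<not> (a = b \<or> a = c \<or> b = c)"
  have nb: "y < n" "x < n" "y \<noteq> x" "(x, y) \<in> R \<or> (y, x) \<in> R" if "hasse_adj n R x y" for y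
    using that by (auto simp: hasse_def)
  have cmp: "(i, j) \<in> R \<or> (j, i) \<in> R \<longleftrightarrow> t i = t j \<or> h i = h j" and nboth: "\<not> (t i = t j \<and> h i = h j)"
    if "i < n" "j < n" "i \<noteq> j" for i j
    using ar that unfolding arrow_rep_def by auto
  have share: "h y = h x \<longleftrightarrow> t y \<noteq> t x" if "hasse_adj n R x y" for y
    using cmp[of x y] nboth[of x y] nb[OF that] by metis
  have cov: "k = u \<or> k = v"
    if "hasse {0..<n} R u v" "(u, k) \<in> R" "(k, v) \<in> R" for u v k
    using that is_posetD(2)[OF po] unfolding hasse_def by auto
  have pair: "((x, y) \<in> R \<longleftrightarrow> (x, z) \<in> R) \<longleftrightarrow> (t y = t x \<longleftrightarrow> t z \<noteq> t x)"
    if y: "hasse_adj n R x y" and z: "hasse_adj n R x z" and yz: "y \<noteq> z" for y z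
  proof -
    have dir: "(x, y) \<in> R \<longleftrightarrow> hasse {0..<n} R x y" "(y, x) \<in> R \<longleftrightarrow> \<not> hasse {0..<n} R x y"
      "(x, z) \<in> R \<longleftrightarrow> hasse {0..<n} R x z" "(z, x) \<in> R \<longleftrightarrow> \<not> hasse {0..<n} R x z"
      using y z is_posetD(3)[OF po, of x y] is_posetD(3)[OF po, of x z] by (auto simp: hasse_def)
    show ?thesis
    proof (cases "(x, y) \<in> R \<longleftrightarrow> (x, z) \<in> R")
      case True
      have ne': "y \<noteq> x" "z \<noteq> x" using nb(3)[OF y] nb(3)[OF z] by auto
      have "(y, z) \<notin> R \<and> (z, y) \<notin> R"
      proof (cases "hasse {0..<n} R x y")
        case up: True
        then have up': "hasse {0..<n} R x z" and R: "(x, y) \<in> R" "(x, z) \<in> R" using True dir by blast+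
        show ?thesis using cov[OF up R(2)] cov[OF up' R(1)] yz ne' by blast
      next
        case False
        then have dn: "hasse {0..<n} R y x" "hasse {0..<n} R z x" and R: "(y, x) \<in> R" "(z, x) \<in> R"
          using True dir y z by blast+
        show ?thesis using cov[OF dn(1) _ R(2)] cov[OF dn(2) _ R(1)] yz ne' by blast
      qed
      then have "t y \<noteq> t z" "h y \<noteq> h z" using cmp[of y z] nb[OF y] nb[OF z] yz by auto
      then show ?thesis using True share[OF y] share[OF z] by metis
    next
      case False
      have "(y, z) \<in> R \<or> (z, y) \<in> R"
        using False dir is_posetD(4)[OF po] by blast
      then have "t y = t z \<or> h y = h z" "\<not> (t y = t z \<and> h y = h z)" using cmp[of y z] nboth[of y z] nb[OF y] nb[OF z] yz by auto
      then show ?thesis using False share[OF y] share[OF z] by metis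
    qed
  qed
  \<comment> \<open>\<open>pair\<close> says that the truth value of
    \<open>(x, y) \<in> R \<longleftrightarrow> t y = t x\<close> differs for any two neighbours
    \<open>y\<close>; three truth values cannot be pairwise different.\<close>
  show False
    using pair[OF adj(1,2)] pair[OF adj(1,3)] pair[OF adj(2,3)] ne by metis
qed

text \<open>The ends of an interval share exactly one label if they differ. An element between them
  must carry it too, since otherwise both ends would agree with it in the other label. So intervals
  are chains.\<close>

lemma arrow_rep_interval:
  assumes po: "is_poset n R" and ar: "arrow_rep n R t h"
    and R: "(x, u) \<in> R" "(u, y) \<in> R" "(x, v) \<in> R" "(v, y) \<in> R"
  shows "(u, v) \<in> R \<or> (v, u) \<in> R"
proof -
  have b: "x < n" "u < n" "v < n" "y < n" using R is_posetD(2)[OF po] by auto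
  have cmp: "(i, j) \<in> R \<or> (j, i) \<in> R \<longleftrightarrow> t i = t j \<or> h i = h j" if "i < n" "j < n" for i j
    using ar that is_posetD(1)[OF po] unfolding arrow_rep_def by (cases "i = j") auto
  have nboth: "i = j" if "i < n" "j < n" "t i = t j" "h i = h j" for i j
    using ar that unfolding arrow_rep_def by blast
  show ?thesis
  proof (cases "x = y")
    case True
    then have "u = x" "v = x" using R is_posetD(3)[OF po] by blast+
    then show ?thesis using is_posetD(1)[OF po b(1)] by simp
  next
    case False
    have "(x, y) \<in> R" using R is_posetD(4)[OF po] by blast
    then have xy: "t x = t y \<or> h x = h y" using cmp b by blast
    have mid: "(t x = t y \<longrightarrow> t k = t x) \<and> (h x = h y \<longrightarrow> h k = h x)" if "k < n" "(x, k) \<in> R" "(k, y) \<in> R" for k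
      using cmp[OF b(1) that(1)] cmp[OF that(1) b(4)] that nboth[OF b(1,4)] False by metis
    show ?thesis using mid[OF b(2) R(1,2)] mid[OF b(3) R(3,4)] xy cmp[OF b(2,3)] by metis
  qed
qed

section \<open>Reading the word of a poset off its Hasse diagram\<close>

lemma chain_up:
  assumes po: "is_poset n R" and n: "0 < n" and ab: "a \<le> b"
    and st: "\<And>k. a \<le> k \<Longrightarrow> k < b \<Longrightarrow> (zmod n k, zmod n (k + 1)) \<in> R"
  shows "(zmod n a, zmod n b) \<in> R"
  using ab st
proof (induction b rule: int_ge_induct)
  case base
  then show ?case using is_posetD(1)[OF po zmod_less[OF n]] by simp
next
  case (step b)
  then show ?case using is_posetD(4)[OF po, of "zmod n a" "zmod n b"] by force
qed

lemma chain_down: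
  assumes po: "is_poset n R" and n: "0 < n" and ab: "a \<le> b"
    and st: "\<And>k. a \<le> k \<Longrightarrow> k < b \<Longrightarrow> (zmod n (k + 1), zmod n k) \<in> R"
  shows "(zmod n b, zmod n a) \<in> R"
  using ab st
proof (induction b rule: int_ge_induct)
  case base
  then show ?case using is_posetD(1)[OF po zmod_less[OF n]] by simp
next
  case (step b)
  then show ?case using is_posetD(4)[OF po, of "zmod n (b + 1)" "zmod n b"] by force
qed


locale enumerated_poset =
  fixes n :: nat and R :: "(nat \<times> nat) set" and t h :: "nat \<Rightarrow> nat"
  assumes n: "1 \<le> n" and po: "is_poset n R" and ar: "arrow_rep n R t h"
begin

lemma n0: "0 < n" using n by simp

definition s :: "int \<Rightarrow> bool" where
  "s k \<longleftrightarrow> hasse {0..<n} R (zmod n k) (zmod n (k + 1))"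

abbreviation adjacent :: "int \<Rightarrow> bool" where
  "adjacent k \<equiv> hasse_adj n R (zmod n k) (zmod n (k + 1))"

lemma periodic_s: "periodic n s"
proof -
  have "zmod n (k + int n + 1) = zmod n (k + 1)" for k
    using zmod_add(2)[of n "k + 1"] by (simp add: algebra_simps)
  then show ?thesis by (simp add: periodic_def s_def)
qed

lemma step_up: "s k \<Longrightarrow> (zmod n k, zmod n (k + 1)) \<in> R"
  by (simp add: s_def hasse_def)

lemma step_down: "\<not> s k \<Longrightarrow> adjacent k \<Longrightarrow> hasse {0..<n} R (zmod n (k + 1)) (zmod n k)"
  by (auto simp: s_def)

lemma hasse_not_s: "hasse {0..<n} R (zmod n (k + 1)) (zmod n k) \<Longrightarrow> \<not> s k"
  using is_posetD(3)[OF po] by (auto simp: s_def hasse_def)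

text \<open>A false letter means a descending edge only where the two consecutive elements are
  adjacent at all, hence the assumption on every letter between \<open>a\<close> and
  \<open>b\<close>.\<close>

lemma zle_imp_R:
  assumes z: "zle s a b" and adj: "\<And>k. min a b \<le> k \<Longrightarrow> k < max a b \<Longrightarrow> adjacent k"
  shows "(zmod n a, zmod n b) \<in> R"
proof (cases "a \<le> b")
  case True
  show ?thesis
  proof (rule chain_up[OF po n0 True])
    fix k assume "a \<le> k" "k < b"
    then have "s k" by (intro zle_up[OF z]) auto
    then show "(zmod n k, zmod n (k + 1)) \<in> R" by (rule step_up)
  qed
next
  case False
  then have ba: "b \<le> a" by simp
  show ?thesis
  proof (rule chain_down[OF po n0 ba])
    fix k assume k: "b \<le> k" "k < a"
    then have "\<not> s k" by (intro zle_down[OF z]) auto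
    moreover have "adjacent k" using adj k by auto
    ultimately show "(zmod n (k + 1), zmod n k) \<in> R" using step_down by (auto simp: hasse_def)
  qed
qed

lemma path_case:
  assumes adj: "\<And>i j. i < n \<Longrightarrow> j < n \<Longrightarrow> hasse_adj n R i j \<longleftrightarrow> j = Suc i \<or> i = Suc j"
  shows "R = path_poset n s"
proof -
  have suc: "zmod n (int i + 1) = Suc i" if "Suc i < n" for i
    using zmod_int[OF that] by (simp add: add.commute)
  have "(i, j) \<in> R \<longleftrightarrow> (i, j) \<in> path_poset n s" for i j
  proof
    assume R: "(i, j) \<in> R"
    then have ij: "i < n" "j < n" using is_posetD(2)[OF po] by auto
    have "(hasse {0..<n} R)\<^sup>*\<^sup>* i j" by (rule hasse_path[OF po R])
    then have "zle s (int i) (int j)"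
    proof (induction rule: rtranclp_induct)
      case base
      show ?case by (rule zle_refl)
    next
      case (step y z)
      have yz: "y < n" "z < n" using step.hyps(2) by (auto simp: hasse_def)
      then have "z = Suc y \<or> y = Suc z" using adj step.hyps(2) by blast
      then have "zle s (int y) (int z)"
      proof
        assume e: "z = Suc y"
        then have "s (int y)" using step.hyps(2) suc[of y] zmod_int[of y n] yz by (simp add: s_def)
        then show ?thesis using zle_suc(1)[of s "int y"] e by (simp add: add.commute)
      next
        assume e: "y = Suc z"
        then have "\<not> s (int z)" using step.hyps(2) suc[of z] zmod_int[of z n] yz by (intro hasse_not_s) simp
        then show ?thesis using zle_suc(2)[of s "int z"] e by (simp add: add.commute)
      qed
      with step.IH show ?case by (rule zle_trans)
    qed
    then show "(i, j) \<in> path_poset n s" using ij by (simp add: path_poset_def)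
  next
    assume P: "(i, j) \<in> path_poset n s"
    then have ij: "i < n" "j < n" and z: "zle s (int i) (int j)" by (auto simp: path_poset_def)
    have "(zmod n (int i), zmod n (int j)) \<in> R"
    proof (rule zle_imp_R[OF z])
      fix k assume k: "min (int i) (int j) \<le> k" "k < max (int i) (int j)"
      then obtain a where a: "k = int a" "Suc a < n"
        using ij nonneg_int_cases[of k] by (cases "i \<le> j") auto
      then show "adjacent k" using adj[of a "Suc a"] suc[of a] zmod_int[of a n] by simp
    qed
    then show "(i, j) \<in> R" using ij by (simp add: zmod_int)
  qed
  then show ?thesis by auto
qed

lemma cycle_case:
  assumes n3: "3 \<le> n" and adj: "\<And>k. adjacent k"
    and nb: "\<And>i j. hasse_adj n R i j \<Longrightarrow> \<exists>k. (i = zmod n k \<and> j = zmod n (k + 1)) \<or> (i = zmod n (k + 1) \<and> j = zmod n k)"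
  shows "R = cycle_poset n s" "\<not> two_runs n s"
proof -
  have same: "s a = s b" "zmod n (a + c) = zmod n (b + c)" if e: "zmod n a = zmod n b" for a b c
  proof -
    obtain q where "b = a + q * int n" using e zmod_eq_iff[OF n0] by blast
    then show "s a = s b" "zmod n (a + c) = zmod n (b + c)"
      using periodic_shift[OF periodic_s, of a q] zmod_add(1)[of n "a + c" q] by (simp_all add: algebra_simps)
  qed
  have "(i, j) \<in> R \<longleftrightarrow> (i, j) \<in> cycle_poset n s" for i j
  proof
    assume R: "(i, j) \<in> R"
    then have ij: "i < n" "j < n" using is_posetD(2)[OF po] by auto
    have "(hasse {0..<n} R)\<^sup>*\<^sup>* i j" by (rule hasse_path[OF po R])
    then have "\<exists>b. zmod n b = j \<and> zle s (int i) b"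
    proof (induction rule: rtranclp_induct)
      case base
      show ?case using zmod_int[OF ij(1)] zle_refl by blast
    next
      case (step y z)
      obtain b where b: "zmod n b = y" "zle s (int i) b" using step.IH by blast
      obtain k where "(y = zmod n k \<and> z = zmod n (k + 1)) \<or> (y = zmod n (k + 1) \<and> z = zmod n k)"
        using nb step.hyps(2) by blast
      then show ?case
      proof
        assume k: "y = zmod n k \<and> z = zmod n (k + 1)"
        then have "s k" using step.hyps(2) by (simp add: s_def)
        then have "s b" using same(1)[of b k] b k by simp
        then have "zle s (int i) (b + 1)" using zle_trans[OF b(2)] zle_suc(1) by blast
        moreover have "zmod n (b + 1) = z" using same(2)[of b k 1] b k by simp
        ultimately show ?thesis by blast
      next
        assume k: "y = zmod n (k + 1) \<and> z = zmod n k"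
        then have "\<not> s k" using step.hyps(2) hasse_not_s by simp
        have "zmod n (b - 1) = zmod n k" using same(2)[of b "k + 1" "-1"] b k by simp
        then have "\<not> s (b - 1)" using same(1)[of "b - 1" k] \<open>\<not> s k\<close> by simp
        then have "zle s b (b - 1)" using zle_suc(2)[of s "b - 1"] by simp
        then have "zle s (int i) (b - 1)" using zle_trans[OF b(2)] by blast
        then show ?thesis using \<open>zmod n (b - 1) = zmod n k\<close> k by auto
      qed
    qed
    then obtain b where b: "zmod n b = j" "zle s (int i) b" by blast
    have "(zmod n (int i), zmod n b) \<in> cycle_poset n s"
      unfolding cycle_poset_zmod[OF n0 periodic_s] using b(2) by (intro exI[of _ 0]) simp
    then show "(i, j) \<in> cycle_poset n s" using b(1) zmod_int[OF ij(1)] by simp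
  next
    assume C: "(i, j) \<in> cycle_poset n s"
    then obtain q where ij: "i < n" "j < n" and z: "zle s (int i) (int j + q * int n)" by (auto simp: cycle_poset_def)
    have "(zmod n (int i), zmod n (int j + q * int n)) \<in> R" by (rule zle_imp_R[OF z adj])
    then show "(i, j) \<in> R" using ij by (simp add: zmod_int)
  qed
  then show "R = cycle_poset n s" by auto
  show "\<not> two_runs n s"
  proof
    assume "two_runs n s"
    then obtain a l where l: "0 \<le> l" "l \<le> int n" and t: "\<And>k. a \<le> k \<Longrightarrow> k < a + l \<Longrightarrow> s k"
      and f: "\<And>k. a + l \<le> k \<Longrightarrow> k < a + int n \<Longrightarrow> \<not> s k"
      unfolding two_runs_def by blast
    have up: "(zmod n b, zmod n c) \<in> R" if "a \<le> b" "b \<le> c" "c \<le> a + l" for b c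
      by (rule chain_up[OF po n0 that(2)], rule step_up, rule t) (use that in auto)
    have down: "(zmod n c, zmod n b) \<in> R" if "a + l \<le> b" "b \<le> c" "c \<le> a + int n" for b c
    proof (rule chain_down[OF po n0 that(2)])
      fix k assume "b \<le> k" "k < c"
      then have "\<not> s k" using that by (intro f) auto
      then show "(zmod n (k + 1), zmod n k) \<in> R" using step_down adj by (auto simp: hasse_def)
    qed
    have a1: "zmod n (a + 1) \<noteq> zmod n a" using zmod_neq[of 1 n a] n3 by simp
    have wrap: "zmod n (a + int n) = zmod n a" by simp
    consider "l = int n" | "l = 0" | "0 < l" "l < int n" using l by linarith
    then show False
    proof cases
      case 1
      then show False using up[of a "a + 1"] up[of "a + 1" "a + int n"] wrap a1 is_posetD(3)[OF po] n3 by auto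
    next
      case 2
      then show False using down[of a "a + 1"] down[of "a + 1" "a + int n"] wrap a1 is_posetD(3)[OF po] n3 by auto
    next
      case 3
      \<comment> \<open>The two upper neighbours of the minimum \<open>a\<close>. Both lie below the
        maximum \<open>a + l\<close>, so they are comparable, and then one of them does not cover
        \<open>a\<close>.\<close>
      let ?x = "zmod n (a + 1)" and ?y = "zmod n (a + int n - 1)"
      have xl: "(zmod n a, ?x) \<in> R" "(?x, zmod n (a + l)) \<in> R" using up[of a "a + 1"] up[of "a + 1" "a + l"] 3 by auto
      have yl: "(zmod n a, ?y) \<in> R" "(?y, zmod n (a + l)) \<in> R"
        using down[of "a + int n - 1" "a + int n"] down[of "a + l" "a + int n - 1"] wrap 3 by auto
      have "s a" using t[of a] 3 by simp
      then have hx: "hasse {0..<n} R (zmod n a) ?x" by (simp add: s_def)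
      have "\<not> s (a + int n - 1)" using f[of "a + int n - 1"] 3 by simp
      from step_down[OF this adj] have hy: "hasse {0..<n} R (zmod n a) ?y" using wrap by simp
      have "?x \<noteq> ?y" using zmod_neq[of "int n - 2" n "a + 1"] n3 by (simp add: algebra_simps)
      moreover have "?x \<noteq> zmod n a" "?y \<noteq> zmod n a" using hx hy by (auto simp: hasse_def)
      moreover have "(?x, ?y) \<in> R \<or> (?y, ?x) \<in> R" by (rule arrow_rep_interval[OF po ar xl yl])
      ultimately show False using hx hy xl yl zmod_less[OF n0] unfolding hasse_def by auto
    qed
  qed
qed

end

theorem arrow_rep_classification:
  assumes n: "1 \<le> n" and po: "is_poset n R" and cp: "connected_poset n R" and ar: "arrow_rep n R t h"
  shows "(\<exists>s. poset_iso n R (path_poset n s)) \<or>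
    (3 \<le> n \<and> (\<exists>s. periodic n s \<and> \<not> two_runs n s \<and> poset_iso n R (cycle_poset n s)))"
proof -
  have n0: "0 < n" using n by simp
  obtain p w where p: "bij_betw ((!) p) {0..<n} {0..<n}"
    and padj: "\<And>i j. i < n \<Longrightarrow> j < n \<Longrightarrow> hasse_adj n R (p ! i) (p ! j) \<longleftrightarrow> j = Suc i \<or> i = Suc j \<or>
      (w \<and> 3 \<le> n \<and> ((i = 0 \<and> Suc j = n) \<or> (j = 0 \<and> Suc i = n)))"
  proof (rule path_or_cycle[OF n, of "hasse_adj n R"])
    show "\<And>x a b c. hasse_adj n R x a \<Longrightarrow> hasse_adj n R x b \<Longrightarrow> hasse_adj n R x c \<Longrightarrow> a = b \<or> a = c \<or> b = c"
      by (rule arrow_rep_degree[OF po ar])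
    show "\<And>i j. i < n \<Longrightarrow> j < n \<Longrightarrow> (hasse_adj n R)\<^sup>*\<^sup>* i j"
      using cp unfolding connected_poset_def connected_on_def by auto
  qed (auto simp: hasse_def)
  define R' where "R' = {(i, j). i < n \<and> j < n \<and> (p ! i, p ! j) \<in> R}"
  have pn: "p ! i < n" if "i < n" for i using p that by (auto simp: bij_betw_def)
  have inj: "i = j" if "i < n" "j < n" "p ! i = p ! j" for i j
    using bij_betw_imp_inj_on[OF p] that by (auto simp: inj_on_def)
  have mem: "(i, j) \<in> R' \<longleftrightarrow> (p ! i, p ! j) \<in> R" if "i < n" "j < n" for i j using that by (simp add: R'_def)
  have iso: "poset_iso n R' R" unfolding poset_iso_def using p mem by blast
  have adj: "hasse_adj n R' i j \<longleftrightarrow> j = Suc i \<or> i = Suc j \<or>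
      (w \<and> 3 \<le> n \<and> ((i = 0 \<and> Suc j = n) \<or> (j = 0 \<and> Suc i = n)))" if "i < n" "j < n" for i j
    using padj[OF that] iso_hasse[OF p mem that] iso_hasse[OF p mem that(2,1)] by simp
  have po': "is_poset n R'" unfolding is_poset_def partial_order_on_def preorder_on_def
  proof (intro conjI)
    show "R' \<subseteq> {0..<n} \<times> {0..<n}" by (auto simp: R'_def)
    show "refl_on {0..<n} R'" using is_posetD(1)[OF po] pn by (auto simp: refl_on_def R'_def)
    show "trans R'" unfolding trans_def R'_def using is_posetD(4)[OF po] by blast
    show "antisym R'" unfolding antisym_def R'_def using is_posetD(3)[OF po] inj by blast
  qed
  have ar': "arrow_rep n R' (\<lambda>i. t (p ! i)) (\<lambda>i. h (p ! i))"
    using ar pn inj mem unfolding arrow_rep_def by (metis (no_types, lifting))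
  interpret enumerated_poset n R' "\<lambda>i. t (p ! i)" "\<lambda>i. h (p ! i)"
    using n po' ar' by unfold_locales
  show ?thesis
  proof (cases "w \<and> 3 \<le> n")
    case False
    then have e: "R' = path_poset n s" using adj by (intro path_case) blast
    show ?thesis
      using back_subst[of "poset_iso n R", OF poset_iso_sym[OF iso] e] by (intro disjI1 exI)
  next
    case True
    have conv: "\<exists>k. (i = zmod n k \<and> j = zmod n (k + 1)) \<or> (i = zmod n (k + 1) \<and> j = zmod n k)"
      if ij: "hasse_adj n R' i j" for i j
    proof -
      have b: "i < n" "j < n" using ij by (auto simp: hasse_def)
      have z: "zmod n (int i) = i" "zmod n (int j) = j" using b by (simp_all add: zmod_int)
      have last: "zmod n (int x + 1) = 0" if "Suc x = n" for x
      proof -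
        have "int x + 1 = 0 + int n" using that by linarith
        then have "zmod n (int x + 1) = zmod n (0 + int n)" by (rule arg_cong)
        also have "\<dots> = zmod n 0" by (rule zmod_add(2))
        finally show ?thesis by (simp add: zmod_def)
      qed
      consider "j = Suc i" | "i = Suc j" | "i = 0" "Suc j = n" | "j = 0" "Suc i = n" using adj[OF b] ij by blast
      then show ?thesis
      proof cases
        case 1
        then show ?thesis using z by (intro exI[of _ "int i"]) (auto simp: add.commute)
      next
        case 2
        then show ?thesis using z by (intro exI[of _ "int j"]) (auto simp: add.commute)
      next
        case 3
        then show ?thesis using z last[of j] by (intro exI[of _ "int j"]) auto
      next
        case 4
        then show ?thesis using z last[of i] by (intro exI[of _ "int i"]) auto
      qed
    qed
    have "hasse_adj n R' (zmod n k) (zmod n (k + 1))" for k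
    proof -
      let ?i = "zmod n k"
      have b: "?i < n" "zmod n (k + 1) < n" using zmod_less[OF n0] by auto
      have "zmod n (k + 1) = Suc ?i \<or> (zmod n (k + 1) = 0 \<and> Suc ?i = n)"
      proof -
        have e: "zmod n (k + 1) = zmod n (int ?i + 1)" by (rule zmod_shift[OF n0, symmetric])
        show ?thesis
        proof (cases "Suc ?i < n")
          case True
          then show ?thesis using zmod_int[OF True] e by (simp add: add.commute)
        next
          case False
          then have "int ?i + 1 = 0 + int n" using b by linarith
          then have "zmod n (int ?i + 1) = zmod n (0 + int n)" by (rule arg_cong)
          also have "\<dots> = zmod n 0" by (rule zmod_add(2))
          finally show ?thesis using e False b by (simp add: zmod_def)
        qed
      qed
      then show ?thesis unfolding adj[OF b] using True by auto
    qed
    from cycle_case[OF conjunct2[OF True] this conv]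
    have e: "R' = cycle_poset n s" "\<not> two_runs n s" by simp_all
    have "poset_iso n R (cycle_poset n s)"
      by (rule back_subst[of "poset_iso n R", OF poset_iso_sym[OF iso] e(1)])
    with e(2) periodic_s conjunct2[OF True] show ?thesis by (intro disjI2 conjI exI[of _ s])
  qed
qed


subsection \<open>Isomorphisms\<close>

lemma zle_translate:
  assumes "\<And>k. min a b \<le> k \<Longrightarrow> k < max a b \<Longrightarrow> s k = s' (k + c)"
  shows "zle s a b \<longleftrightarrow> zle s' (a + c) (b + c)"
proof -
  have "run s a b \<longleftrightarrow> run s' (a + c) (b + c)" "run (\<lambda>k. \<not> s k) a b \<longleftrightarrow> run (\<lambda>k. \<not> s' k) (a + c) (b + c)"
    if "a \<le> b \<or> b \<le> a"
  proof -
    have e: "k - c + c = k" for k :: int by simp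
    have "(\<forall>k. (a \<le> k \<and> k < b) \<or> (b \<le> k \<and> k < a) \<longrightarrow> P (s k)) \<longleftrightarrow>
      (\<forall>k. (a + c \<le> k \<and> k < b + c) \<or> (b + c \<le> k \<and> k < a + c) \<longrightarrow> P (s' k))" for P :: "bool \<Rightarrow> bool"
    proof (intro iffI allI impI)
      fix k assume l: "\<forall>k. (a \<le> k \<and> k < b) \<or> (b \<le> k \<and> k < a) \<longrightarrow> P (s k)"
        and k: "(a + c \<le> k \<and> k < b + c) \<or> (b + c \<le> k \<and> k < a + c)"
      then have "P (s (k - c))" by auto
      moreover have "s (k - c) = s' (k - c + c)" using k by (intro assms) auto
      ultimately show "P (s' k)" by simp
    next
      fix k assume l: "\<forall>k. (a + c \<le> k \<and> k < b + c) \<or> (b + c \<le> k \<and> k < a + c) \<longrightarrow> P (s' k)"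
        and k: "(a \<le> k \<and> k < b) \<or> (b \<le> k \<and> k < a)"
      then have "P (s' (k + c))" by auto
      moreover have "s k = s' (k + c)" using k by (intro assms) auto
      ultimately show "P (s k)" by simp
    qed
    from this[of "\<lambda>x. x"] this[of Not]
    show "run s a b \<longleftrightarrow> run s' (a + c) (b + c)" "run (\<lambda>k. \<not> s k) a b \<longleftrightarrow> run (\<lambda>k. \<not> s' k) (a + c) (b + c)"
      by (simp_all add: run_def)
  qed
  then show ?thesis unfolding zle_def by (metis add_le_cancel_right linorder_linear)
qed

text \<open>Reflecting vertices by \<open>k \<mapsto> c - k\<close> sends the edge from
  \<open>k\<close> to \<open>k + 1\<close> to the edge that starts at
  \<open>c - 1 - k\<close>.\<close>

lemma run_mirror: "run (\<lambda>k. s (c - 1 - k)) a b \<longleftrightarrow> run s (c - a) (c - b)"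
proof
  assume r: "run (\<lambda>k. s (c - 1 - k)) a b"
  show "run s (c - a) (c - b)" unfolding run_def
  proof (intro allI impI)
    fix k assume "(c - a \<le> k \<and> k < c - b) \<or> (c - b \<le> k \<and> k < c - a)"
    then have "s (c - 1 - (c - 1 - k))" using r unfolding run_def by (auto dest!: spec[of _ "c - 1 - k"])
    then show "s k" by simp
  qed
next
  assume r: "run s (c - a) (c - b)"
  show "run (\<lambda>k. s (c - 1 - k)) a b" unfolding run_def
    using r unfolding run_def by auto
qed

lemma zle_mirror: "zle (\<lambda>k. \<not> s (c - 1 - k)) a b \<longleftrightarrow> zle s (c - a) (c - b)"
  unfolding zle_def using run_mirror[of s c a b] run_mirror[of "\<lambda>k. \<not> s k" c a b] by auto

lemma zle_reflect:
  assumes "\<And>k. min a b \<le> k \<Longrightarrow> k < max a b \<Longrightarrow> s k = (\<not> s' (c - 1 - k))"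
  shows "zle s a b \<longleftrightarrow> zle s' (c - a) (c - b)"
  using zle_translate[of a b s "\<lambda>k. \<not> s' (c - 1 - k)" 0] assms zle_mirror[of s' c a b] by simp

text \<open>A walk by steps of 1 or -1 that never returns to the vertex before last keeps its
  direction. Modulus \<open>N = 0\<close> means equality of integers, so paths and cycles are
  treated at once.\<close>

lemma walk_monotone:
  fixes g :: "nat \<Rightarrow> int" and N :: int
  assumes st: "\<And>i. Suc i < n \<Longrightarrow> g (Suc i) mod N = (g i + 1) mod N \<or> g (Suc i) mod N = (g i - 1) mod N"
    and nb: "\<And>i. Suc (Suc i) < n \<Longrightarrow> g (Suc (Suc i)) mod N \<noteq> g i mod N"
  shows "\<exists>e. (e = 1 \<or> e = -1) \<and> (\<forall>i<n. g i mod N = (g 0 + e * int i) mod N)"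
proof -
  obtain e :: int where e: "e = 1 \<or> e = -1" and g1: "1 < n \<Longrightarrow> g 1 mod N = (g 0 + e) mod N"
    using st[of 0] by (metis One_nat_def diff_minus_eq_add minus_diff_eq uminus_add_conv_diff add.commute diff_conv_add_uminus)
  have "g i mod N = (g 0 + e * int i) mod N" if "i < n" for i
    using that
  proof (induction i rule: less_induct)
    case (less i)
    consider "i = 0" | "i = 1" | j where "i = Suc (Suc j)" by (metis One_nat_def not0_implies_Suc)
    then show ?case
    proof cases
      case 2
      then show ?thesis using g1 less.prems by simp
    next
      case 3
      have IH: "g (Suc j) mod N = (g 0 + e * int (Suc j)) mod N" "g j mod N = (g 0 + e * int j) mod N"
        using less 3 by auto
      have shift: "(g (Suc j) + d) mod N = (g 0 + e * int (Suc j) + d) mod N" for d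
        using IH(1) by (rule mod_add_cong) simp
      have neg: "g i mod N \<noteq> (g (Suc j) - e) mod N"
      proof
        assume "g i mod N = (g (Suc j) - e) mod N"
        also have "\<dots> = (g 0 + e * int j) mod N" using shift[of "- e"] by (simp add: algebra_simps)
        finally show False using nb[of j] IH(2) 3 less.prems by simp
      qed
      have "g i mod N = (g (Suc j) + e) mod N" using st[of "Suc j"] neg e 3 less.prems by auto
      then show ?thesis using shift[of e] 3 by (simp add: algebra_simps)
    qed simp
  qed
  then show ?thesis using e by blast
qed

lemma path_poset_cong:
  assumes "\<And>k. 0 \<le> k \<Longrightarrow> k < int n - 1 \<Longrightarrow> s k = s' k"
  shows "path_poset n s = path_poset n s'"
proof -
  have "zle s (int i) (int j) \<longleftrightarrow> zle s' (int i) (int j)" if "i < n" "j < n" for i j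
  proof -
    have E: "s k = s' (k + 0)" if "min (int i) (int j) \<le> k" "k < max (int i) (int j)" for k
      using that \<open>i < n\<close> \<open>j < n\<close> by (simp, intro assms) auto
    have "zle s (int i) (int j) \<longleftrightarrow> zle s' (int i + 0) (int j + 0)" by (rule zle_translate, rule E)
    then show ?thesis by simp
  qed
  then show ?thesis unfolding path_poset_def by auto
qed

text \<open>An isomorphism preserves covers, so it carries the walk along one path to a walk along
  the other; that walk never turns and fits into \<open>n\<close> places only as the identity or the
  reversal.\<close>

lemma path_iso_iff:
  assumes n: "1 \<le> n"
  shows "poset_iso n (path_poset n s) (path_poset n s') \<longleftrightarrow>
    (\<forall>k. 0 \<le> k \<and> k < int n - 1 \<longrightarrow> s k = s' k) \<or>
    (\<forall>k. 0 \<le> k \<and> k < int n - 1 \<longrightarrow> s k = (\<not> s' (int n - 2 - k)))" (is "?I \<longleftrightarrow> ?A \<or> ?B")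
proof
  assume "?A \<or> ?B"
  then show ?I
  proof
    assume ?A
    then have "path_poset n s = path_poset n s'" by (intro path_poset_cong) auto
    then show ?I using poset_iso_refl by simp
  next
    assume B: ?B
    let ?f = "\<lambda>i. n - 1 - i"
    have "bij_betw ?f {0..<n} {0..<n}"
      by (rule bij_betwI[of _ _ _ ?f]) (use n in auto)
    moreover have "(i, j) \<in> path_poset n s \<longleftrightarrow> (?f i, ?f j) \<in> path_poset n s'" if ij: "i < n" "j < n" for i j
    proof -
      have E: "s k = (\<not> s' (int n - 1 - 1 - k))" if "min (int i) (int j) \<le> k" "k < max (int i) (int j)" for k
      proof -
        have "0 \<le> k \<and> k < int n - 1" using that ij by auto
        then show ?thesis using B by (simp add: algebra_simps)
      qed
      have "zle s (int i) (int j) \<longleftrightarrow> zle s' (int n - 1 - int i) (int n - 1 - int j)"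
        by (rule zle_reflect, rule E)
      moreover have "int (?f i) = int n - 1 - int i" "int (?f j) = int n - 1 - int j" using ij by auto
      ultimately show ?thesis using ij by (simp add: path_poset_def algebra_simps)
    qed
    ultimately show ?I unfolding poset_iso_def by blast
  qed
next
  assume ?I
  then obtain f where f: "bij_betw f {0..<n} {0..<n}"
    and iso: "\<And>i j. i < n \<Longrightarrow> j < n \<Longrightarrow> (i, j) \<in> path_poset n s \<longleftrightarrow> (f i, f j) \<in> path_poset n s'"
    unfolding poset_iso_def by blast
  have h: "hasse {0..<n} (path_poset n s) i j \<longleftrightarrow> hasse {0..<n} (path_poset n s') (f i) (f j)"
    if "i < n" "j < n" for i j by (rule iso_hasse[OF f iso that])
  have fn: "f i < n" if "i < n" for i using f that by (auto simp: bij_betw_def)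
  \<comment> \<open>The residues modulo 0 are the integers themselves.\<close>
  have "\<exists>e. (e = 1 \<or> e = -1) \<and> (\<forall>i<n. int (f i) mod 0 = (int (f 0) + e * int i) mod 0)"
  proof (rule walk_monotone)
    fix i assume "Suc i < n"
    then have "hasse_adj n (path_poset n s) i (Suc i)" by (simp add: hasse_path_poset)
    then have "hasse_adj n (path_poset n s') (f i) (f (Suc i))" using h \<open>Suc i < n\<close> by simp
    then show "int (f (Suc i)) mod 0 = (int (f i) + 1) mod 0 \<or> int (f (Suc i)) mod 0 = (int (f i) - 1) mod 0"
      by (auto simp: hasse_path_poset)
  next
    fix i assume "Suc (Suc i) < n"
    then show "int (f (Suc (Suc i))) mod 0 \<noteq> int (f i) mod 0"
      using inj_on_eq_iff[OF bij_betw_imp_inj_on[OF f], of "Suc (Suc i)" i] by simp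
  qed
  then obtain e :: int where e: "e = 1 \<or> e = -1" and fe: "\<And>i. i < n \<Longrightarrow> int (f i) = int (f 0) + e * int i" by auto
  have last: "int (f (n - 1)) = int (f 0) + e * (int n - 1)" using fe[of "n - 1"] n by (simp add: of_nat_diff)
  have fl: "f (n - 1) < n" "f 0 < n" using fn n by auto
  from e show "?A \<or> ?B"
  proof
    assume "e = 1"
    then have "f 0 = 0" using last fl by auto
    then have fi: "f i = i" if "i < n" for i using fe[OF that] \<open>e = 1\<close> by simp
    have "s k = s' k" if k: "0 \<le> k" "k < int n - 1" for k
    proof -
      obtain i where i: "k = int i" using k(1) nonneg_int_cases by blast
      then have "Suc i < n" using k by linarith
      then show ?thesis using h[of i "Suc i"] fi i by (simp add: hasse_path_poset)
    qed
    then show ?thesis by blast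
  next
    assume e1: "e = -1"
    then have "int (f 0) = int n - 1" using last fl by auto
    then have fi: "f i = n - 1 - i" if "i < n" for i using fe[OF that] e1 that by auto
    have "s k = (\<not> s' (int n - 2 - k))" if k: "0 \<le> k" "k < int n - 1" for k
    proof -
      obtain i where i: "k = int i" using k(1) nonneg_int_cases by blast
      then have i1: "Suc i < n" using k by linarith
      have "s k \<longleftrightarrow> hasse {0..<n} (path_poset n s') (n - 1 - i) (n - 1 - Suc i)"
        using h[of i "Suc i"] fi i i1 by (simp add: hasse_path_poset)
      also have "\<dots> \<longleftrightarrow> \<not> s' (int (n - 1 - Suc i))" using i1 by (auto simp: hasse_path_poset)
      also have "int (n - 1 - Suc i) = int n - 2 - k" using i1 i by auto
      finally show ?thesis .
    qed
    then show ?thesis by blast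
  qed
qed

lemma hasse_adj_cycle:
  assumes n: "3 \<le> n" and per: "periodic n s" and H: "hasse_adj n (cycle_poset n s) i j"
  shows "j = zmod n (int i + 1) \<or> j = zmod n (int i - 1)"
proof -
  have n0: "0 < n" using n by simp
  obtain a where "(i = zmod n a \<and> j = zmod n (a + 1)) \<or> (i = zmod n (a + 1) \<and> j = zmod n a)"
    using H hasse_cycleE[OF n per] by blast
  then show ?thesis using zmod_shift[OF n0, of a 1] zmod_shift[OF n0, of "a + 1" "-1"] by auto
qed

text \<open>As for paths, an isomorphism is a walk of constant direction, now modulo
  \<open>n\<close>; \<open>c\<close> is the image of 0, and the direction separates rotations from
  reflections, which exchange up and down.\<close>

lemma cycle_iso_iff:
  assumes n: "3 \<le> n" and per: "periodic n s" "periodic n s'" and g: "\<not> two_runs n s" "\<not> two_runs n s'"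
  shows "poset_iso n (cycle_poset n s) (cycle_poset n s') \<longleftrightarrow>
    (\<exists>c\<in>{0..<int n}. (\<forall>k. s k = s' (k + c)) \<or> (\<forall>k. s k = (\<not> s' (c - 1 - k))))" (is "?I \<longleftrightarrow> ?C")
proof
  have n0: "0 < n" using n by simp
  assume ?C
  then obtain c where c: "(\<forall>k. s k = s' (k + c)) \<or> (\<forall>k. s k = (\<not> s' (c - 1 - k)))" by blast
  have main: ?I if sg: "sg = 1 \<or> sg = -1" and z: "\<And>a b. zle s a b \<longleftrightarrow> zle s' (c + sg * a) (c + sg * b)" for sg
  proof -
    let ?f = "\<lambda>i. zmod n (c + sg * int i)"
    have inj: "inj_on ?f {0..<n}"
    proof (rule inj_onI)
      fix i j assume ij: "i \<in> {0..<n}" "j \<in> {0..<n}" "?f i = ?f j"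
      then obtain q where q: "c + sg * int j = c + sg * int i + q * int n" using zmod_eq_iff[OF n0] by blast
      from sg have "int j = int i + (sg * q) * int n"
      proof
        assume "sg = 1"
        then show ?thesis using q by simp
      next
        assume "sg = -1"
        then show ?thesis using q by (simp add: algebra_simps)
      qed
      then have "zmod n (int i) = zmod n (int j)" by simp
      then show "i = j" using ij by (simp add: zmod_int)
    qed
    have "?f ` {0..<n} \<subseteq> {0..<n}" using zmod_less[OF n0] by auto
    then have "bij_betw ?f {0..<n} {0..<n}" using inj by (simp add: bij_betw_def endo_inj_surj)
    moreover have "(i, j) \<in> cycle_poset n s \<longleftrightarrow> (?f i, ?f j) \<in> cycle_poset n s'" if ij: "i < n" "j < n" for i j
    proof -
      have "(i, j) \<in> cycle_poset n s \<longleftrightarrow> (\<exists>q. zle s (int i) (int j + q * int n))"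
        using ij by (simp add: cycle_poset_def)
      also have "\<dots> \<longleftrightarrow> (\<exists>q. zle s' (c + sg * int i) (c + sg * int j + (sg * q) * int n))"
        unfolding z by (simp add: algebra_simps)
      also have "\<dots> \<longleftrightarrow> (\<exists>q. zle s' (c + sg * int i) (c + sg * int j + q * int n))"
      proof
        assume "\<exists>q. zle s' (c + sg * int i) (c + sg * int j + q * int n)"
        then obtain q where q: "zle s' (c + sg * int i) (c + sg * int j + q * int n)" ..
        have e: "sg * (sg * q) = q" using sg by auto
        show "\<exists>q. zle s' (c + sg * int i) (c + sg * int j + (sg * q) * int n)"
          by (rule exI[of _ "sg * q"]) (simp only: e q)
      qed blast
      also have "\<dots> \<longleftrightarrow> (?f i, ?f j) \<in> cycle_poset n s'" by (rule cycle_poset_zmod[OF n0 per(2), symmetric])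
      finally show ?thesis .
    qed
    ultimately show ?I unfolding poset_iso_def by blast
  qed
  from c show ?I
  proof
    assume "\<forall>k. s k = s' (k + c)"
    then have "zle s a b \<longleftrightarrow> zle s' (c + 1 * a) (c + 1 * b)" for a b
      using zle_translate[of a b s s' c] by (simp add: add.commute)
    then show ?I by (rule main[rotated]) simp
  next
    assume "\<forall>k. s k = (\<not> s' (c - 1 - k))"
    then have "zle s a b \<longleftrightarrow> zle s' (c + (-1) * a) (c + (-1) * b)" for a b
      using zle_reflect[of a b s s' c] by simp
    then show ?I by (rule main[rotated]) simp
  qed
next
  have n0: "0 < n" using n by simp
  assume ?I
  then obtain f where f: "bij_betw f {0..<n} {0..<n}"
    and iso: "\<And>i j. i < n \<Longrightarrow> j < n \<Longrightarrow> (i, j) \<in> cycle_poset n s \<longleftrightarrow> (f i, f j) \<in> cycle_poset n s'"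
    unfolding poset_iso_def by blast
  have h: "hasse {0..<n} (cycle_poset n s) i j \<longleftrightarrow> hasse {0..<n} (cycle_poset n s') (f i) (f j)"
    if "i < n" "j < n" for i j by (rule iso_hasse[OF f iso that])
  have fn: "f i < n" if "i < n" for i using f that by (auto simp: bij_betw_def)
  have "\<exists>e. (e = 1 \<or> e = -1) \<and> (\<forall>i<n. int (f i) mod int n = (int (f 0) + e * int i) mod int n)"
  proof (rule walk_monotone)
    fix i assume i: "Suc i < n"
    then have "zmod n (int i) = i" "zmod n (int i + 1) = Suc i"
      using zmod_int[of i n] zmod_int[of "Suc i" n] by (simp_all add: add.commute)
    then have "hasse_adj n (cycle_poset n s) i (Suc i)" using hasse_cycle_iff[OF n per(1) g(1), of "int i"] by auto
    then have "hasse_adj n (cycle_poset n s') (f i) (f (Suc i))" using h i by simp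
    then have "f (Suc i) = zmod n (int (f i) + 1) \<or> f (Suc i) = zmod n (int (f i) - 1)"
      by (rule hasse_adj_cycle[OF n per(2)])
    then show "int (f (Suc i)) mod int n = (int (f i) + 1) mod int n \<or> int (f (Suc i)) mod int n = (int (f i) - 1) mod int n"
      using int_zmod[OF n0] by (metis mod_mod_trivial)
  next
    fix i assume i: "Suc (Suc i) < n"
    then have "f (Suc (Suc i)) \<noteq> f i"
      using inj_on_eq_iff[OF bij_betw_imp_inj_on[OF f], of "Suc (Suc i)" i] by simp
    then show "int (f (Suc (Suc i))) mod int n \<noteq> int (f i) mod int n"
      using fn[of i] fn[of "Suc (Suc i)"] i by simp
  qed
  then obtain e :: int where e: "e = 1 \<or> e = -1"
    and fe: "\<And>i. i < n \<Longrightarrow> int (f i) mod int n = (int (f 0) + e * int i) mod int n" by auto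
  let ?c = "int (f 0)"
  have fz: "f (zmod n k) = zmod n (?c + e * k)" for k
  proof -
    have "int (f (zmod n k)) = int (f (zmod n k)) mod int n" using fn[OF zmod_less[OF n0]] by simp
    also have "\<dots> = (?c + e * (k mod int n)) mod int n" using fe[OF zmod_less[OF n0]] int_zmod[OF n0] by simp
    also have "\<dots> = (?c + e * k) mod int n" by (metis mod_add_right_eq mod_mult_right_eq)
    also have "\<dots> = int (zmod n (?c + e * k))" using int_zmod[OF n0] by simp
    finally show ?thesis by simp
  qed
  have sk: "s k \<longleftrightarrow> hasse {0..<n} (cycle_poset n s') (zmod n (?c + e * k)) (zmod n (?c + e * (k + 1)))" for k
    using hasse_cycle_iff(1)[OF n per(1) g(1), of k] h[OF zmod_less[OF n0] zmod_less[OF n0], of k "k + 1"] fz by simp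
  have "?c \<in> {0..<int n}" using fn n0 by simp
  moreover from e have "(\<forall>k. s k = s' (k + ?c)) \<or> (\<forall>k. s k = (\<not> s' (?c - 1 - k)))"
  proof
    assume "e = 1"
    then have "s k = s' (k + ?c)" for k
      using sk[of k] hasse_cycle_iff(1)[OF n per(2) g(2), of "?c + k"] by (simp add: algebra_simps)
    then show ?thesis by blast
  next
    assume "e = -1"
    then have "s k = (\<not> s' (?c - 1 - k))" for k
      using sk[of k] hasse_cycle_iff(2)[OF n per(2) g(2), of "?c - 1 - k"] by (simp add: algebra_simps)
    then show ?thesis by blast
  qed
  ultimately show ?C by blast
qed

text \<open>The end 0 of the path has a single neighbour, but its image on the cycle has two, which
  are distinct because \<open>n\<close> is at least 3.\<close>

lemma path_not_iso_cycle:
  assumes n: "3 \<le> n" and per: "periodic n s'" and g: "\<not> two_runs n s'"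
  shows "\<not> poset_iso n (path_poset n s) (cycle_poset n s')"
proof
  have n0: "0 < n" using n by simp
  assume "poset_iso n (path_poset n s) (cycle_poset n s')"
  then obtain f where f: "bij_betw f {0..<n} {0..<n}"
    and iso: "\<And>i j. i < n \<Longrightarrow> j < n \<Longrightarrow> (i, j) \<in> path_poset n s \<longleftrightarrow> (f i, f j) \<in> cycle_poset n s'"
    unfolding poset_iso_def by blast
  have h: "hasse {0..<n} (path_poset n s) i j \<longleftrightarrow> hasse {0..<n} (cycle_poset n s') (f i) (f j)"
    if "i < n" "j < n" for i j by (rule iso_hasse[OF f iso that])
  have f0: "f 0 < n" using f n0 by (auto simp: bij_betw_def)
  have one: "y = f 1" if "hasse_adj n (cycle_poset n s') (f 0) y" for y
  proof -
    have "y < n" using that by (auto simp: hasse_def)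
    then obtain i where i: "i < n" "y = f i" using f by (force simp: bij_betw_def)
    then have "hasse_adj n (path_poset n s) 0 i" using that h[of 0 i] h[of i 0] n0 by simp
    then have "i = 1" by (auto simp: hasse_path_poset)
    then show ?thesis using i by simp
  qed
  have z: "zmod n (int (f 0)) = f 0" using f0 by (rule zmod_int)
  have "hasse_adj n (cycle_poset n s') (f 0) (zmod n (int (f 0) + 1))"
    using hasse_cycle_iff[OF n per g, of "int (f 0)"] z by auto
  moreover have "hasse_adj n (cycle_poset n s') (f 0) (zmod n (int (f 0) - 1))"
    using hasse_cycle_iff[OF n per g, of "int (f 0) - 1"] z by auto
  ultimately have "zmod n (int (f 0) + 1) = zmod n (int (f 0) - 1)" using one by metis
  then show False using zmod_neq[of 2 n "int (f 0) - 1"] n by (simp add: algebra_simps)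
qed


subsection \<open>Counting orbits\<close>

lemma card_image_kernel:
  assumes "\<And>x y. x \<in> X \<Longrightarrow> y \<in> X \<Longrightarrow> f x = f y \<longleftrightarrow> g x = g y"
  shows "card (f ` X) = card (g ` X)"
proof -
  have iv: "inv_into X f (f x) \<in> X" "f (inv_into X f (f x)) = f x" if "x \<in> X" for x
    using that by (auto simp: inv_into_into f_inv_into_f)
  have g: "g (inv_into X f (f x)) = g x" if "x \<in> X" for x using assms[OF iv(1)[OF that] that] iv(2)[OF that] by simp
  have "inj_on (\<lambda>u. g (inv_into X f u)) (f ` X)"
    using assms g by (auto intro!: inj_onI)
  moreover have "(\<lambda>u. g (inv_into X f u)) ` f ` X = g ` X" using g by (force simp: image_image)
  ultimately show ?thesis by (metis card_image)
qed

lemma card_filter_bij: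
  assumes "bij_betw r D D"
  shows "card {x \<in> D. P (r x)} = card {x \<in> D. P x}"
proof -
  have "{x \<in> D. P x} = r ` {x \<in> D. P (r x)}" using assms by (auto simp: bij_betw_def)
  moreover have "inj_on r {x \<in> D. P (r x)}" using assms by (auto simp: bij_betw_def intro: inj_on_subset)
  ultimately show ?thesis by (simp add: card_image)
qed

text \<open>No multiplication on \<open>G\<close> is fixed: right multiplication by an element
  appears as a permutation \<open>r\<close> of \<open>G\<close> that depends on that element only,
  not on the point acted upon.\<close>

locale finite_action =
  fixes G :: "'g set" and X :: "'x set" and act :: "'g \<Rightarrow> 'x \<Rightarrow> 'x"
  assumes finG: "finite G" and finX: "finite X"
    and act_in: "\<And>g x. g \<in> G \<Longrightarrow> x \<in> X \<Longrightarrow> act g x \<in> X"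
    and act_one: "\<exists>e\<in>G. \<forall>x\<in>X. act e x = x"
    and act_mult: "\<And>g\<^sub>0. g\<^sub>0 \<in> G \<Longrightarrow> \<exists>r. bij_betw r G G \<and> (\<forall>g\<in>G. \<forall>x\<in>X. act (r g) x = act g (act g\<^sub>0 x))"
begin

definition orb :: "'x \<Rightarrow> 'x set" where
  "orb x = (\<lambda>g. act g x) ` G"

lemma orb_self: "x \<in> X \<Longrightarrow> x \<in> orb x"
  using act_one unfolding orb_def by (metis imageI)

lemma orb_eq:
  assumes x: "x \<in> X" and y: "y \<in> orb x"
  shows "orb y = orb x"
proof -
  obtain g0 where g0: "g0 \<in> G" "y = act g0 x" using y by (auto simp: orb_def)
  obtain r where r: "bij_betw r G G" "\<And>g. g \<in> G \<Longrightarrow> act (r g) x = act g y" using act_mult[OF g0(1)] x g0(2) by blast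
  have "orb y = (\<lambda>g. act (r g) x) ` G" unfolding orb_def using r(2) by simp
  also have "\<dots> = (\<lambda>g. act g x) ` (r ` G)" by (simp add: image_image)
  also have "\<dots> = orb x" by (simp add: orb_def bij_betw_imp_surj_on[OF r(1)])
  finally show ?thesis .
qed

lemma orb_eq_iff: "x \<in> X \<Longrightarrow> y \<in> X \<Longrightarrow> orb x = orb y \<longleftrightarrow> x \<in> orb y"
  using orb_eq orb_self by blast

lemma orb_subset: "x \<in> X \<Longrightarrow> orb x \<subseteq> X"
  using act_in by (auto simp: orb_def)

lemma transporter_card:
  assumes x: "x \<in> X" and y: "y \<in> orb x"
  shows "card {g \<in> G. act g y = z} = card {g \<in> G. act g x = z}"
proof -
  obtain g0 where g0: "g0 \<in> G" "y = act g0 x" using y by (auto simp: orb_def)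
  obtain r where r: "bij_betw r G G" "\<And>g. g \<in> G \<Longrightarrow> act (r g) x = act g y" using act_mult[OF g0(1)] x g0(2) by blast
  have "{g \<in> G. act g y = z} = {g \<in> G. act (r g) x = z}" using r(2) by auto
  then show ?thesis using card_filter_bij[OF r(1), of "\<lambda>g. act g x = z"] by simp
qed

text \<open>Count the pairs of an element and a fixed point by points. On the orbit of
  \<open>x\<close> the stabiliser of \<open>y\<close> has as many elements as there are elements
  moving \<open>x\<close> to \<open>y\<close>, and those sets partition \<open>G\<close>.\<close>

lemma burnside: "(\<Sum>g\<in>G. card {x \<in> X. act g x = x}) = card (orb ` X) * card G"
proof -
  have "(\<Sum>g\<in>G. card {x \<in> X. act g x = x}) = (\<Sum>g\<in>G. \<Sum>x\<in>X. if act g x = x then 1 else 0)"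
    using finX by (simp add: sum.inter_filter[symmetric])
  also have "\<dots> = (\<Sum>x\<in>X. \<Sum>g\<in>G. if act g x = x then 1 else 0)" by (rule sum.swap)
  also have "\<dots> = (\<Sum>x\<in>X. card {g \<in> G. act g x = x})"
    using finG by (simp add: sum.inter_filter[symmetric])
  also have "\<dots> = (\<Sum>u\<in>orb ` X. \<Sum>x\<in>{x \<in> X. orb x = u}. card {g \<in> G. act g x = x})"
    by (rule sum.image_gen[OF finX])
  also have "\<dots> = (\<Sum>u\<in>orb ` X. card G)"
  proof (intro sum.cong refl)
    fix u assume "u \<in> orb ` X"
    then obtain x where x: "x \<in> X" "u = orb x" by blast
    have "{y \<in> X. orb y = u} = orb x"
    proof (intro equalityI subsetI)
      show "y \<in> orb x" if "y \<in> {y \<in> X. orb y = u}" for y using that orb_self[of y] x(2) by simp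
      show "y \<in> {y \<in> X. orb y = u}" if "y \<in> orb x" for y
        using that orb_eq[OF x(1) that] orb_subset[OF x(1)] x(2) by (simp add: subset_iff)
    qed
    then have "(\<Sum>y\<in>{y \<in> X. orb y = u}. card {g \<in> G. act g y = y}) = (\<Sum>y\<in>orb x. card {g \<in> G. act g x = y})"
      using transporter_card[OF x(1)] by (intro sum.cong) auto
    also have "\<dots> = (\<Sum>y\<in>(\<lambda>g. act g x) ` G. \<Sum>g\<in>{g \<in> G. act g x = y}. 1)"
      by (simp add: orb_def)
    also have "\<dots> = (\<Sum>g\<in>G. 1)" by (rule sum.image_gen[OF finG, symmetric])
    finally show "(\<Sum>y\<in>{y \<in> X. orb y = u}. card {g \<in> G. act g y = y}) = card G" by simp
  qed
  finally show ?thesis by simp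
qed

end

subsection \<open>Orientations of a path\<close>

text \<open>A path on \<open>n\<close> vertices has the edges 0 to \<open>n - 2\<close>; fixing the
  letters elsewhere to false makes each orientation one function.\<close>

definition path_words :: "nat \<Rightarrow> (int \<Rightarrow> bool) set" where
  "path_words n = {s. \<forall>k. s k \<longrightarrow> 0 \<le> k \<and> k < int n - 1}"

text \<open>Reading a path backwards exchanges up and down, hence the negation.\<close>

definition path_flip :: "nat \<Rightarrow> bool \<Rightarrow> (int \<Rightarrow> bool) \<Rightarrow> int \<Rightarrow> bool" where
  "path_flip n b s = (if b then (\<lambda>k. 0 \<le> k \<and> k < int n - 1 \<and> \<not> s (int n - 2 - k)) else s)"

lemma bij_path_words: "bij_betw (\<lambda>A k. k \<in> A) (Pow {0..<int n - 1}) (path_words n)"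
  by (rule bij_betw_byWitness[of _ Collect]) (auto simp: path_words_def)

lemma card_path_words: "finite (path_words n)" "1 \<le> n \<Longrightarrow> card (path_words n) = 2 ^ (n - 1)"
proof -
  show "finite (path_words n)" using bij_betw_finite[OF bij_path_words] by simp
  assume n: "1 \<le> n"
  have "card (path_words n) = card (Pow {0..<int n - 1})" using bij_betw_same_card[OF bij_path_words] by simp
  also have "\<dots> = 2 ^ (n - 1)" using n by (simp add: card_Pow nat_diff_distrib)
  finally show "card (path_words n) = 2 ^ (n - 1)" .
qed

lemma path_flip_involution: "s \<in> path_words n \<Longrightarrow> path_flip n True (path_flip n True s) = s"
  by (auto simp: path_flip_def path_words_def fun_eq_iff)

interpretation path_action: finite_action "UNIV :: bool set" "path_words n" "path_flip n" for n
proof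
  show "finite (path_words n)" by (rule card_path_words)
  show "path_flip n g x \<in> path_words n" if "x \<in> path_words n" for g x
    using that by (cases g) (auto simp: path_flip_def path_words_def)
  show "\<exists>e\<in>UNIV. \<forall>x\<in>path_words n. path_flip n e x = x"
    by (intro bexI[of _ False]) (auto simp: path_flip_def)
  show "\<exists>r. bij_betw r UNIV UNIV \<and> (\<forall>g\<in>UNIV. \<forall>x\<in>path_words n. path_flip n (r g) x = path_flip n g (path_flip n g0 x))"
    for g0
  proof (cases g0)
    case True
    have "bij (\<lambda>g. \<not> g)" by (rule bij_betwI[of _ _ _ "\<lambda>g. \<not> g"]) auto
    moreover have "path_flip n (\<not> g) x = path_flip n g (path_flip n True x)" if "x \<in> path_words n" for g x
      using path_flip_involution[OF that] by (cases g) (auto simp: path_flip_def)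
    ultimately show ?thesis by (intro exI[of _ Not] conjI ballI) (simp_all add: True)
  next
    case False
    then show ?thesis by (intro exI[of _ id]) (auto simp: path_flip_def)
  qed
qed auto

text \<open>For even \<open>n\<close> the middle edge would have to be its own opposite. For odd
  \<open>n\<close> the edges fall into opposite pairs, and the letters of the first half are
  free.\<close>

lemma card_path_flip_fixed:
  assumes n: "1 \<le> n"
  shows "card {s \<in> path_words n. path_flip n True s = s} = (if odd n then 2 ^ ((n - 1) div 2) else 0)"
proof (cases "odd n")
  case False
  have "path_flip n True s \<noteq> s" for s
  proof
    assume e: "path_flip n True s = s"
    obtain h where h: "n = 2 * h" using False by (auto elim!: evenE)
    then have "0 \<le> int h - 1 \<and> int h - 1 < int n - 1" "int n - 2 - (int h - 1) = int h - 1" using n by auto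
    then show False using fun_cong[OF e, of "int h - 1"] unfolding path_flip_def by auto
  qed
  then show ?thesis using False by simp
next
  case True
  then obtain m where m: "n = 2 * m + 1" by (rule oddE)
  let ?E = "\<lambda>A k. (0 \<le> k \<and> k < int m \<and> k \<in> A) \<or> (int m \<le> k \<and> k < 2 * int m \<and> 2 * int m - 1 - k \<notin> A)"
  have "bij_betw ?E (Pow {0..<int m}) {s \<in> path_words n. path_flip n True s = s}"
  proof (rule bij_betw_byWitness[of _ "\<lambda>s. {k. 0 \<le> k \<and> k < int m \<and> s k}"])
    show "\<forall>s\<in>{s \<in> path_words n. path_flip n True s = s}. ?E {k. 0 \<le> k \<and> k < int m \<and> s k} = s"
    proof (intro ballI ext)
      fix s k assume s: "s \<in> {s \<in> path_words n. path_flip n True s = s}"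
      have w: "s k \<longrightarrow> 0 \<le> k \<and> k < 2 * int m" using s m by (auto simp: path_words_def)
      have "path_flip n True s k = s k" using s by simp
      then have f: "s k \<longleftrightarrow> 0 \<le> k \<and> k < 2 * int m \<and> \<not> s (2 * int m - 1 - k)"
        using m unfolding path_flip_def by auto
      show "?E {k. 0 \<le> k \<and> k < int m \<and> s k} k = s k"
        using w f by (cases "k < int m") auto
    qed
    show "?E ` Pow {0..<int m} \<subseteq> {s \<in> path_words n. path_flip n True s = s}"
    proof clarify
      fix A assume A: "A \<subseteq> {0..<int m}"
      have "path_flip n True (?E A) k = ?E A k" for k
        using A m by (auto simp: path_flip_def)
      then show "?E A \<in> path_words n \<and> path_flip n True (?E A) = ?E A" using m by (auto simp: path_words_def)
    qed
  qed auto
  then have "card {s \<in> path_words n. path_flip n True s = s} = card (Pow {0..<int m})"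
    by (rule bij_betw_same_card[symmetric])
  then show ?thesis using m by (simp add: card_Pow)
qed

lemma card_path_orbits:
  assumes n: "1 \<le> n"
  shows "2 * card (path_action.orb n ` path_words n) = 2 ^ (n - 1) + (if odd n then 2 ^ ((n - 1) div 2) else 0)"
proof -
  have "card {s \<in> path_words n. path_flip n False s = s} = 2 ^ (n - 1)"
    using card_path_words(2)[OF n] by (simp add: path_flip_def)
  then show ?thesis
    using path_action.burnside[of n] card_path_flip_fixed[OF n] by (simp add: UNIV_bool mult.commute)
qed

subsection \<open>Orientations of a cycle\<close>

text \<open>The Boolean says whether the cycle is reflected; a reflection also negates the letters.
  The number is the image of vertex 0 under the vertex map of \<open>cycle_iso_iff\<close>.\<close>

definition dihedral :: "bool \<times> nat \<Rightarrow> (int \<Rightarrow> bool) \<Rightarrow> int \<Rightarrow> bool" where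
  "dihedral g s = (if fst g then (\<lambda>k. \<not> s (int (snd g) - 1 - k)) else (\<lambda>k. s (k + int (snd g))))"

lemma bij_periodic:
  assumes d: "0 < d"
  shows "bij_betw (\<lambda>A k. k mod int d \<in> A) (Pow {0..<int d}) {s. periodic d s}"
proof (rule bij_betw_byWitness[of _ "\<lambda>s. {k. 0 \<le> k \<and> k < int d \<and> s k}"])
  show "\<forall>s\<in>{s. periodic d s}. (\<lambda>k. k mod int d \<in> {k. 0 \<le> k \<and> k < int d \<and> s k}) = s"
  proof (intro ballI ext)
    fix s k assume "s \<in> {s. periodic d s}"
    then have "s (k mod int d + (k div int d) * int d) = s (k mod int d)" using periodic_shift by blast
    then show "(k mod int d \<in> {k. 0 \<le> k \<and> k < int d \<and> s k}) = s k" using d by simp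
  qed
  show "\<forall>A\<in>Pow {0..<int d}. {k. 0 \<le> k \<and> k < int d \<and> k mod int d \<in> A} = A" using d by auto
  show "(\<lambda>A k. k mod int d \<in> A) ` Pow {0..<int d} \<subseteq> {s. periodic d s}" by (auto simp: periodic_def)
qed auto

lemma card_periodic:
  assumes "0 < d"
  shows "finite {s. periodic d s}" "card {s. periodic d s} = 2 ^ d"
  using bij_betw_finite[OF bij_periodic[OF assms]] bij_betw_same_card[OF bij_periodic[OF assms]]
  by (simp_all add: card_Pow)

lemma periodic_zmod:
  assumes "0 < n" "periodic n s"
  shows "s (k + int (zmod n x)) = s (k + x)"
proof -
  have "k + int (zmod n x) = k + x + - (x div int n) * int n"
    using int_zmod[OF assms(1), of x] minus_div_mult_eq_mod[of x "int n"] by simp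
  then show ?thesis using periodic_shift[OF assms(2), of "k + x" "- (x div int n)"] by (simp only:)
qed

lemma periodic_dihedral: "periodic n s \<Longrightarrow> periodic n (dihedral g s)"
proof -
  assume p: "periodic n s"
  have "s (k + int n + c) = s (k + c)" "s (c - 1 - (k + int n)) = s (c - 1 - k)" for k c
    using periodic_shift[OF p, of "k + c" 1] periodic_shift[OF p, of "c - 1 - k" "-1"] by (simp_all add: algebra_simps)
  then show ?thesis by (simp add: periodic_def dihedral_def)
qed

interpretation cycle_action: finite_action "UNIV \<times> {..<Suc n'}" "{s. periodic (Suc n') s}" dihedral for n'
proof
  let ?n = "Suc n'"
  have n: "0 < ?n" by simp
  show "finite (UNIV \<times> {..<?n} :: (bool \<times> nat) set)" by simp
  show "finite {s. periodic ?n s}" by (rule card_periodic) simp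
  show "dihedral g x \<in> {s. periodic ?n s}" if "x \<in> {s. periodic ?n s}" for g x
    using that periodic_dihedral by simp
  show "\<exists>e\<in>UNIV \<times> {..<?n}. \<forall>x\<in>{s. periodic ?n s}. dihedral e x = x"
    by (intro bexI[of _ "(False, 0)"]) (auto simp: dihedral_def)
  fix g0 :: "bool \<times> nat" assume g0: "g0 \<in> UNIV \<times> {..<?n}"
  obtain e d where ed: "g0 = (e, d)" by (cases g0)
  \<comment> \<open>Acting by shift \<open>c\<close> after a reflection with shift \<open>d\<close>
    amounts to shift \<open>d - c\<close>, after a rotation to \<open>c + d\<close>; the kinds
    combine by exclusive or.\<close>
  let ?sh = "\<lambda>c. if e then int d - int c else int c + int d"
  let ?r = "\<lambda>g. (fst g \<noteq> e, zmod ?n (?sh (snd g)))"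
  have inj: "inj_on ?r (UNIV \<times> {..<?n})"
  proof (rule inj_onI)
    fix g h :: "bool \<times> nat"
    assume g: "g \<in> UNIV \<times> {..<?n}" and h: "h \<in> UNIV \<times> {..<?n}" and eq: "?r g = ?r h"
    then obtain q where "?sh (snd h) = ?sh (snd g) + q * int ?n" using zmod_eq_iff[OF n] by blast
    then have "int (snd h) = int (snd g) + (if e then - q else q) * int ?n" by (auto split: if_splits)
    then have "zmod ?n (int (snd g)) = zmod ?n (int (snd h))" by (metis zmod_add(1))
    moreover have "snd g < ?n" "snd h < ?n" using g h by auto
    ultimately have "snd g = snd h" using zmod_int by metis
    then show "g = h" using eq by (auto simp: prod_eq_iff)
  qed
  have "?r ` (UNIV \<times> {..<?n}) \<subseteq> UNIV \<times> {..<?n}" using zmod_less[OF n] by auto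
  then have "bij_betw ?r (UNIV \<times> {..<?n}) (UNIV \<times> {..<?n})"
    using inj by (simp add: bij_betw_def endo_inj_surj)
  moreover have "dihedral (?r g) s = dihedral g (dihedral g0 s)" if "periodic ?n s" for g s
  proof
    fix k
    have z: "s (l + int (zmod ?n x)) = s (l + x)" for l x by (rule periodic_zmod[OF n that])
    have z': "s (int (zmod ?n x) - 1 - k) = s (x - 1 - k)" for x
      using z[of "- 1 - k" x] by (simp add: algebra_simps)
    show "dihedral (?r g) s k = dihedral g (dihedral g0 s) k"
      unfolding ed by (cases "fst g"; cases e) (simp_all add: dihedral_def z z', simp_all add: algebra_simps)
  qed
  ultimately show "\<exists>r. bij_betw r (UNIV \<times> {..<?n}) (UNIV \<times> {..<?n}) \<and>
      (\<forall>g\<in>UNIV \<times> {..<?n}. \<forall>x\<in>{s. periodic ?n s}. dihedral (r g) x = dihedral g (dihedral g0 x))"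
    by (intro exI[of _ ?r]) blast
qed

text \<open>A word with periods \<open>n\<close> and \<open>c\<close> has period
  \<open>gcd n c\<close> by Bezout's identity.\<close>

lemma rotation_fixed:
  assumes n: "0 < n"
  shows "{s. periodic n s \<and> dihedral (False, c) s = s} = {s. periodic (gcd n c) s}"
proof (intro equalityI subsetI)
  fix s assume "s \<in> {s. periodic n s \<and> dihedral (False, c) s = s}"
  then have p: "periodic n s" and c: "periodic c s" by (auto simp: periodic_def dihedral_def fun_eq_iff)
  obtain u v where uv: "u * int n + v * int c = int (gcd n c)" using bezout_int[of "int n" "int c"] by auto
  have "s (k + int (gcd n c)) = s k" for k
    using periodic_shift[OF c, of "k + u * int n" v] periodic_shift[OF p, of k u] uv[symmetric] by (simp add: add.assoc)
  then show "s \<in> {s. periodic (gcd n c) s}" by (simp add: periodic_def)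
next
  fix s assume "s \<in> {s. periodic (gcd n c) s}"
  then have g: "periodic (gcd n c) s" by simp
  obtain a b where "n = gcd n c * a" "c = gcd n c * b" by (metis dvdE gcd_dvd1 gcd_dvd2)
  then have "int n = int a * int (gcd n c)" "int c = int b * int (gcd n c)" by (metis mult.commute of_nat_mult)+
  then have "s (k + int n) = s k" "s (k + int c) = s k" for k
    using periodic_shift[OF g, of k "int a"] periodic_shift[OF g, of k "int b"] by simp_all
  then show "s \<in> {s. periodic n s \<and> dihedral (False, c) s = s}" by (simp add: periodic_def dihedral_def fun_eq_iff)
qed

text \<open>Under these parities some edge \<open>k\<close> is mapped to itself modulo
  \<open>n\<close>, and its letter would have to equal its own negation.\<close>

lemma reflection_fixed_empty:
  assumes "odd c \<or> odd n"
  shows "{s. periodic n s \<and> dihedral (True, c) s = s} = {}"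
proof -
  have False if p: "periodic n s" and e: "dihedral (True, c) s = s" for s
  proof -
    obtain k q where "int c - 1 - k = k + q * int n"
    proof (cases "odd c")
      case True
      then obtain m where "c = 2 * m + 1" by (rule oddE)
      then show ?thesis using that[of "int m" 0] by simp
    next
      case False
      then obtain m where "c = 2 * m" by (auto elim!: evenE)
      moreover obtain l where "n = 2 * l + 1" using False assms by (auto elim!: oddE)
      ultimately show ?thesis using that[of "int m + int l" "-1"] by simp
    qed
    then show False using fun_cong[OF e, of k] periodic_shift[OF p, of k q] by (simp add: dihedral_def)
  qed
  then show ?thesis by auto
qed

text \<open>Counted from \<open>c div 2\<close>, the reflection exchanges edge offsets
  \<open>x\<close> and \<open>n - 1 - x\<close>. It pairs the first half of the cycle with the
  second, so the letters on one half are free and determine the others.\<close>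

lemma reflection_fixed_card:
  assumes "even c" "even n" "0 < n"
  shows "card {s. periodic n s \<and> dihedral (True, c) s = s} = 2 ^ (n div 2)"
proof -
  obtain e h where e: "c = 2 * e" and h: "n = 2 * h" using assms by (auto elim!: evenE)
  have h0: "0 < h" using assms(3) h by simp
  let ?x = "\<lambda>k. (k - int e) mod int n"
  let ?E = "\<lambda>A k. if ?x k < int h then ?x k \<in> A else int n - 1 - ?x k \<notin> A"
  have b: "0 \<le> ?x k" "?x k < int n" for k using assms(3) by simp_all
  have mirror: "?x (int c - 1 - k) = int n - 1 - ?x k" for k
  proof -
    have "?x (int c - 1 - k) = (int n - 1 - ?x k) mod int n"
    proof -
      have "(int n - 1 - ?x k) mod int n = (int n - 1 - (k - int e)) mod int n" by (rule mod_diff_right_eq)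
      also have "int n - 1 - (k - int e) = (int c - 1 - k - int e) + int n" using e by simp
      finally show ?thesis by simp
    qed
    also have "\<dots> = int n - 1 - ?x k" using b[of k] by (intro mod_pos_pos_trivial) auto
    finally show ?thesis .
  qed
  have "bij_betw ?E (Pow {0..<int h}) {s. periodic n s \<and> dihedral (True, c) s = s}"
  proof (rule bij_betw_byWitness[of _ "\<lambda>s. {y. 0 \<le> y \<and> y < int h \<and> s (y + int e)}"])
    show "\<forall>A\<in>Pow {0..<int h}. {y. 0 \<le> y \<and> y < int h \<and> ?E A (y + int e)} = A"
      using h by auto
    show "\<forall>s\<in>{s. periodic n s \<and> dihedral (True, c) s = s}. ?E {y. 0 \<le> y \<and> y < int h \<and> s (y + int e)} = s"
    proof (intro ballI ext)
      fix s k assume "s \<in> {s. periodic n s \<and> dihedral (True, c) s = s}"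
      then have p: "periodic n s" and f: "\<And>k. s k = (\<not> s (int c - 1 - k))" by (auto simp: dihedral_def fun_eq_iff)
      have x: "s (?x k + int e) = s k" for k
        using periodic_shift[OF p, of k "- ((k - int e) div int n)"]
        by (simp add: minus_div_mult_eq_mod[symmetric] algebra_simps)
      have "s (int n - 1 - ?x k + int e) = s (int c - 1 - k)" using x[of "int c - 1 - k"] mirror[of k] by simp
      then show "?E {y. 0 \<le> y \<and> y < int h \<and> s (y + int e)} k = s k"
        using x[of k] f[of k] b[of k] h by auto
    qed
    show "?E ` Pow {0..<int h} \<subseteq> {s. periodic n s \<and> dihedral (True, c) s = s}"
    proof clarify
      fix A
      have "?x (k + int n) = ?x k" for k by (metis add_diff_eq add.commute mod_add_self1 diff_add_eq)
      then have P: "periodic n (?E A)" by (simp add: periodic_def)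
      have "dihedral (True, c) (?E A) k = ?E A k" for k
      proof -
        define X where "X = ?x k"
        have "dihedral (True, c) (?E A) k \<longleftrightarrow>
            \<not> (if int n - 1 - X < int h then int n - 1 - X \<in> A else int n - 1 - (int n - 1 - X) \<notin> A)"
          by (simp only: dihedral_def fst_conv snd_conv if_True mirror X_def)
        also have "\<dots> \<longleftrightarrow> (if X < int h then X \<in> A else int n - 1 - X \<notin> A)"
          using b[of k, folded X_def] h by auto
        finally show ?thesis unfolding X_def .
      qed
      then have "dihedral (True, c) (?E A) = ?E A" by (rule ext)
      with P show "periodic n (?E A) \<and> dihedral (True, c) (?E A) = ?E A" by (rule conjI)
    qed
  qed auto
  then have "card {s. periodic n s \<and> dihedral (True, c) s = s} = card (Pow {0..<int h})"
    by (rule bij_betw_same_card[symmetric])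
  then show ?thesis using h by (simp add: card_Pow)
qed

lemma sum_even: "(\<Sum>c<2 * h. if even c then (x :: nat) else 0) = h * x"
  by (induction h) simp_all

text \<open>Burnside's lemma for the dihedral group of order \<open>2 * n\<close>: the rotations
  give the powers with \<open>gcd\<close>, and for even \<open>n\<close> half of the
  \<open>n\<close> reflections have fixed words.\<close>

lemma card_cycle_orbits:
  assumes n: "n = Suc n'"
  shows "card (cycle_action.orb n' ` {s. periodic n s}) * (2 * n)
    = (\<Sum>c<n. 2 ^ gcd n c) + (if even n then (n div 2) * 2 ^ (n div 2) else 0)"
proof -
  let ?X = "{s. periodic n s}"
  have n0: "0 < n" using n by simp
  have "card (cycle_action.orb n' ` ?X) * card (UNIV \<times> {..<n} :: (bool \<times> nat) set)
      = (\<Sum>g\<in>UNIV \<times> {..<n}. card {s \<in> ?X. dihedral g s = s})"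
    using cycle_action.burnside[of n'] n by simp
  also have "\<dots> = (\<Sum>e\<in>UNIV. \<Sum>c<n. card {s \<in> ?X. dihedral (e, c) s = s})"
    by (simp add: sum.cartesian_product)
  also have "\<dots> = (\<Sum>c<n. card {s \<in> ?X. dihedral (False, c) s = s}) + (\<Sum>c<n. card {s \<in> ?X. dihedral (True, c) s = s})"
    by (simp add: UNIV_bool)
  also have "(\<Sum>c<n. card {s \<in> ?X. dihedral (False, c) s = s}) = (\<Sum>c<n. 2 ^ gcd n c)"
    using rotation_fixed[OF n0] card_periodic(2) n0 by (intro sum.cong) auto
  also have "(\<Sum>c<n. card {s \<in> ?X. dihedral (True, c) s = s}) = (if even n then (n div 2) * 2 ^ (n div 2) else 0)"
  proof (cases "even n")
    case True
    then obtain h where h: "n = 2 * h" by (rule evenE)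
    have "card {s \<in> ?X. dihedral (True, c) s = s} = (if even c then 2 ^ (n div 2) else 0)" for c
    proof (cases "even c")
      case True
      then show ?thesis using reflection_fixed_card[OF True \<open>even n\<close> n0] by simp
    next
      case False
      then have "{s. periodic n s \<and> dihedral (True, c) s = s} = {}" by (intro reflection_fixed_empty disjI1)
      then have "card {s. periodic n s \<and> dihedral (True, c) s = s} = 0" by (simp only: card.empty)
      then show ?thesis using False by simp
    qed
    then have "(\<Sum>c<n. card {s \<in> ?X. dihedral (True, c) s = s}) = (\<Sum>c<2 * h. if even c then 2 ^ (n div 2) else 0)"
      using h by (intro sum.cong) auto
    then show ?thesis using True h sum_even by simp
  next
    case False
    then have "{s. periodic n s \<and> dihedral (True, c) s = s} = {}" for c by (intro reflection_fixed_empty disjI2)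
    then have "card {s. periodic n s \<and> dihedral (True, c) s = s} = 0" for c by (simp only: card.empty)
    then show ?thesis using False by simp
  qed
  finally have "card (cycle_action.orb n' ` ?X) * card (UNIV \<times> {..<n} :: (bool \<times> nat) set)
      = (\<Sum>c<n. 2 ^ gcd n c) + (if even n then (n div 2) * 2 ^ (n div 2) else 0)" .
  moreover have "card (UNIV \<times> {..<n} :: (bool \<times> nat) set) = 2 * n"
    by (simp add: card_cartesian_product card_UNIV_bool)
  ultimately show ?thesis by (simp only:)
qed


section \<open>Orbits of words with at most two runs\<close>

lemma two_runs_shift:
  assumes "two_runs n s"
  shows "two_runs n (\<lambda>k. s (k + c))"
proof -
  obtain a l where l: "0 \<le> l" "l \<le> int n" and t: "\<And>k. a \<le> k \<Longrightarrow> k < a + l \<Longrightarrow> s k"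
    and f: "\<And>k. a + l \<le> k \<Longrightarrow> k < a + int n \<Longrightarrow> \<not> s k"
    using assms unfolding two_runs_def by blast
  show ?thesis unfolding two_runs_def
    using l t f by (intro exI[of _ "a - c"] exI[of _ l]) auto
qed

lemma two_runs_reflect:
  assumes "two_runs n s"
  shows "two_runs n (\<lambda>k. \<not> s (c - 1 - k))"
proof -
  obtain a l where l: "0 \<le> l" "l \<le> int n" and t: "\<And>k. a \<le> k \<Longrightarrow> k < a + l \<Longrightarrow> s k"
    and f: "\<And>k. a + l \<le> k \<Longrightarrow> k < a + int n \<Longrightarrow> \<not> s k"
    using assms unfolding two_runs_def by blast
  show ?thesis unfolding two_runs_def
    using l t f by (intro exI[of _ "c - a - int n"] exI[of _ "int n - l"]) auto
qed

lemma two_runs_dihedral: "two_runs n s \<Longrightarrow> two_runs n (dihedral g s)"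
  using two_runs_shift two_runs_reflect by (simp add: dihedral_def)

definition block :: "nat \<Rightarrow> nat \<Rightarrow> int \<Rightarrow> bool" where
  "block n l k \<longleftrightarrow> k mod int n < int l"

text \<open>The number of ascending edges in one period. It is invariant under rotations and
  replaced by its complement under reflections, which is enough to separate the orbits of
  blocks.\<close>

definition weight :: "nat \<Rightarrow> (int \<Rightarrow> bool) \<Rightarrow> nat" where
  "weight n s = card {k \<in> {0..<int n}. s k}"

lemma weight_dihedral:
  assumes n: "0 < n" and per: "periodic n s"
  shows "weight n (dihedral g s) = (if fst g then n - weight n s else weight n s)"
proof -
  have perm: "bij_betw (\<lambda>k. (sg * k + c) mod int n) {0..<int n} {0..<int n}" if sg: "sg = 1 \<or> sg = -1" for sg c :: int
  proof -
    have "inj_on (\<lambda>k. (sg * k + c) mod int n) {0..<int n}"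
    proof (rule inj_onI)
      fix k l assume kl: "k \<in> {0..<int n}" "l \<in> {0..<int n}" "(sg * k + c) mod int n = (sg * l + c) mod int n"
      then have "int n dvd sg * k + c - (sg * l + c)" by (simp add: mod_eq_dvd_iff)
      then have "int n dvd sg * (k - l)" by (simp add: algebra_simps)
      then have "int n dvd k - l" using sg by (auto simp: dvd_diff_commute[of "int n"])
      then have "k mod int n = l mod int n" by (simp add: mod_eq_dvd_iff)
      then show "k = l" using kl by simp
    qed
    moreover have "(\<lambda>k. (sg * k + c) mod int n) ` {0..<int n} \<subseteq> {0..<int n}" using n by auto
    ultimately show ?thesis by (simp add: bij_betw_def endo_inj_surj)
  qed
  have md: "s (x mod int n) = s x" for x
    using periodic_shift[OF per, of x "- (x div int n)"] by (simp add: minus_div_mult_eq_mod[symmetric])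
  let ?c = "int (snd g)"
  have rot: "card {k \<in> {0..<int n}. s (k + ?c)} = weight n s"
    using card_filter_bij[OF perm[of 1 ?c], of s] by (simp add: md weight_def)
  have refl: "card {k \<in> {0..<int n}. s (?c - 1 - k)} = weight n s"
    using card_filter_bij[OF perm[of "-1" "?c - 1"], of s] by (simp add: md weight_def)
  have "{k \<in> {0..<int n}. \<not> s (?c - 1 - k)} = {0..<int n} - {k \<in> {0..<int n}. s (?c - 1 - k)}" by auto
  then have "card {k \<in> {0..<int n}. \<not> s (?c - 1 - k)} = n - weight n s"
    using refl card_Diff_subset[of "{k \<in> {0..<int n}. s (?c - 1 - k)}" "{0..<int n}"] by fastforce
  then show ?thesis using rot by (simp add: dihedral_def weight_def)
qed

lemma weight_block:
  assumes "l \<le> n"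
  shows "weight n (block n l) = l"
proof -
  have "{k \<in> {0..<int n}. block n l k} = {0..<int l}" using assms by (auto simp: block_def)
  then show ?thesis by (simp add: weight_def)
qed

lemma periodic_block: "periodic n (block n l)"
  by (simp add: periodic_def block_def)

lemma two_runs_block:
  assumes "l \<le> n"
  shows "two_runs n (block n l)"
  unfolding two_runs_def using assms
  by (intro exI[of _ 0] exI[of _ "int l"]) (auto simp: block_def)

lemma block_reflect:
  assumes n: "0 < n" and l: "l \<le> n"
  shows "dihedral (True, 0) (block n l) = block n (n - l)"
proof
  fix k
  have b: "0 \<le> k mod int n" "k mod int n < int n" using n by simp_all
  have "(- 1 - k) mod int n = (int n - 1 - k mod int n) mod int n"
  proof -
    have "(int n - 1 - k mod int n) mod int n = (int n - 1 - k) mod int n" by (rule mod_diff_right_eq)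
    also have "int n - 1 - k = (- 1 - k) + int n" by simp
    finally show ?thesis by simp
  qed
  also have "\<dots> = int n - 1 - k mod int n" using b by (intro mod_pos_pos_trivial) auto
  finally show "dihedral (True, 0) (block n l) k = block n (n - l) k"
    using l by (auto simp: dihedral_def block_def of_nat_diff)
qed

lemma two_runs_orbit:
  assumes n: "n = Suc n'" and per: "periodic n s" and bad: "two_runs n s"
  obtains l where "l \<le> n" "cycle_action.orb n' s = cycle_action.orb n' (block n l)"
proof -
  have n0: "0 < n" using n by simp
  obtain a l where l: "0 \<le> l" "l \<le> int n" and t: "\<And>k. a \<le> k \<Longrightarrow> k < a + l \<Longrightarrow> s k"
    and f: "\<And>k. a + l \<le> k \<Longrightarrow> k < a + int n \<Longrightarrow> \<not> s k"
    using bad unfolding two_runs_def by blast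
  have "s k = dihedral (False, zmod n (- a)) (block n (nat l)) k" for k
  proof -
    define x where "x = (k - a) mod int n"
    have x: "0 \<le> x" "x < int n" using n0 by (simp_all add: x_def)
    have "s k = s (a + x)"
    proof -
      have "k = a + x + ((k - a) div int n) * int n" unfolding x_def by simp
      then show ?thesis using periodic_shift[OF per, of "a + x" "(k - a) div int n"] by simp
    qed
    also have "\<dots> \<longleftrightarrow> x < l"
    proof (cases "x < l")
      case True
      then show ?thesis using t[of "a + x"] x by simp
    next
      case False
      then show ?thesis using f[of "a + x"] x by simp
    qed
    also have "\<dots> \<longleftrightarrow> block n (nat l) (k - a)" using l by (simp add: block_def x_def)
    also have "\<dots> \<longleftrightarrow> dihedral (False, zmod n (- a)) (block n (nat l)) k"
      using periodic_zmod[OF n0 periodic_block, where k = k and x = "- a"] by (simp add: dihedral_def)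
    finally show ?thesis .
  qed
  then have "s = dihedral (False, zmod n (- a)) (block n (nat l))" by (rule ext)
  moreover have "zmod n (- a) < Suc n'" using zmod_less[OF n0] n by simp
  ultimately have "s \<in> cycle_action.orb n' (block n (nat l))"
    unfolding cycle_action.orb_def by (intro image_eqI[of _ _ "(False, zmod n (- a))"]) auto
  then have "cycle_action.orb n' s = cycle_action.orb n' (block n (nat l))"
    using periodic_block[of n] n by (intro cycle_action.orb_eq) auto
  then show ?thesis using that[of "nat l"] l by simp
qed

text \<open>Rotation brings a two-run word to a block of some length \<open>l\<close>, reflection
  identifies \<open>l\<close> with \<open>n - l\<close>, and the weight tells the remaining lengths
  up to \<open>n div 2\<close> apart.\<close>

lemma card_two_runs_orbits:
  assumes n: "n = Suc n'"
  shows "card (cycle_action.orb n' ` {s. periodic n s \<and> two_runs n s}) = n div 2 + 1"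
proof -
  have n0: "0 < n" using n by simp
  let ?o = "\<lambda>l. cycle_action.orb n' (block n l)"
  have mem: "block n l \<in> {s. periodic (Suc n') s}" for l using periodic_block[of n l] n by simp
  have refl: "?o (n - l) = ?o l" if "l \<le> n" for l
  proof (rule cycle_action.orb_eq[OF mem])
    show "block n (n - l) \<in> ?o l"
      unfolding cycle_action.orb_def block_reflect[OF n0 that, symmetric] by (intro imageI) auto
  qed
  have "cycle_action.orb n' ` {s. periodic n s \<and> two_runs n s} = ?o ` {0..n div 2}"
  proof (intro equalityI subsetI)
    fix u assume "u \<in> cycle_action.orb n' ` {s. periodic n s \<and> two_runs n s}"
    then obtain s where s: "u = cycle_action.orb n' s" "periodic n s" "two_runs n s" by blast
    obtain l where l: "l \<le> n" "u = ?o l" using two_runs_orbit[OF n s(2,3)] s(1) by metis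
    show "u \<in> ?o ` {0..n div 2}"
    proof (cases "l \<le> n div 2")
      case True
      then show ?thesis using l by auto
    next
      case False
      then have "n - l \<le> n div 2" using l(1) by linarith
      then show ?thesis using l refl[OF l(1)] by auto
    qed
  next
    fix u assume "u \<in> ?o ` {0..n div 2}"
    then obtain l where l: "l \<le> n div 2" "u = ?o l" by auto
    then have "l \<le> n" by linarith
    then show "u \<in> cycle_action.orb n' ` {s. periodic n s \<and> two_runs n s}"
      using l periodic_block two_runs_block by blast
  qed
  moreover have "inj_on ?o {0..n div 2}"
  proof (rule inj_onI)
    fix l l' assume l: "l \<in> {0..n div 2}" "l' \<in> {0..n div 2}" "?o l = ?o l'"
    then have ln: "l \<le> n" "l' \<le> n" by auto
    have "block n l \<in> ?o l'" using cycle_action.orb_self[OF mem] l(3) by blast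
    then obtain g where g: "block n l = dihedral g (block n l')" by (auto simp: cycle_action.orb_def)
    have "weight n (block n l) = weight n (dihedral g (block n l'))" by (simp only: g)
    then have "l = (if fst g then n - l' else l')"
      unfolding weight_dihedral[OF n0 periodic_block] weight_block[OF ln(1)] weight_block[OF ln(2)] .
    then show "l = l'" using l by (auto split: if_splits)
  qed
  ultimately show ?thesis by (simp add: card_image)
qed

lemma card_good_orbits:
  assumes n: "n = Suc n'"
  shows "card (cycle_action.orb n' ` {s. periodic n s \<and> \<not> two_runs n s}) + (n div 2 + 1)
    = card (cycle_action.orb n' ` {s. periodic n s})"
proof -
  let ?g = "{s. periodic n s \<and> \<not> two_runs n s}" and ?b = "{s. periodic n s \<and> two_runs n s}"
  have fin: "finite {s. periodic n s}" using card_periodic(1) n by simp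
  have "{s. periodic n s} = ?g \<union> ?b" by auto
  then have u: "cycle_action.orb n' ` {s. periodic n s} = cycle_action.orb n' ` ?g \<union> cycle_action.orb n' ` ?b"
    by (simp only: image_Un)
  have "finite ?g" "finite ?b" using fin by (auto intro: finite_subset)
  moreover have "cycle_action.orb n' ` ?g \<inter> cycle_action.orb n' ` ?b = {}"
  proof (rule ccontr)
    assume "\<not> ?thesis"
    then obtain s s' where s: "s \<in> ?g" "s' \<in> ?b" "cycle_action.orb n' s = cycle_action.orb n' s'" by blast
    then have "s \<in> cycle_action.orb n' s'" using cycle_action.orb_self[of s n'] n by auto
    then obtain g where "s = dihedral g s'" by (auto simp: cycle_action.orb_def)
    then show False using s two_runs_dihedral by auto
  qed
  ultimately show ?thesis unfolding u card_two_runs_orbits[OF n, symmetric]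
    by (intro card_Un_disjoint[symmetric] finite_imageI)
qed

text \<open>Group the rotations by their gcd \<open>d\<close> with \<open>n\<close>: there are
  \<open>totient (n div d)\<close> of them. The shift 0 is counted as \<open>n\<close>, since both
  have gcd \<open>n\<close>; finally divisors are replaced by their complements.\<close>

lemma sum_gcd_totient:
  assumes n: "0 < n"
  shows "(\<Sum>c<n. 2 ^ gcd n c) = (\<Sum>d | d dvd n. 2 ^ (n div d) * totient d)"
proof -
  have "(\<Sum>c<n. 2 ^ gcd n c :: nat) = (\<Sum>c\<in>{0<..n}. 2 ^ gcd c n)"
    by (rule sum.reindex_bij_witness[of _ "\<lambda>c. if c = n then 0 else c" "\<lambda>c. if c = 0 then n else c"])
      (use n in \<open>auto simp: gcd.commute\<close>)
  also have "\<dots> = (\<Sum>d\<in>{d. d dvd n}. \<Sum>c\<in>{c \<in> {0<..n}. gcd c n = d}. 2 ^ gcd c n)"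
    using n by (intro sum.group[symmetric]) auto
  also have "\<dots> = (\<Sum>d | d dvd n. 2 ^ d * totient (n div d))"
    using card_gcd_eq_totient[OF n] by (intro sum.cong) (auto simp: mult.commute)
  also have "\<dots> = (\<Sum>d | d dvd n. 2 ^ (n div d) * totient d)"
    by (rule sum.reindex_bij_witness[of _ "\<lambda>d. n div d" "\<lambda>d. n div d"])
      (use n in \<open>auto simp: div_dvd_iff_mult dvd_div_eq_mult elim!: dvdE\<close>)
  finally show ?thesis .
qed

subsection \<open>The number of isomorphism classes\<close>

definition iso_class :: "nat \<Rightarrow> (nat \<times> nat) set \<Rightarrow> (nat \<times> nat) set set" where
  "iso_class n R = {S. poset_iso n R S}"

lemma iso_class_eq_iff: "iso_class n R = iso_class n S \<longleftrightarrow> poset_iso n R S"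
  unfolding iso_class_def using poset_iso_refl poset_iso_sym poset_iso_trans by blast

lemma Nneg_A_card: "Nneg_A n = card (iso_class n ` NnegA_posets n)"
proof -
  have "NnegA_posets n // {(R, S). poset_iso n R S} = iso_class n ` NnegA_posets n"
    by (auto simp: quotient_def iso_class_def)
  then show ?thesis by (simp add: Nneg_A_def)
qed

lemma NnegA_posets_iff:
  assumes n: "1 \<le> n"
  shows "R \<in> NnegA_posets n \<longleftrightarrow> is_poset n R \<and> connected_poset n R \<and> (\<exists>t h. arrow_rep n R t h)"
  using type_A_iff_arrow_rep[OF _ _ n] by (auto simp: NnegA_posets_def)

lemma iso_classes:
  assumes n: "1 \<le> n"
  shows "iso_class n ` NnegA_posets n = (\<lambda>s. iso_class n (path_poset n s)) ` path_words n \<union>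
    (if 3 \<le> n then (\<lambda>s. iso_class n (cycle_poset n s)) ` {s. periodic n s \<and> \<not> two_runs n s} else {})"
proof (intro equalityI subsetI)
  fix u assume "u \<in> iso_class n ` NnegA_posets n"
  then obtain R t h where R: "u = iso_class n R" "is_poset n R" "connected_poset n R" "arrow_rep n R t h"
    using NnegA_posets_iff[OF n] by blast
  from arrow_rep_classification[OF n R(2-4)]
  show "u \<in> (\<lambda>s. iso_class n (path_poset n s)) ` path_words n \<union>
    (if 3 \<le> n then (\<lambda>s. iso_class n (cycle_poset n s)) ` {s. periodic n s \<and> \<not> two_runs n s} else {})"
  proof
    assume "\<exists>s. poset_iso n R (path_poset n s)"
    then obtain s where s: "poset_iso n R (path_poset n s)" ..
    let ?s = "\<lambda>k. 0 \<le> k \<and> k < int n - 1 \<and> s k"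
    have "path_poset n s = path_poset n ?s" by (rule path_poset_cong) simp
    moreover have "u = iso_class n (path_poset n s)" using s R(1) iso_class_eq_iff by blast
    ultimately have "u = iso_class n (path_poset n ?s)" by simp
    moreover have "?s \<in> path_words n" by (simp add: path_words_def)
    ultimately show ?thesis by (intro UnI1 image_eqI)
  next
    assume "3 \<le> n \<and> (\<exists>s. periodic n s \<and> \<not> two_runs n s \<and> poset_iso n R (cycle_poset n s))"
    then obtain s where n3: "3 \<le> n" and s: "periodic n s" "\<not> two_runs n s" "poset_iso n R (cycle_poset n s)" by blast
    have "u = iso_class n (cycle_poset n s)" using s R(1) iso_class_eq_iff by blast
    moreover have "s \<in> {s. periodic n s \<and> \<not> two_runs n s}" using s by simp
    ultimately have "u \<in> (\<lambda>s. iso_class n (cycle_poset n s)) ` {s. periodic n s \<and> \<not> two_runs n s}"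
      by (rule image_eqI)
    then show ?thesis using n3 by simp
  qed
next
  fix u assume "u \<in> (\<lambda>s. iso_class n (path_poset n s)) ` path_words n \<union>
    (if 3 \<le> n then (\<lambda>s. iso_class n (cycle_poset n s)) ` {s. periodic n s \<and> \<not> two_runs n s} else {})"
  then consider s where "u = iso_class n (path_poset n s)"
    | s where "3 \<le> n" "periodic n s" "\<not> two_runs n s" "u = iso_class n (cycle_poset n s)"
    by (auto split: if_splits)
  then show "u \<in> iso_class n ` NnegA_posets n"
  proof cases
    case 1
    have "path_poset n s \<in> NnegA_posets n"
      unfolding NnegA_posets_iff[OF n] using path_poset_is_poset path_poset_connected path_poset_arrow_rep by blast
    then show ?thesis using 1 by simp
  next
    case 2
    have "0 < n" using n by simp
    then have "cycle_poset n s \<in> NnegA_posets n"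
      unfolding NnegA_posets_iff[OF n]
      using cycle_poset_is_poset cycle_poset_connected cycle_poset_arrow_rep 2 by blast
    then show ?thesis using 2 by simp
  qed
qed

lemma path_orb_iff:
  assumes n: "1 \<le> n" and s: "s \<in> path_words n" "s' \<in> path_words n"
  shows "poset_iso n (path_poset n s) (path_poset n s') \<longleftrightarrow> path_action.orb n s = path_action.orb n s'"
proof -
  have "s \<in> path_action.orb n s' \<longleftrightarrow> s = s' \<or> s = path_flip n True s'"
    unfolding path_action.orb_def unfolding UNIV_bool by (auto simp: path_flip_def)
  moreover have "s = s' \<longleftrightarrow> (\<forall>k. 0 \<le> k \<and> k < int n - 1 \<longrightarrow> s k = s' k)"
    using s by (auto simp: path_words_def fun_eq_iff)
  moreover have "s = path_flip n True s' \<longleftrightarrow> (\<forall>k. 0 \<le> k \<and> k < int n - 1 \<longrightarrow> s k = (\<not> s' (int n - 2 - k)))"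
    using s by (auto simp: path_words_def path_flip_def fun_eq_iff)
  ultimately show ?thesis using path_iso_iff[OF n] path_action.orb_eq_iff[OF s] by simp
qed

lemma cycle_orb_iff:
  assumes n: "3 \<le> n" "n = Suc n'" and s: "periodic n s" "\<not> two_runs n s" "periodic n s'" "\<not> two_runs n s'"
  shows "poset_iso n (cycle_poset n s) (cycle_poset n s') \<longleftrightarrow> cycle_action.orb n' s = cycle_action.orb n' s'"
proof -
  have "s \<in> cycle_action.orb n' s' \<longleftrightarrow> (\<exists>c<n. s = dihedral (False, c) s' \<or> s = dihedral (True, c) s')"
    unfolding cycle_action.orb_def n(2) by (auto simp: UNIV_bool)
  also have "\<dots> \<longleftrightarrow> (\<exists>c\<in>{0..<int n}. (\<forall>k. s k = s' (k + c)) \<or> (\<forall>k. s k = (\<not> s' (c - 1 - k))))"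
  proof -
    have "(\<exists>c\<in>{0..<int n}. P c) \<longleftrightarrow> (\<exists>c<n. P (int c))" for P
      by (metis atLeastLessThan_iff of_nat_0_le_iff of_nat_less_iff zero_le_imp_eq_int)
    then show ?thesis by (simp add: dihedral_def fun_eq_iff)
  qed
  finally show ?thesis
    using cycle_iso_iff[OF n(1) s(1,3,2,4)] cycle_action.orb_eq_iff[of s n' s'] s n(2) by simp
qed

lemma Nneg_A_orbits:
  assumes n: "n = Suc n'"
  shows "Nneg_A n = card (path_action.orb n ` path_words n) +
    (if 3 \<le> n then card (cycle_action.orb n' ` {s. periodic n s \<and> \<not> two_runs n s}) else 0)"
proof -
  have n1: "1 \<le> n" using n by simp
  let ?P = "(\<lambda>s. iso_class n (path_poset n s)) ` path_words n"
  let ?g = "{s. periodic n s \<and> \<not> two_runs n s}"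
  let ?C = "(\<lambda>s. iso_class n (cycle_poset n s)) ` ?g"
  have P: "card ?P = card (path_action.orb n ` path_words n)"
    by (rule card_image_kernel) (simp add: iso_class_eq_iff path_orb_iff[OF n1])
  show ?thesis
  proof (cases "3 \<le> n")
    case False
    then show ?thesis using P by (simp add: Nneg_A_card iso_classes[OF n1])
  next
    case True
    have C: "card ?C = card (cycle_action.orb n' ` ?g)"
      by (rule card_image_kernel) (simp add: iso_class_eq_iff cycle_orb_iff[OF True n])
    have "?P \<inter> ?C = {}" using path_not_iso_cycle[OF True] iso_class_eq_iff by blast
    moreover have "finite ?P" using card_path_words(1) by simp
    moreover have "finite ?C" using card_periodic(1)[of n] n by (auto intro: finite_subset)
    ultimately have "card (?P \<union> ?C) = card ?P + card ?C" by (intro card_Un_disjoint)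
    then show ?thesis using P C True by (simp add: Nneg_A_card iso_classes[OF n1])
  qed
qed

text \<open>\<open>p\<close> counts paths and \<open>q\<close> all orbits of cycle words, the
  excluded two-run orbits included. The terms are arranged so that neither subtraction nor division
  of natural numbers by the unknown counts occurs.\<close>

lemma Nneg_A_equation:
  assumes n: "3 \<le> n"
  obtains p q :: nat where "Nneg_A n + (n div 2 + 1) = p + q"
    "2 * p = 2 ^ (n - 1) + (if odd n then 2 ^ ((n - 1) div 2) else 0)"
    "q * (2 * n) = (\<Sum>c<n. 2 ^ gcd n c) + (if even n then (n div 2) * 2 ^ (n div 2) else 0)"
proof -
  obtain n' where n': "n = Suc n'" using n by (cases n) auto
  have n1: "1 \<le> n" using n by simp
  show ?thesis
  proof (rule that)
    show "Nneg_A n + (n div 2 + 1) = card (path_action.orb n ` path_words n)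
        + card (cycle_action.orb n' ` {s. periodic n s})"
      using Nneg_A_orbits[OF n'] card_good_orbits[OF n'] n by simp
  qed (rule card_path_orbits[OF n1], rule card_cycle_orbits[OF n'])
qed

section \<open>The closed formula and its first values\<close>

lemma Nneg_A_small:
  assumes "n = 1 \<or> n = 2"
  shows "Nneg_A n = 1"
proof -
  have "2 * Nneg_A n = 2 ^ (n - 1) + (if odd n then 2 ^ ((n - 1) div 2) else 0)"
    using assms Nneg_A_orbits[of n "n - 1"] card_path_orbits[of n] by auto
  then show ?thesis using assms by auto
qed

lemma ceiling_half: "\<lceil>(real n + 1) / 2\<rceil> = int (n div 2 + 1)"
proof (cases "even n")
  case True
  then obtain m where "n = 2 * m" by (rule evenE)
  then show ?thesis by (intro ceiling_unique) auto
next
  case False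
  then obtain m where "n = 2 * m + 1" by (rule oddE)
  then show ?thesis by (intro ceiling_unique) auto
qed

text \<open>The isolated power of 2 has different origins: for odd \<open>n\<close> it comes from
  the self-opposite paths, for even \<open>n\<close> from the reflections of the cycle, as
  \<open>(n / 2) * 2 ^ (n / 2)\<close> divided by \<open>2 * n\<close>. The ceiling is the number of
  excluded orbits.\<close>

lemma Nneg_A_formula:
  assumes n: "3 \<le> n"
  shows "real (Nneg_A n) = 2 ^ (n - 2) + (1 / (2 * real n)) * (\<Sum>d | d dvd n. 2 ^ (n div d) * real (totient d))
    + (if odd n then 2 ^ ((n - 3) div 2) else 2 ^ (n div 2 - 2)) - real_of_int \<lceil>(real n + 1) / 2\<rceil>"
proof -
  obtain p q :: nat where N: "Nneg_A n + (n div 2 + 1) = p + q"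
    and p: "2 * p = 2 ^ (n - 1) + (if odd n then 2 ^ ((n - 1) div 2) else 0)"
    and q: "q * (2 * n) = (\<Sum>c<n. 2 ^ gcd n c) + (if even n then (n div 2) * 2 ^ (n div 2) else 0)"
    by (rule Nneg_A_equation[OF n])
  let ?S = "\<Sum>d | d dvd n. 2 ^ (n div d) * real (totient d)"
  have n0: "0 < n" using n by simp
  have S: "real (\<Sum>c<n. 2 ^ gcd n c) = ?S" unfolding sum_gcd_totient[OF n0] by simp
  have N': "real (Nneg_A n) = real p + real q - real_of_int \<lceil>(real n + 1) / 2\<rceil>"
    unfolding ceiling_half using N by linarith
  show ?thesis
  proof (cases "odd n")
    case True
    then obtain m where "n = 2 * m + 1" by (rule oddE)
    then obtain m' where m: "n = 2 * m' + 3" using n by (cases m) auto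
    have "2 * p = 2 * (2 ^ (n - 2) + 2 ^ ((n - 3) div 2))" using p True m by simp
    then have "real p = 2 ^ (n - 2) + 2 ^ ((n - 3) div 2)" by (metis mult_left_cancel of_nat_add of_nat_numeral of_nat_power zero_neq_numeral)
    moreover have "real q * (2 * real n) = ?S" using arg_cong[OF q, of real] S True by simp
    then have "real q = (1 / (2 * real n)) * ?S" using n0 by (simp add: field_simps)
    ultimately show ?thesis using N' True by simp
  next
    case False
    then obtain k where k: "n = 2 * k" by auto
    then have "2 \<le> k" using n by simp
    then obtain m' where "k = 2 + m'" by (auto simp: le_iff_add)
    then have m: "n = 2 * (m' + 2)" using k by simp
    have "2 * p = 2 * 2 ^ (n - 2)" using p False m by simp
    then have "real p = 2 ^ (n - 2)" by simp
    moreover have "real q * (2 * real n) = ?S + real (n div 2) * 2 ^ (n div 2)"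
      using arg_cong[OF q, of real] S False by simp
    then have "real q = (1 / (2 * real n)) * ?S + 2 ^ (n div 2 - 2)"
      using m by (simp add: field_simps power_add)
    ultimately show ?thesis using N' False by simp
  qed
qed

text \<open>The equations determine the two counts, so supplying their values turns each numerical
  claim into evaluations without division by \<open>n\<close>.\<close>

lemma Nneg_A_eqI:
  assumes "3 \<le> n" "2 * p = 2 ^ (n - 1) + (if odd n then 2 ^ ((n - 1) div 2) else 0)"
    "q * (2 * n) = (\<Sum>c<n. 2 ^ gcd n c) + (if even n then (n div 2) * 2 ^ (n div 2) else 0)"
    "v + (n div 2 + 1) = p + q"
  shows "Nneg_A n = v"
proof -
  obtain p' q' :: nat where N: "Nneg_A n + (n div 2 + 1) = p' + q'"
    and p: "2 * p' = 2 ^ (n - 1) + (if odd n then 2 ^ ((n - 1) div 2) else 0)"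
    and q: "q' * (2 * n) = (\<Sum>c<n. 2 ^ gcd n c) + (if even n then (n div 2) * 2 ^ (n div 2) else 0)"
    by (rule Nneg_A_equation[OF assms(1)])
  have "p' = p" using p assms(2) by simp
  moreover have "q' * (2 * n) = q * (2 * n)" using q assms(3) by simp
  then have "q' = q" using assms(1) by simp
  ultimately show ?thesis using N assms(4) by simp
qed

theorem theorem5p7:
  shows "(\<forall>n::nat. 1 \<le> n \<longrightarrow>
      real (Nneg_A n) =
        (if n \<le> 2 then 1
         else 2 ^ (n - 2) + (1 / (2 * real n)) * (\<Sum>d | d dvd n. 2 ^ (n div d) * real (totient d))
              + (if odd n then 2 ^ ((n - 3) div 2) else 2 ^ (n div 2 - 2))
              - real_of_int \<lceil>(real n + 1) / 2\<rceil>))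
    \<and> map Nneg_A [1..<22] = [1, 1, 3, 5, 11, 21, 42, 81, 161, 312, 616, 1209, 2389, 4711,
                              9344, 18497, 36743, 72955, 145116, 288633, 574729]"
  (is "?A \<and> map Nneg_A [1..<22] = ?L")
proof
  show ?A
  proof (intro allI impI)
    fix n :: nat assume "1 \<le> n"
    then show "real (Nneg_A n) = (if n \<le> 2 then 1
      else 2 ^ (n - 2) + (1 / (2 * real n)) * (\<Sum>d | d dvd n. 2 ^ (n div d) * real (totient d))
        + (if odd n then 2 ^ ((n - 3) div 2) else 2 ^ (n div 2 - 2)) - real_of_int \<lceil>(real n + 1) / 2\<rceil>)"
      using Nneg_A_small[of n] Nneg_A_formula[of n] by (cases "n = 1 \<or> n = 2") auto
  qed
  have "Nneg_A 1 = 1" "Nneg_A 2 = 1" by (simp_all add: Nneg_A_small)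
  moreover have "Nneg_A 3 = 3"
    by (rule Nneg_A_eqI[of _ 3 2]; (simp add: sum_less_numeral gcd_non_0_nat)?)
  moreover have "Nneg_A 4 = 5"
    by (rule Nneg_A_eqI[of _ 4 4]; (simp add: sum_less_numeral gcd_non_0_nat)?)
  moreover have "Nneg_A 5 = 11"
    by (rule Nneg_A_eqI[of _ 10 4]; (simp add: sum_less_numeral gcd_non_0_nat)?)
  moreover have "Nneg_A 6 = 21"
    by (rule Nneg_A_eqI[of _ 16 9]; (simp add: sum_less_numeral gcd_non_0_nat)?)
  moreover have "Nneg_A 7 = 42"
    by (rule Nneg_A_eqI[of _ 36 10]; (simp add: sum_less_numeral gcd_non_0_nat)?)
  moreover have "Nneg_A 8 = 81"
    by (rule Nneg_A_eqI[of _ 64 22]; (simp add: sum_less_numeral gcd_non_0_nat)?)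
  moreover have "Nneg_A 9 = 161"
    by (rule Nneg_A_eqI[of _ 136 30]; (simp add: sum_less_numeral gcd_non_0_nat)?)
  moreover have "Nneg_A 10 = 312"
    by (rule Nneg_A_eqI[of _ 256 62]; (simp add: sum_less_numeral gcd_non_0_nat)?)
  moreover have "Nneg_A 11 = 616"
    by (rule Nneg_A_eqI[of _ 528 94]; (simp add: sum_less_numeral gcd_non_0_nat)?)
  moreover have "Nneg_A 12 = 1209"
    by (rule Nneg_A_eqI[of _ 1024 192]; (simp add: sum_less_numeral gcd_non_0_nat)?)
  moreover have "Nneg_A 13 = 2389"
    by (rule Nneg_A_eqI[of _ 2080 316]; (simp add: sum_less_numeral gcd_non_0_nat)?)
  moreover have "Nneg_A 14 = 4711"
    by (rule Nneg_A_eqI[of _ 4096 623]; (simp add: sum_less_numeral gcd_non_0_nat)?)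
  moreover have "Nneg_A 15 = 9344"
    by (rule Nneg_A_eqI[of _ 8256 1096]; (simp add: sum_less_numeral gcd_non_0_nat)?)
  moreover have "Nneg_A 16 = 18497"
    by (rule Nneg_A_eqI[of _ 16384 2122]; (simp add: sum_less_numeral gcd_non_0_nat)?)
  moreover have "Nneg_A 17 = 36743"
    by (rule Nneg_A_eqI[of _ 32896 3856]; (simp add: sum_less_numeral gcd_non_0_nat)?)
  moreover have "Nneg_A 18 = 72955"
    by (rule Nneg_A_eqI[of _ 65536 7429]; (simp add: sum_less_numeral gcd_non_0_nat)?)
  moreover have "Nneg_A 19 = 145116"
    by (rule Nneg_A_eqI[of _ 131328 13798]; (simp add: sum_less_numeral gcd_non_0_nat)?)
  moreover have "Nneg_A 20 = 288633"
    by (rule Nneg_A_eqI[of _ 262144 26500]; (simp add: sum_less_numeral gcd_non_0_nat)?)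
  moreover have "Nneg_A 21 = 574729"
    by (rule Nneg_A_eqI[of _ 524800 49940]; (simp add: sum_less_numeral gcd_non_0_nat)?)
  moreover have "[1..<22] = [1, 2, 3, 4, 5, 6, 7, 8, 9, 10, 11, 12, 13, 14, 15, 16, 17, 18, 19, 20, 21 :: nat]"
    by (simp add: upt_rec)
  ultimately show "map Nneg_A [1..<22] = ?L" by simp
qed

end
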